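(* The operator $\mathcal{A}:V_0\to L^2(Q)\times L^2(Q)^d\times L^2(\Omega)\times L^2(\Omega)^d$, $$\mathcal{A}(v,\boldsymbol\sigma)=(\partial_t v-\mathrm{div}_x\boldsymbol\sigma,\ \partial_t\boldsymbol\sigma-\nabla_x v,\ v(0),\ \boldsymbol\sigma(0)),$$ is an isomorphism (a bounded linear bijection with bounded inverse, $V_0$ carrying the norm $\|\cdot\|_V$). In particular, $$\|(v,\boldsymbol\sigma)\|_{L^2(Q)\times L^2(Q)^d}\lesssim\|\mathcal{A}(v,\boldsymbol\sigma)\|_{L^2(Q)^{1+d}\times L^2(\Omega)^{1+d}}\quad\text{for all }(v,\boldsymbol\sigma)\in V_0.$$
   Context: $\Omega\subset\mathbb{R}^d$ is a bounded polygonal Lipschitz domain, $T>0$, $J=(0,T)$, $Q=J\times\Omega$; $L^2(Q)$ is identified with $L^2(J;L^2(\Omega))$; $(\cdot,\cdot)_Q,(\cdot,\cdot)_\Omega$ are $L^2$ inner products. $H^{-1}(\Omega)$ is the dual of $H^1_0(\Omega)$ w.r.t. the extended $L^2(\Omega)$ pairing. $\partial_t,\nabla_x,\mathrm{div}_x,\Delta_x$ are distributional derivatives on $Q$. $\widetilde V=\{(v,\boldsymbol\sigma)\in L^2(Q)\times L^2(Q)^d\mid \partial_t v-\mathrm{div}_x\boldsymbol\sigma\in L^2(Q),\ \partial_t\boldsymbol\sigma-\nabla_x v\in L^2(Q)^d\}$ with graph norm $\|(v,\boldsymbol\sigma)\|_{\widetilde V}^2=\|v\|^2_{L^2(Q)}+\|\boldsymbol\sigma\|^2_{L^2(Q)^d}+\|\partial_t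 v-\mathrm{div}_x\boldsymbol\sigma\|^2_{L^2(Q)}+\|\partial_t\boldsymbol\sigma-\nabla_x v\|^2_{L^2(Q)^d}$. Every element of $\widetilde V$ satisfies $v\in H^1(J;H^{-1}(\Omega))$, $\boldsymbol\sigma\in H^1(J;H^{-1}(\Omega)^d)$, so $v(0)\in H^{-1}(\Omega)$, $\boldsymbol\sigma(0)\in H^{-1}(\Omega)^d$ are defined (via continuous representatives). Let $V=\{(v,\boldsymbol\sigma)\in\widetilde V\mid v(0)\in L^2(\Omega),\ \boldsymbol\sigma(0)\in L^2(\Omega)^d\}$ with $\|(v,\boldsymbol\sigma)\|_V^2=\|(v,\boldsymbol\sigma)\|_{\widetilde V}^2+\|v(0)\|_{L^2(\Omega)}^2+\|\boldsymbol\sigma(0)\|_{L^2(\Omega)^d}^2$. Let $Y=\{\varphi\in H^1(J;H^1_0(\Omega))\cap H^2(J;L^2(\Omega))\mid\Delta_x\varphi\in L^2(Q),\ \varphi(T)=0,\ \partial_t\varphi(T)=0\}$ and, for $(v,\boldsymbol\sigma)\in V$, $\varphi\in Y$, $D(v,\boldsymbol\sigma)(\varphi)=(\partial_t\boldsymbol\sigma-\nabla_x v,\nabla_x\varphi)_Q+(\boldsymbol\sigma,\nabla_x\partial_t\varphi)_Q-(v,\Delta_x\varphi)_Q+(\boldsymbol\sigma(0),\nabla_x\varphi(0))_\Omega$. Set $V_0=\{(v,\boldsymbol\sigma)\in V\mid D(v,\boldsymbol\sigma)(\varphi)=0\ \forall\varphi\in Y\}$ (a weak encoding of the homogeneous Dirichlet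 condition $v=0$ on $J\times\partial\Omega$), normed by $\|\cdot\|_V$. $a\lesssim b$ means $a\le Cb$ with $C$ independent of $(v,\boldsymbol\sigma)$. *)

theory Defs
  imports "HOL-Analysis.Analysis"
begin

definition lipschitz_domain :: "(real^'d) set \<Rightarrow> bool" where
  "lipschitz_domain \<Omega> \<longleftrightarrow> open \<Omega> \<and> connected \<Omega> \<and> bounded \<Omega> \<and> \<Omega> \<noteq> {} \<and>
     (\<forall>z\<in>frontier \<Omega>. \<exists>r>0. \<exists>(R::real^'d \<Rightarrow> real^'d) (i::'d) (h::real^'d \<Rightarrow> real) L. orthogonal_transformation R \<and> lipschitz_on L UNIV h \<and>
        (\<forall>y c. h (y + c *\<^sub>R axis i 1) = h y) \<and>
        \<Omega> \<inter> ball z r = {x \<in> ball z r. (R x) $ i < h (R x)})"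

definition polygonal :: "(real^'d) set \<Rightarrow> bool" where
  "polygonal \<Omega> \<longleftrightarrow> (\<exists>H. finite H \<and> (\<forall>S\<in>H. \<exists>a b. a \<noteq> 0 \<and> S = {x. a \<bullet> x = b}) \<and>
     frontier \<Omega> \<subseteq> \<Union>H)"

definition polygonal_lipschitz_domain :: "(real^'d) set \<Rightarrow> bool" where
  "polygonal_lipschitz_domain \<Omega> \<longleftrightarrow> lipschitz_domain \<Omega> \<and> polygonal \<Omega>"

fun pderivs :: "'a::euclidean_space list \<Rightarrow> ('a \<Rightarrow> real) \<Rightarrow> 'a \<Rightarrow> real" where
  "pderivs [] f = f"
| "pderivs (v # vs) f = (\<lambda>x. frechet_derivative (pderivs vs f) (at x) v)"

definition smooth_fun :: "('a::euclidean_space \<Rightarrow> real) \<Rightarrow> bool" where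
  "smooth_fun f \<longleftrightarrow> (\<forall>vs x. pderivs vs f differentiable (at x))"

definition test_fun :: "'a::euclidean_space set \<Rightarrow> ('a \<Rightarrow> real) \<Rightarrow> bool" where
  "test_fun U \<phi> \<longleftrightarrow> smooth_fun \<phi> \<and> compact (closure {x. \<phi> x \<noteq> 0}) \<and> closure {x. \<phi> x \<noteq> 0} \<subseteq> U"

definition dt :: "(real \<times> (real^'d) \<Rightarrow> real) \<Rightarrow> real \<times> (real^'d) \<Rightarrow> real" where
  "dt \<phi> = pderivs [(1, 0)] \<phi>"

definition gradx :: "(real \<times> (real^'d) \<Rightarrow> real) \<Rightarrow> real \<times> (real^'d) \<Rightarrow> real^'d" where
  "gradx \<phi> p = (\<chi> i. pderivs [(0, axis i 1)] \<phi> p)"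

definition lapx :: "(real \<times> (real^'d) \<Rightarrow> real) \<Rightarrow> real \<times> (real^'d) \<Rightarrow> real" where
  "lapx \<phi> p = (\<Sum>i\<in>UNIV. pderivs [(0, axis i 1), (0, axis i 1)] \<phi> p)"

definition L2 :: "'a::euclidean_space set \<Rightarrow> ('a \<Rightarrow> 'b::euclidean_space) \<Rightarrow> bool" where
  "L2 S f \<longleftrightarrow> f \<in> borel_measurable (lebesgue_on S) \<and> integrable (lebesgue_on S) (\<lambda>x. (norm (f x))\<^sup>2)"

abbreviation intg :: "'a::euclidean_space set \<Rightarrow> ('a \<Rightarrow> 'b::euclidean_space) \<Rightarrow> 'b" where
  "intg S f \<equiv> integral\<^sup>L (lebesgue_on S) f"

definition cyl :: "real \<Rightarrow> (real^'d) set \<Rightarrow> (real \<times> (real^'d)) set" where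
  "cyl T \<Omega> = {0<..<T} \<times> \<Omega>"

definition is_dtdiv :: "(real \<times> (real^'d)) set \<Rightarrow> _ \<Rightarrow> _ \<Rightarrow> _ \<Rightarrow> bool" where
  "is_dtdiv Q v \<sigma> f \<longleftrightarrow> (\<forall>\<phi>. test_fun Q \<phi> \<longrightarrow>
     intg Q (\<lambda>p. f p * \<phi> p) = intg Q (\<lambda>p. - (v p * dt \<phi> p) + \<sigma> p \<bullet> gradx \<phi> p))"

definition is_dtgrad :: "(real \<times> (real^'d)) set \<Rightarrow> _ \<Rightarrow> _ \<Rightarrow> _ \<Rightarrow> bool" where
  "is_dtgrad Q \<sigma> v g \<longleftrightarrow> (\<forall>\<phi>. test_fun Q \<phi> \<longrightarrow>
     intg Q (\<lambda>p. \<phi> p *\<^sub>R g p) = intg Q (\<lambda>p. - (dt \<phi> p *\<^sub>R \<sigma> p) + v p *\<^sub>R gradx \<phi> p))"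

text \<open>v0 = v(0) (continuous H^{-1} representative), characterised by integration by parts
  against test functions supported in (-\<infinity>,T) x \<Omega>.\<close>
definition is_trace0_v :: "real \<Rightarrow> (real^'d) set \<Rightarrow> _ \<Rightarrow> _ \<Rightarrow> _ \<Rightarrow> _ \<Rightarrow> bool" where
  "is_trace0_v T \<Omega> v \<sigma> f v0 \<longleftrightarrow> (\<forall>\<phi>. test_fun ({..<T} \<times> \<Omega>) \<phi> \<longrightarrow>
     intg \<Omega> (\<lambda>x. v0 x * \<phi> (0, x)) =
     intg (cyl T \<Omega>) (\<lambda>p. - (v p * dt \<phi> p) + \<sigma> p \<bullet> gradx \<phi> p - f p * \<phi> p))"

definition is_trace0_sigma :: "real \<Rightarrow> (real^'d) set \<Rightarrow> _ \<Rightarrow> _ \<Rightarrow> _ \<Rightarrow> _ \<Rightarrow> bool" where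
  "is_trace0_sigma T \<Omega> \<sigma> v g \<sigma>0 \<longleftrightarrow> (\<forall>\<phi>. test_fun ({..<T} \<times> \<Omega>) \<phi> \<longrightarrow>
     intg \<Omega> (\<lambda>x. \<phi> (0, x) *\<^sub>R \<sigma>0 x) =
     intg (cyl T \<Omega>) (\<lambda>p. - (dt \<phi> p *\<^sub>R \<sigma> p) + v p *\<^sub>R gradx \<phi> p - \<phi> p *\<^sub>R g p))"

text \<open>(v,\<sigma>) \<in> V with A(v,\<sigma>) = (f, g, v0, \<sigma>0).\<close>
definition inV :: "real \<Rightarrow> (real^'d) set \<Rightarrow> (real \<times> (real^'d) \<Rightarrow> real) \<Rightarrow> (real \<times> (real^'d) \<Rightarrow> real^'d)
    \<Rightarrow> (real \<times> (real^'d) \<Rightarrow> real) \<Rightarrow> (real \<times> (real^'d) \<Rightarrow> real^'d) \<Rightarrow> (real^'d \<Rightarrow> real) \<Rightarrow> (real^'d \<Rightarrow> real^'d) \<Rightarrow> bool" where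
  "inV T \<Omega> v \<sigma> f g v0 \<sigma>0 \<longleftrightarrow>
     L2 (cyl T \<Omega>) v \<and> L2 (cyl T \<Omega>) \<sigma> \<and> L2 (cyl T \<Omega>) f \<and> L2 (cyl T \<Omega>) g \<and> L2 \<Omega> v0 \<and> L2 \<Omega> \<sigma>0 \<and>
     is_dtdiv (cyl T \<Omega>) v \<sigma> f \<and> is_dtgrad (cyl T \<Omega>) \<sigma> v g \<and>
     is_trace0_v T \<Omega> v \<sigma> f v0 \<and> is_trace0_sigma T \<Omega> \<sigma> v g \<sigma>0"

definition weak_dt :: "(real \<times> (real^'d)) set \<Rightarrow> (real \<times> (real^'d) \<Rightarrow> 'b::euclidean_space) \<Rightarrow> _ \<Rightarrow> bool" where
  "weak_dt Q u w \<longleftrightarrow> (\<forall>\<phi>. test_fun Q \<phi> \<longrightarrow> intg Q (\<lambda>p. \<phi> p *\<^sub>R w p) = - intg Q (\<lambda>p. dt \<phi> p *\<^sub>R u p))"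

definition weak_grad :: "(real \<times> (real^'d)) set \<Rightarrow> (real \<times> (real^'d) \<Rightarrow> real) \<Rightarrow> _ \<Rightarrow> bool" where
  "weak_grad Q u G \<longleftrightarrow> (\<forall>\<phi>. test_fun Q \<phi> \<longrightarrow> intg Q (\<lambda>p. \<phi> p *\<^sub>R G p) = - intg Q (\<lambda>p. u p *\<^sub>R gradx \<phi> p))"

definition weak_lap :: "(real \<times> (real^'d)) set \<Rightarrow> (real \<times> (real^'d) \<Rightarrow> real) \<Rightarrow> _ \<Rightarrow> bool" where
  "weak_lap Q u L \<longleftrightarrow> (\<forall>\<phi>. test_fun Q \<phi> \<longrightarrow> intg Q (\<lambda>p. L p * \<phi> p) = intg Q (\<lambda>p. u p * lapx \<phi> p))"

text \<open>u \<in> L2(J;H^1_0(\<Omega>)) (with G = grad_x u): u is a limit of C-infinity functions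
  compactly supported in Q in the L2(J;H^1(\<Omega>)) norm.\<close>
definition zero_bc :: "(real \<times> (real^'d)) set \<Rightarrow> (real \<times> (real^'d) \<Rightarrow> real) \<Rightarrow> (real \<times> (real^'d) \<Rightarrow> real^'d) \<Rightarrow> bool" where
  "zero_bc Q u G \<longleftrightarrow> (\<exists>s. (\<forall>n. test_fun Q (s n)) \<and>
     (\<lambda>n. intg Q (\<lambda>p. (s n p - u p)\<^sup>2 + (norm (gradx (s n) p - G p))\<^sup>2)) \<longlonglongrightarrow> 0)"

text \<open>u(T) = 0 where w = \<partial>t u (u \<in> H^1(J;L2(\<Omega>))).\<close>
definition zero_at_T :: "real \<Rightarrow> (real^'d) set \<Rightarrow> (real \<times> (real^'d) \<Rightarrow> real) \<Rightarrow> _ \<Rightarrow> bool" where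
  "zero_at_T T \<Omega> u w \<longleftrightarrow> (\<forall>\<psi>. test_fun ({0<..} \<times> \<Omega>) \<psi> \<longrightarrow>
     intg (cyl T \<Omega>) (\<lambda>p. w p * \<psi> p) = - intg (cyl T \<Omega>) (\<lambda>p. u p * dt \<psi> p))"

text \<open>G0 = G(0) where H = \<partial>t G (G \<in> H^1(J;L2(\<Omega>)^d)).\<close>
definition trace0_vec :: "real \<Rightarrow> (real^'d) set \<Rightarrow> (real \<times> (real^'d) \<Rightarrow> real^'d) \<Rightarrow> _ \<Rightarrow> _ \<Rightarrow> bool" where
  "trace0_vec T \<Omega> G H G0 \<longleftrightarrow> (\<forall>\<psi>. test_fun ({..<T} \<times> \<Omega>) \<psi> \<longrightarrow>
     intg \<Omega> (\<lambda>x. \<psi> (0, x) *\<^sub>R G0 x) = - intg (cyl T \<Omega>) (\<lambda>p. dt \<psi> p *\<^sub>R G p + \<psi> p *\<^sub>R H p))"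

definition inY :: "real \<Rightarrow> (real^'d) set \<Rightarrow> (real \<times> (real^'d) \<Rightarrow> real) \<Rightarrow> (real \<times> (real^'d) \<Rightarrow> real)
    \<Rightarrow> (real \<times> (real^'d) \<Rightarrow> real) \<Rightarrow> (real \<times> (real^'d) \<Rightarrow> real^'d) \<Rightarrow> (real \<times> (real^'d) \<Rightarrow> real^'d)
    \<Rightarrow> (real \<times> (real^'d) \<Rightarrow> real) \<Rightarrow> (real^'d \<Rightarrow> real^'d) \<Rightarrow> bool" where
  "inY T \<Omega> \<phi> \<phi>t \<phi>tt G Gt L G0 \<longleftrightarrow>
     L2 (cyl T \<Omega>) \<phi> \<and> L2 (cyl T \<Omega>) \<phi>t \<and> L2 (cyl T \<Omega>) \<phi>tt \<and> L2 (cyl T \<Omega>) G \<and>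
     L2 (cyl T \<Omega>) Gt \<and> L2 (cyl T \<Omega>) L \<and> L2 \<Omega> G0 \<and>
     weak_dt (cyl T \<Omega>) \<phi> \<phi>t \<and> weak_dt (cyl T \<Omega>) \<phi>t \<phi>tt \<and>
     weak_grad (cyl T \<Omega>) \<phi> G \<and> weak_grad (cyl T \<Omega>) \<phi>t Gt \<and> weak_lap (cyl T \<Omega>) \<phi> L \<and>
     zero_bc (cyl T \<Omega>) \<phi> G \<and> zero_bc (cyl T \<Omega>) \<phi>t Gt \<and>
     zero_at_T T \<Omega> \<phi> \<phi>t \<and> zero_at_T T \<Omega> \<phi>t \<phi>tt \<and>
     trace0_vec T \<Omega> G Gt G0"

definition inV0 :: "real \<Rightarrow> (real^'d) set \<Rightarrow> (real \<times> (real^'d) \<Rightarrow> real) \<Rightarrow> (real \<times> (real^'d) \<Rightarrow> real^'d)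
    \<Rightarrow> (real \<times> (real^'d) \<Rightarrow> real) \<Rightarrow> (real \<times> (real^'d) \<Rightarrow> real^'d) \<Rightarrow> (real^'d \<Rightarrow> real) \<Rightarrow> (real^'d \<Rightarrow> real^'d) \<Rightarrow> bool" where
  "inV0 T \<Omega> v \<sigma> f g v0 \<sigma>0 \<longleftrightarrow> inV T \<Omega> v \<sigma> f g v0 \<sigma>0 \<and>
     (\<forall>\<phi> \<phi>t \<phi>tt G Gt L G0. inY T \<Omega> \<phi> \<phi>t \<phi>tt G Gt L G0 \<longrightarrow>
        intg (cyl T \<Omega>) (\<lambda>p. g p \<bullet> G p) + intg (cyl T \<Omega>) (\<lambda>p. \<sigma> p \<bullet> Gt p)
        - intg (cyl T \<Omega>) (\<lambda>p. v p * L p) + intg \<Omega> (\<lambda>x. \<sigma>0 x \<bullet> G0 x) = 0)"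

definition normA :: "real \<Rightarrow> (real^'d) set \<Rightarrow> (real \<times> (real^'d) \<Rightarrow> real) \<Rightarrow> (real \<times> (real^'d) \<Rightarrow> real^'d)
    \<Rightarrow> (real^'d \<Rightarrow> real) \<Rightarrow> (real^'d \<Rightarrow> real^'d) \<Rightarrow> real" where
  "normA T \<Omega> f g v0 \<sigma>0 = sqrt (intg (cyl T \<Omega>) (\<lambda>p. (f p)\<^sup>2) + intg (cyl T \<Omega>) (\<lambda>p. (norm (g p))\<^sup>2)
     + intg \<Omega> (\<lambda>x. (v0 x)\<^sup>2) + intg \<Omega> (\<lambda>x. (norm (\<sigma>0 x))\<^sup>2))"

definition normL2Q :: "real \<Rightarrow> (real^'d) set \<Rightarrow> (real \<times> (real^'d) \<Rightarrow> real) \<Rightarrow> (real \<times> (real^'d) \<Rightarrow> real^'d) \<Rightarrow> real" where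
  "normL2Q T \<Omega> v \<sigma> = sqrt (intg (cyl T \<Omega>) (\<lambda>p. (v p)\<^sup>2) + intg (cyl T \<Omega>) (\<lambda>p. (norm (\<sigma> p))\<^sup>2))"

definition normV :: "real \<Rightarrow> (real^'d) set \<Rightarrow> (real \<times> (real^'d) \<Rightarrow> real) \<Rightarrow> (real \<times> (real^'d) \<Rightarrow> real^'d)
    \<Rightarrow> (real \<times> (real^'d) \<Rightarrow> real) \<Rightarrow> (real \<times> (real^'d) \<Rightarrow> real^'d) \<Rightarrow> (real^'d \<Rightarrow> real) \<Rightarrow> (real^'d \<Rightarrow> real^'d) \<Rightarrow> real" where
  "normV T \<Omega> v \<sigma> f g v0 \<sigma>0 = sqrt ((normL2Q T \<Omega> v \<sigma>)\<^sup>2 + (normA T \<Omega> f g v0 \<sigma>0)\<^sup>2)"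

end

theory Submission
  imports Defs
begin

text \<open>The adjoint of the wave operator satisfies an energy estimate on test pairs \<open>(w, \<tau>)\<close> that vanish at time \<open>T\<close>,
  obtained by pairing it with \<open>t (w, \<tau>)\<close>. By the Riesz representation theorem (Lions' projection method) this gives
  a weak solution for all data, bounded by the data; the class of test pairs contains \<open>(0, \<nabla>\<phi>)\<close> for \<open>\<phi> \<in> Y\<close>, which
  is the boundary condition. For uniqueness, a solution with zero data is replaced by its primitives in time, which
  are regular enough for the usual energy argument as soon as \<open>v\<close> satisfies the boundary condition in
  \<open>L\<^sup>2(J; H\<^sup>1\<^sub>0(\<Omega>))\<close>. The latter follows from the weak condition tested with an elliptic solution, integrated twice in
  time.\<close>

section \<open>Square-integrable functions\<close>

text \<open>Two obstacles shape the argument. Square-integrable functions are kept as functions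
  rather than as classes modulo null sets, so a linear functional is carried by a linear relation
  between functions and numbers, and limits are fixed only almost everywhere. And a pair in V has no
  boundary trace, so an energy identity cannot be applied to it directly. In the estimate for the
  adjoint, the weight t removes the unknown values at time 0, while the test pair itself vanishes at
  T; half the squared norm of the pair is left, which is the origin of the factor 2 * T. For
  uniqueness it is the values at time 0 that vanish, so the mirror weight T - t is used. Two
  primitives in time are taken there: one integration turns \<sigma> into the gradient of the
  primitive of v, and the second matches the two time derivatives in the definition of Y, whose
  elements are obtained by integrating an elliptic solution twice backwards from T. Both end
  conditions at T then hold by construction.\<close>

definition ip :: "'a::euclidean_space set \<Rightarrow> ('a \<Rightarrow> 'b::euclidean_space) \<Rightarrow> ('a \<Rightarrow> 'b) \<Rightarrow> real" where
  "ip S f g = intg S (\<lambda>x. f x \<bullet> g x)"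

definition nrm :: "'a::euclidean_space set \<Rightarrow> ('a \<Rightarrow> 'b::euclidean_space) \<Rightarrow> real" where
  "nrm S f = sqrt (ip S f f)"

lemma L2_measurable [measurable_dest]: "L2 S f \<Longrightarrow> f \<in> borel_measurable (lebesgue_on S)"
  by (simp add: L2_def)

lemma L2_sq: "L2 S f \<Longrightarrow> integrable (lebesgue_on S) (\<lambda>x. (norm (f x))\<^sup>2)"
  by (simp add: L2_def)

lemma L2_zero [simp]: "L2 S (\<lambda>x. 0)"
  by (simp add: L2_def)

lemma L2_add:
  assumes "L2 S f" "L2 S g" shows "L2 S (\<lambda>x. f x + g x)"
  unfolding L2_def
proof
  note [measurable] = assms[THEN L2_measurable]
  show m: "(\<lambda>x. f x + g x) \<in> borel_measurable (lebesgue_on S)" by measurable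
  show "integrable (lebesgue_on S) (\<lambda>x. (norm (f x + g x))\<^sup>2)"
  proof (rule Bochner_Integration.integrable_bound)
    show "integrable (lebesgue_on S) (\<lambda>x. 2 * (norm (f x))\<^sup>2 + 2 * (norm (g x))\<^sup>2)"
      by (intro Bochner_Integration.integrable_add integrable_mult_right L2_sq assms)
    show "AE x in lebesgue_on S. norm ((norm (f x + g x))\<^sup>2) \<le> norm (2 * (norm (f x))\<^sup>2 + 2 * (norm (g x))\<^sup>2)"
    proof (rule AE_I2)
      fix x
      have "(norm (f x + g x))\<^sup>2 \<le> (norm (f x) + norm (g x))\<^sup>2"
        by (intro power_mono norm_triangle_ineq) auto
      also have "\<dots> \<le> 2 * (norm (f x))\<^sup>2 + 2 * (norm (g x))\<^sup>2"
        using sum_squares_bound[of "norm (f x)" "norm (g x)"] by (simp add: power2_sum)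
      finally show "norm ((norm (f x + g x))\<^sup>2) \<le> norm (2 * (norm (f x))\<^sup>2 + 2 * (norm (g x))\<^sup>2)" by simp
    qed
  qed (use m in measurable)
qed

lemma L2_bounded_mult:
  assumes f: "L2 S f" and m: "m \<in> borel_measurable (lebesgue_on S)" and B: "\<And>x. x \<in> S \<Longrightarrow> \<bar>m x\<bar> \<le> B"
  shows "L2 S (\<lambda>x. m x *\<^sub>R f x)"
  unfolding L2_def
proof
  note [measurable] = f[THEN L2_measurable] m
  show "(\<lambda>x. m x *\<^sub>R f x) \<in> borel_measurable (lebesgue_on S)" by measurable
  show "integrable (lebesgue_on S) (\<lambda>x. (norm (m x *\<^sub>R f x))\<^sup>2)"
  proof (rule Bochner_Integration.integrable_bound)
    show "integrable (lebesgue_on S) (\<lambda>x. B\<^sup>2 * (norm (f x))\<^sup>2)"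
      using L2_sq[OF f] by auto
    show "AE x in lebesgue_on S. norm ((norm (m x *\<^sub>R f x))\<^sup>2) \<le> norm (B\<^sup>2 * (norm (f x))\<^sup>2)"
    proof (rule AE_I2)
      fix x assume "x \<in> space (lebesgue_on S)"
      then have "\<bar>m x\<bar> \<le> B" using B by simp
      then have "\<bar>m x\<bar>\<^sup>2 \<le> B\<^sup>2" by (intro power_mono) auto
      then show "norm ((norm (m x *\<^sub>R f x))\<^sup>2) \<le> norm (B\<^sup>2 * (norm (f x))\<^sup>2)"
        by (simp add: power_mult_distrib mult_right_mono)
    qed
  qed measurable
qed

lemma L2_scaleR: "L2 S f \<Longrightarrow> L2 S (\<lambda>x. c *\<^sub>R f x)"
  by (rule L2_bounded_mult[where B="\<bar>c\<bar>"]) auto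

lemma L2_mult_left: "L2 S f \<Longrightarrow> L2 S (\<lambda>x. c * (f x :: real))"
  using L2_scaleR[of S f c] by simp

lemma L2_minus: "L2 S f \<Longrightarrow> L2 S (\<lambda>x. - f x)"
  using L2_scaleR[of S f "-1"] by simp

lemma L2_diff: "L2 S f \<Longrightarrow> L2 S g \<Longrightarrow> L2 S (\<lambda>x. f x - g x)"
  using L2_add[of S f "\<lambda>x. - g x"] L2_minus[of S g] by simp

lemma L2_integrable_inner:
  assumes "L2 S f" "L2 S g" shows "integrable (lebesgue_on S) (\<lambda>x. f x \<bullet> g x)"
proof (rule Bochner_Integration.integrable_bound)
  note [measurable] = assms[THEN L2_measurable]
  show "integrable (lebesgue_on S) (\<lambda>x. (norm (f x))\<^sup>2 + (norm (g x))\<^sup>2)"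
    by (intro Bochner_Integration.integrable_add L2_sq assms)
  show "(\<lambda>x. f x \<bullet> g x) \<in> borel_measurable (lebesgue_on S)" by measurable
  show "AE x in lebesgue_on S. norm (f x \<bullet> g x) \<le> norm ((norm (f x))\<^sup>2 + (norm (g x))\<^sup>2)"
  proof (rule AE_I2)
    fix x
    have "\<bar>f x \<bullet> g x\<bar> \<le> norm (f x) * norm (g x)" by (rule Cauchy_Schwarz_ineq2)
    also have "\<dots> \<le> 2 * norm (f x) * norm (g x)" by (simp add: mult_nonneg_nonneg)
    also have "\<dots> \<le> (norm (f x))\<^sup>2 + (norm (g x))\<^sup>2" by (rule sum_squares_bound)
    finally show "norm (f x \<bullet> g x) \<le> norm ((norm (f x))\<^sup>2 + (norm (g x))\<^sup>2)" by simp
  qed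
qed

lemma L2_integrable_mult:
  assumes "L2 S f" "L2 S g" shows "integrable (lebesgue_on S) (\<lambda>x. f x * g x :: real)"
  using L2_integrable_inner[OF assms] by simp

lemma L2_component:
  assumes "L2 S f" shows "L2 S (\<lambda>x. f x \<bullet> b)"
  unfolding L2_def
proof
  note [measurable] = assms[THEN L2_measurable]
  show "(\<lambda>x. f x \<bullet> b) \<in> borel_measurable (lebesgue_on S)" by measurable
  show "integrable (lebesgue_on S) (\<lambda>x. (norm (f x \<bullet> b))\<^sup>2)"
  proof (rule Bochner_Integration.integrable_bound)
    show "integrable (lebesgue_on S) (\<lambda>x. (norm b)\<^sup>2 * (norm (f x))\<^sup>2)"
      using L2_sq[OF assms] by auto
    show "AE x in lebesgue_on S. norm ((norm (f x \<bullet> b))\<^sup>2) \<le> norm ((norm b)\<^sup>2 * (norm (f x))\<^sup>2)"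
    proof (rule AE_I2)
      fix x
      have "\<bar>f x \<bullet> b\<bar>\<^sup>2 \<le> (norm (f x) * norm b)\<^sup>2" by (intro power_mono Cauchy_Schwarz_ineq2) auto
      then show "norm ((norm (f x \<bullet> b))\<^sup>2) \<le> norm ((norm b)\<^sup>2 * (norm (f x))\<^sup>2)"
        by (simp add: power_mult_distrib mult.commute)
    qed
  qed measurable
qed

lemma L2_sum:
  assumes "finite I" "\<And>i. i \<in> I \<Longrightarrow> L2 S (f i)" shows "L2 S (\<lambda>x. \<Sum>i\<in>I. f i x)"
  using assms by (induction I rule: finite_induct) (auto intro: L2_add)

lemma L2_real_scaleR_const:
  assumes "L2 S (f :: _ \<Rightarrow> real)" shows "L2 S (\<lambda>x. f x *\<^sub>R b)"
  unfolding L2_def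
proof
  note [measurable] = assms[THEN L2_measurable]
  show "(\<lambda>x. f x *\<^sub>R b) \<in> borel_measurable (lebesgue_on S)" by measurable
  show "integrable (lebesgue_on S) (\<lambda>x. (norm (f x *\<^sub>R b))\<^sup>2)"
    using L2_sq[OF assms] by (simp add: power_mult_distrib)
qed

lemma L2_vec:
  assumes "\<And>i. L2 S (\<lambda>x. f x $ i)" shows "L2 S (f :: _ \<Rightarrow> real^'n)"
proof -
  have eq: "(\<lambda>x. \<Sum>i\<in>UNIV. (f x $ i) *\<^sub>R axis i 1) = f"
    by (rule ext) (simp add: vec_eq_iff axis_def if_distrib cong: if_cong)
  have "L2 S (\<lambda>x. \<Sum>i\<in>UNIV. (f x $ i) *\<^sub>R (axis i 1 :: real^'n))"
    by (intro L2_sum L2_real_scaleR_const assms) auto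
  then show ?thesis unfolding eq .
qed

lemma L2_nth: "L2 S (f :: _ \<Rightarrow> real^'n) \<Longrightarrow> L2 S (\<lambda>x. f x $ i)"
  using L2_component[of S f "axis i 1"] by (simp add: inner_axis)

lemma L2_Pair:
  assumes "L2 S f" "L2 S g" shows "L2 S (\<lambda>x. (f x, g x))"
  unfolding L2_def
proof
  note [measurable] = assms[THEN L2_measurable]
  show "(\<lambda>x. (f x, g x)) \<in> borel_measurable (lebesgue_on S)" by measurable
  show "integrable (lebesgue_on S) (\<lambda>x. (norm (f x, g x))\<^sup>2)"
    using L2_sq[OF assms(1)] L2_sq[OF assms(2)] by (simp add: norm_Pair)
qed

lemma L2_fst: assumes "L2 S f" shows "L2 S (\<lambda>x. fst (f x))"
  unfolding L2_def
proof
  note [measurable] = assms[THEN L2_measurable]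
  show m: "(\<lambda>x. fst (f x)) \<in> borel_measurable (lebesgue_on S)"
    by (rule borel_measurable_continuous_on[OF _ L2_measurable[OF assms]]) (intro continuous_intros)
  show "integrable (lebesgue_on S) (\<lambda>x. (norm (fst (f x)))\<^sup>2)"
    by (rule Bochner_Integration.integrable_bound[OF L2_sq[OF assms]])
      (use m in \<open>auto simp: norm_prod_def\<close>)
qed

lemma L2_snd: assumes "L2 S f" shows "L2 S (\<lambda>x. snd (f x))"
  unfolding L2_def
proof
  note [measurable] = assms[THEN L2_measurable]
  show m: "(\<lambda>x. snd (f x)) \<in> borel_measurable (lebesgue_on S)"
    by (rule borel_measurable_continuous_on[OF _ L2_measurable[OF assms]]) (intro continuous_intros)
  show "integrable (lebesgue_on S) (\<lambda>x. (norm (snd (f x)))\<^sup>2)"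
    by (rule Bochner_Integration.integrable_bound[OF L2_sq[OF assms]])
      (use m in \<open>auto simp: norm_prod_def\<close>)
qed

lemma ip_commute: "ip S f g = ip S g f"
  by (simp add: ip_def inner_commute)

lemma ip_add_left: "L2 S f \<Longrightarrow> L2 S g \<Longrightarrow> L2 S h \<Longrightarrow> ip S (\<lambda>x. f x + g x) h = ip S f h + ip S g h"
  by (simp add: ip_def inner_add_left L2_integrable_inner)

lemma ip_diff_left: "L2 S f \<Longrightarrow> L2 S g \<Longrightarrow> L2 S h \<Longrightarrow> ip S (\<lambda>x. f x - g x) h = ip S f h - ip S g h"
  by (simp add: ip_def inner_diff_left L2_integrable_inner)

lemma ip_scaleR_left: "ip S (\<lambda>x. c *\<^sub>R f x) h = c * ip S f h"
  by (simp add: ip_def)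

lemma ip_minus_left: "ip S (\<lambda>x. - f x) h = - ip S f h"
  by (simp add: ip_def)

lemma ip_add_right: "L2 S f \<Longrightarrow> L2 S g \<Longrightarrow> L2 S h \<Longrightarrow> ip S h (\<lambda>x. f x + g x) = ip S h f + ip S h g"
  by (simp add: ip_def inner_add_right L2_integrable_inner)

lemma ip_diff_right: "L2 S f \<Longrightarrow> L2 S g \<Longrightarrow> L2 S h \<Longrightarrow> ip S h (\<lambda>x. f x - g x) = ip S h f - ip S h g"
  by (simp add: ip_def inner_diff_right L2_integrable_inner)

lemma ip_scaleR_right: "ip S h (\<lambda>x. c *\<^sub>R f x) = c * ip S h f"
  by (simp add: ip_def)

lemma ip_minus_right: "ip S h (\<lambda>x. - f x) = - ip S h f"
  by (simp add: ip_def)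

lemma ip_zero [simp]: "ip S (\<lambda>x. 0) h = 0" "ip S h (\<lambda>x. 0) = 0"
  by (simp_all add: ip_def)

lemma ip_Pair:
  assumes "L2 S f" "L2 S g" "L2 S f'" "L2 S g'"
  shows "ip S (\<lambda>x. (f x, g x)) (\<lambda>x. (f' x, g' x)) = ip S f f' + ip S g g'"
  using assms by (simp add: ip_def L2_integrable_inner)

lemma ip_vec:
  assumes "L2 S f" "L2 S g" 
  shows "ip S f (g :: _ \<Rightarrow> real^'n) = (\<Sum>i\<in>UNIV. ip S (\<lambda>x. f x $ i) (\<lambda>x. g x $ i))"
  unfolding ip_def inner_vec_def
  by (rule Bochner_Integration.integral_sum) (intro L2_integrable_inner L2_nth assms)

lemma ip_AE_cong:
  assumes "L2 S f" "L2 S g" "L2 S h" "AE x in lebesgue_on S. f x = g x"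
  shows "ip S f h = ip S g h"
  unfolding ip_def
proof (rule integral_cong_AE)
  note [measurable] = assms(1-3)[THEN L2_measurable]
  show "(\<lambda>x. f x \<bullet> h x) \<in> borel_measurable (lebesgue_on S)" "(\<lambda>x. g x \<bullet> h x) \<in> borel_measurable (lebesgue_on S)"
    by measurable
  show "AE x in lebesgue_on S. f x \<bullet> h x = g x \<bullet> h x" using assms(4) by auto
qed

lemma ip_self_nonneg: "0 \<le> ip S f f"
  by (simp add: ip_def integral_nonneg_AE)

lemma nrm_nonneg [simp]: "0 \<le> nrm S f"
  by (simp add: nrm_def ip_self_nonneg)

lemma nrm_sq: "(nrm S f)\<^sup>2 = ip S f f"
  by (simp add: nrm_def ip_self_nonneg)

lemma ip_self: "ip S f f = intg S (\<lambda>x. (norm (f x))\<^sup>2)"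
  by (simp add: ip_def power2_norm_eq_inner)

lemma nrm_zero_AE:
  assumes "L2 S f" "nrm S f = 0" shows "AE x in lebesgue_on S. f x = 0"
proof -
  have "intg S (\<lambda>x. (norm (f x))\<^sup>2) = 0" using assms(2) by (simp add: nrm_def ip_self)
  then have "AE x in lebesgue_on S. (norm (f x))\<^sup>2 = 0"
    using integral_nonneg_eq_0_iff_AE[OF L2_sq[OF assms(1)]] by simp
  then show ?thesis by simp
qed

lemma ip_add_self:
  assumes "L2 S f" "L2 S g"
  shows "ip S (\<lambda>x. f x + t *\<^sub>R g x) (\<lambda>x. f x + t *\<^sub>R g x) = ip S f f + 2 * t * ip S f g + t\<^sup>2 * ip S g g"
proof -
  have "L2 S (\<lambda>x. t *\<^sub>R g x)" "L2 S (\<lambda>x. f x + t *\<^sub>R g x)" using assms by (auto intro: L2_scaleR L2_add)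
  then show ?thesis using assms
    by (simp add: ip_add_left ip_add_right ip_scaleR_left ip_scaleR_right ip_commute[of S g f] power2_eq_square algebra_simps)
qed

text \<open>The discriminant criterion, including the degenerate case \<open>C = 0\<close>, so that
  it serves twice: with squared norms as \<open>A\<close> and \<open>C\<close> it is Cauchy-Schwarz,
  and with \<open>A = 0\<close> it says that the first variation at a minimiser vanishes.\<close>

lemma quadratic_nonneg_imp:
  fixes A B C :: real
  assumes "\<And>t. 0 \<le> A + 2 * t * B + t\<^sup>2 * C" "0 \<le> C"
  shows "B\<^sup>2 \<le> A * C"
proof (cases "C = 0")
  case True
  have "B = 0"
  proof (rule ccontr)
    assume "B \<noteq> 0"
    \<comment> \<open>With \<open>C = 0\<close> the polynomial is affine in \<open>t\<close>; this
      choice makes its value -1.\<close>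
    then show False using assms(1)[of "- (A + 1) / (2 * B)"] True by (simp add: field_simps)
  qed
  then show ?thesis using True by simp
next
  case False
  then have "C > 0" using assms(2) by simp
  \<comment> \<open>The point \<open>t = - B / C\<close> is the minimiser; the factor
    \<open>C\<close> clears denominators.\<close>
  have "0 \<le> C * (A + 2 * (- B / C) * B + (- B / C)\<^sup>2 * C)"
    using assms(1)[of "- B / C"] assms(2) by (intro mult_nonneg_nonneg) auto
  also have "\<dots> = A * C - B\<^sup>2" using \<open>C > 0\<close> by (simp add: field_simps power2_eq_square)
  finally show ?thesis by simp
qed

lemma ip_Cauchy_Schwarz:
  assumes "L2 S f" "L2 S g" shows "\<bar>ip S f g\<bar> \<le> nrm S f * nrm S g"
proof -
  have "(ip S f g)\<^sup>2 \<le> ip S f f * ip S g g"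
    by (rule quadratic_nonneg_imp) (use ip_add_self[OF assms] ip_self_nonneg in metis)+
  then have "sqrt ((ip S f g)\<^sup>2) \<le> sqrt (ip S f f * ip S g g)" by (rule real_sqrt_le_mono)
  then show ?thesis by (simp add: nrm_def real_sqrt_mult)
qed

lemma nrm_triangle:
  assumes "L2 S f" "L2 S g" shows "nrm S (\<lambda>x. f x + g x) \<le> nrm S f + nrm S g"
proof (rule power2_le_imp_le)
  have "(nrm S (\<lambda>x. f x + g x))\<^sup>2 = (nrm S f)\<^sup>2 + 2 * ip S f g + (nrm S g)\<^sup>2"
    using ip_add_self[OF assms, of 1] by (simp add: nrm_sq)
  also have "\<dots> \<le> (nrm S f + nrm S g)\<^sup>2"
    using ip_Cauchy_Schwarz[OF assms] by (simp add: power2_sum)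
  finally show "(nrm S (\<lambda>x. f x + g x))\<^sup>2 \<le> (nrm S f + nrm S g)\<^sup>2" .
qed simp

lemma nrm_scaleR: "nrm S (\<lambda>x. c *\<^sub>R f x) = \<bar>c\<bar> * nrm S f"
  by (simp add: nrm_def ip_scaleR_left ip_scaleR_right real_sqrt_mult mult.assoc[symmetric])

lemma nrm_minus: "nrm S (\<lambda>x. - f x) = nrm S f"
  by (simp add: nrm_def ip_minus_left ip_minus_right)

lemma nrm_diff_commute: "nrm S (\<lambda>x. f x - g x) = nrm S (\<lambda>x. g x - f x)"
  using nrm_minus[of S "\<lambda>x. f x - g x"] by simp

lemma nrm_triangle_diff:
  assumes "L2 S f" "L2 S g" "L2 S h" 
  shows "nrm S (\<lambda>x. f x - h x) \<le> nrm S (\<lambda>x. f x - g x) + nrm S (\<lambda>x. g x - h x)"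
  using nrm_triangle[of S "\<lambda>x. f x - g x" "\<lambda>x. g x - h x"] assms by (simp add: L2_diff)

lemma abs_nrm_diff_le:
  assumes "L2 S f" "L2 S g" shows "\<bar>nrm S f - nrm S g\<bar> \<le> nrm S (\<lambda>x. f x - g x)"
  using nrm_triangle[of S g "\<lambda>x. f x - g x"] nrm_triangle[of S f "\<lambda>x. g x - f x"] 
    nrm_diff_commute[of S f g] assms by (simp add: L2_diff)

lemma nrm_bounded_mult:
  assumes f: "L2 S f" and m: "m \<in> borel_measurable (lebesgue_on S)" and B: "\<And>x. x \<in> S \<Longrightarrow> \<bar>m x\<bar> \<le> B"
  shows "nrm S (\<lambda>x. m x *\<^sub>R f x) \<le> \<bar>B\<bar> * nrm S f"
proof (rule power2_le_imp_le)
  have "(nrm S (\<lambda>x. m x *\<^sub>R f x))\<^sup>2 = intg S (\<lambda>x. (norm (m x *\<^sub>R f x))\<^sup>2)"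
    by (simp only: nrm_sq ip_self)
  also have "\<dots> \<le> intg S (\<lambda>x. B\<^sup>2 * (norm (f x))\<^sup>2)"
  proof (rule integral_mono)
    show "integrable (lebesgue_on S) (\<lambda>x. (norm (m x *\<^sub>R f x))\<^sup>2)"
      using L2_sq[OF L2_bounded_mult[OF f m B]] .
    show "integrable (lebesgue_on S) (\<lambda>x. B\<^sup>2 * (norm (f x))\<^sup>2)" using L2_sq[OF f] by auto
    fix x assume "x \<in> space (lebesgue_on S)"
    then have "\<bar>m x\<bar>\<^sup>2 \<le> B\<^sup>2" using B by (intro power_mono) auto
    then show "(norm (m x *\<^sub>R f x))\<^sup>2 \<le> B\<^sup>2 * (norm (f x))\<^sup>2"
      by (simp add: power_mult_distrib mult_right_mono)
  qed
  also have "\<dots> = (\<bar>B\<bar> * nrm S f)\<^sup>2" by (simp add: power_mult_distrib nrm_sq ip_self)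
  finally show "(nrm S (\<lambda>x. m x *\<^sub>R f x))\<^sup>2 \<le> (\<bar>B\<bar> * nrm S f)\<^sup>2" .
qed simp

section \<open>Norm convergence and completeness\<close>

definition L2conv :: "'a::euclidean_space set \<Rightarrow> (nat \<Rightarrow> 'a \<Rightarrow> 'b::euclidean_space) \<Rightarrow> ('a \<Rightarrow> 'b) \<Rightarrow> bool" where
  "L2conv S X u \<longleftrightarrow> (\<forall>n. L2 S (X n)) \<and> L2 S u \<and> (\<lambda>n. nrm S (\<lambda>x. X n x - u x)) \<longlonglongrightarrow> 0"

lemma L2conv_nrm: "L2conv S X u \<Longrightarrow> (\<lambda>n. nrm S (X n)) \<longlonglongrightarrow> nrm S u"
proof -
  assume a: "L2conv S X u"
  have "(\<lambda>n. nrm S (X n) - nrm S u) \<longlonglongrightarrow> 0"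
    by (rule Lim_null_comparison[where g="\<lambda>n. nrm S (\<lambda>x. X n x - u x)"])
       (use a in \<open>auto simp: L2conv_def intro!: always_eventually abs_nrm_diff_le\<close>)
  then show ?thesis by (simp add: LIM_zero_iff)
qed

lemma L2conv_ip:
  assumes "L2conv S X u" "L2conv S Y w" shows "(\<lambda>n. ip S (X n) (Y n)) \<longlonglongrightarrow> ip S u w"
proof -
  have L: "\<And>n. L2 S (X n)" "\<And>n. L2 S (Y n)" "L2 S u" "L2 S w" using assms by (auto simp: L2conv_def)
  have "(\<lambda>n. ip S (X n) (Y n) - ip S u w) \<longlonglongrightarrow> 0"
  proof (rule Lim_null_comparison)
    show "\<forall>\<^sub>F n in sequentially. norm (ip S (X n) (Y n) - ip S u w) 
       \<le> nrm S (\<lambda>x. X n x - u x) * nrm S (Y n) + nrm S u * nrm S (\<lambda>x. Y n x - w x)"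
    proof (rule always_eventually, rule allI)
      fix n
      have "ip S (X n) (Y n) - ip S u w = ip S (\<lambda>x. X n x - u x) (Y n) + ip S u (\<lambda>x. Y n x - w x)"
        using L by (simp add: ip_diff_left ip_diff_right)
      then show "norm (ip S (X n) (Y n) - ip S u w) \<le> nrm S (\<lambda>x. X n x - u x) * nrm S (Y n) + nrm S u * nrm S (\<lambda>x. Y n x - w x)"
        using ip_Cauchy_Schwarz[of S "\<lambda>x. X n x - u x" "Y n"] ip_Cauchy_Schwarz[of S u "\<lambda>x. Y n x - w x"] L
        by (simp add: L2_diff)
    qed
    show "(\<lambda>n. nrm S (\<lambda>x. X n x - u x) * nrm S (Y n) + nrm S u * nrm S (\<lambda>x. Y n x - w x)) \<longlonglongrightarrow> 0"
      using assms L2conv_nrm[OF assms(2)] unfolding L2conv_def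
      by (intro tendsto_eq_intros | force)+
  qed
  then show ?thesis by (simp add: LIM_zero_iff)
qed

lemma L2conv_const: "L2 S u \<Longrightarrow> L2conv S (\<lambda>n. u) u"
  by (simp add: L2conv_def nrm_def)

lemma L2conv_bounded_mult:
  assumes "L2conv S X u" and m: "m \<in> borel_measurable (lebesgue_on S)" and B: "\<And>x. x \<in> S \<Longrightarrow> \<bar>m x\<bar> \<le> B"
  shows "L2conv S (\<lambda>n x. m x *\<^sub>R X n x) (\<lambda>x. m x *\<^sub>R u x)"
proof -
  have L: "\<And>n. L2 S (X n)" "L2 S u" using assms by (auto simp: L2conv_def)
  have "(\<lambda>n. nrm S (\<lambda>x. m x *\<^sub>R X n x - m x *\<^sub>R u x)) \<longlonglongrightarrow> 0"
  proof (rule Lim_null_comparison)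
    show "(\<lambda>n. \<bar>B\<bar> * nrm S (\<lambda>x. X n x - u x)) \<longlonglongrightarrow> 0"
      using assms(1) by (auto simp: L2conv_def intro!: tendsto_mult_right_zero)
    show "\<forall>\<^sub>F n in sequentially. norm (nrm S (\<lambda>x. m x *\<^sub>R X n x - m x *\<^sub>R u x)) \<le> \<bar>B\<bar> * nrm S (\<lambda>x. X n x - u x)"
      using nrm_bounded_mult[OF L2_diff[OF L(1) L(2)] m B] by (simp add: scaleR_diff_right)
  qed
  then show ?thesis unfolding L2conv_def using L by (auto intro: L2_bounded_mult[OF _ m B])
qed

text \<open>Phrased with the extended nonnegative integral because this is the form in which Fatou's
  lemma delivers a bound, before integrability of the limit is known.\<close>

lemma L2I_nrm:
  assumes m: "f \<in> borel_measurable (lebesgue_on S)" and "0 \<le> c"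
    and le: "(\<integral>\<^sup>+x. ennreal ((norm (f x))\<^sup>2) \<partial>lebesgue_on S) \<le> ennreal (c\<^sup>2)"
  shows "L2 S f" "nrm S f \<le> c"
proof -
  show L: "L2 S f" unfolding L2_def
    using m le_less_trans[OF le ennreal_less_top] by (auto intro!: integrableI_bounded)
  have "ennreal (ip S f f) = (\<integral>\<^sup>+x. ennreal ((norm (f x))\<^sup>2) \<partial>lebesgue_on S)"
    unfolding ip_self by (rule nn_integral_eq_integral[symmetric]) (use L2_sq[OF L] in auto)
  then have "ennreal (ip S f f) \<le> ennreal (c\<^sup>2)" using le by simp
  then have "(nrm S f)\<^sup>2 \<le> c\<^sup>2" by (simp add: nrm_sq)
  then show "nrm S f \<le> c" using \<open>0 \<le> c\<close> by (rule power2_le_imp_le)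
qed

lemma nn_integral_nrm:
  assumes "L2 S f"
  shows "(\<integral>\<^sup>+x. ennreal ((norm (f x))\<^sup>2) \<partial>lebesgue_on S) = ennreal ((nrm S f)\<^sup>2)"
  unfolding nrm_sq ip_self by (rule nn_integral_eq_integral) (use L2_sq[OF assms] in auto)

text \<open>Almost everywhere convergence is available only along a subsequence with geometrically
  small steps: the series of step lengths has norm at most 2 and is therefore finite almost
  everywhere. Fatou's lemma returns from the subsequence to the whole sequence.\<close>

theorem Riesz_Fischer:
  fixes X :: "nat \<Rightarrow> 'a::euclidean_space \<Rightarrow> 'b::euclidean_space"
  assumes L: "\<And>n. L2 S (X n)"
    and cauchy: "\<And>e. 0 < e \<Longrightarrow> \<exists>N. \<forall>m\<ge>N. \<forall>n\<ge>N. nrm S (\<lambda>x. X m x - X n x) < e"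
  obtains u where "L2conv S X u"
proof -
  note [measurable] = L[THEN L2_measurable]
  have "\<exists>N. \<forall>m\<ge>N. \<forall>n\<ge>N. nrm S (\<lambda>x. X m x - X n x) < (1/2)^k" for k :: nat
    by (rule cauchy) simp
  then obtain N where N: "\<And>k m n. m \<ge> N k \<Longrightarrow> n \<ge> N k \<Longrightarrow> nrm S (\<lambda>x. X m x - X n x) < (1/2)^k"
    by metis
  \<comment> \<open>A sum of thresholds dominates each of its summands, so both \<open>r n\<close>
    and \<open>r (Suc n)\<close> lie beyond \<open>N n\<close>.\<close>
  define r where "r n = (\<Sum>k\<le>n. N k)" for n
  have r: "N k \<le> r n" if "k \<le> n" for k n
    unfolding r_def using that by (intro member_le_sum) auto
  define D where "D n x = norm (X (r (Suc n)) x - X (r n) x)" for n x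
  have D_L2: "L2 S (D n)" for n
    using L2_sq[OF L2_diff[OF L L], of "r (Suc n)" "r n"] unfolding L2_def D_def by simp
  have D_nrm: "nrm S (D n) \<le> (1/2)^n" for n
  proof -
    have "nrm S (D n) = nrm S (\<lambda>x. X (r (Suc n)) x - X (r n) x)"
      by (simp add: nrm_def ip_self D_def)
    also have "\<dots> < (1/2)^n" by (rule N) (auto intro: r)
    finally show ?thesis by simp
  qed
  define G where "G k x = (\<Sum>n<k. D n x)" for k x
  have G_L2: "L2 S (G k)" for k unfolding G_def by (intro L2_sum D_L2) auto
  have G_nrm: "nrm S (G k) \<le> (\<Sum>n<k. (1/2)^n)" for k
  proof (induction k)
    case 0 then show ?case by (simp add: G_def nrm_def)
  next
    case (Suc k)
    have "nrm S (G (Suc k)) \<le> nrm S (G k) + nrm S (D k)"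
      using nrm_triangle[OF G_L2 D_L2, of k k] by (simp add: G_def[abs_def])
    then show ?case using Suc D_nrm[of k] by simp
  qed
  have G_nrm2: "nrm S (G k) \<le> 2" for k
  proof -
    have "(\<Sum>n<k. (1/2)^n) = (2::real) - 2 * (1/2)^k" by (induction k) auto
    then show ?thesis using G_nrm[of k] by (smt (verit) zero_le_power zero_le_divide_1_iff)
  qed
  \<comment> \<open>The value 4 is the square of the geometric sum 2; being uniform in
    \<open>k\<close>, it survives the supremum.\<close>
  have G_int: "(\<integral>\<^sup>+x. ennreal ((G k x)\<^sup>2) \<partial>lebesgue_on S) \<le> 4" for k
  proof -
    have "(nrm S (G k))\<^sup>2 \<le> 2\<^sup>2" by (intro power_mono G_nrm2) auto
    then have "ennreal ((nrm S (G k))\<^sup>2) \<le> ennreal 4" by (intro ennreal_leI) simp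
    then show ?thesis using nn_integral_nrm[OF G_L2, of k] by simp
  qed
  have D_nonneg: "0 \<le> D n x" for n x by (simp add: D_def)
  have G_mono: "G k x \<le> G (Suc k) x" "0 \<le> G k x" for k x
    using D_nonneg by (auto simp: G_def sum_nonneg)
  have inc: "incseq (\<lambda>k x. ennreal ((G k x)\<^sup>2))"
    by (intro incseq_SucI le_funI ennreal_leI power_mono G_mono)
  have [measurable]: "G k \<in> borel_measurable (lebesgue_on S)" for k by (rule L2_measurable[OF G_L2])
  have "(\<integral>\<^sup>+x. (SUP k. ennreal ((G k x)\<^sup>2)) \<partial>lebesgue_on S) = (SUP k. \<integral>\<^sup>+x. ennreal ((G k x)\<^sup>2) \<partial>lebesgue_on S)"
    by (rule nn_integral_monotone_convergence_SUP[OF inc]) measurable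
  also have "\<dots> \<le> 4" by (intro SUP_least G_int)
  finally have "(\<integral>\<^sup>+x. (SUP k. ennreal ((G k x)\<^sup>2)) \<partial>lebesgue_on S) \<noteq> \<infinity>"
    by (auto simp: top_unique)
  then have fin: "AE x in lebesgue_on S. (SUP k. ennreal ((G k x)\<^sup>2)) \<noteq> \<infinity>"
    by (intro nn_integral_PInf_AE) measurable
  \<comment> \<open>A finite supremum bounds the partial sums of the step lengths, so the
    telescoping series of differences converges absolutely.\<close>
  have conv: "convergent (\<lambda>n. X (r n) x)" if "(SUP k. ennreal ((G k x)\<^sup>2)) \<noteq> \<infinity>" for x
  proof -
    define c where "c = enn2real (SUP k. ennreal ((G k x)\<^sup>2))"
    have c: "(SUP k. ennreal ((G k x)\<^sup>2)) = ennreal c" "0 \<le> c" 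
      unfolding c_def using that by (metis ennreal_enn2real less_top infinity_ennreal_def, simp)
    have "ennreal ((G k x)\<^sup>2) \<le> ennreal c" for k
      unfolding c(1)[symmetric] by (rule SUP_upper) simp
    then have "(G k x)\<^sup>2 \<le> c" for k using c(2) by simp
    then have "G k x \<le> sqrt c" for k by (rule real_le_rsqrt)
    then have "summable (\<lambda>n. D n x)"
      by (intro summableI_nonneg_bounded[where x="sqrt c"]) (auto simp: G_def D_nonneg)
    then have "summable (\<lambda>n. X (r (Suc n)) x - X (r n) x)"
      unfolding D_def by (rule summable_norm_cancel)
    then have "convergent (\<lambda>n. \<Sum>k<n. X (r (Suc k)) x - X (r k) x)" by (simp add: summable_iff_convergent)
    then have "convergent (\<lambda>n. X (r n) x - X (r 0) x)" by (simp add: sum_lessThan_telescope[of "\<lambda>n. X (r n) x"])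
    then show ?thesis
      using convergent_add[OF _ convergent_const[of "X (r 0) x"]] by force
  qed
  define u where "u x = lim (\<lambda>n. X (r n) x)" for x
  have [measurable]: "u \<in> borel_measurable (lebesgue_on S)"
    unfolding u_def by (rule borel_measurable_lim_metric) measurable
  have u: "AE x in lebesgue_on S. (\<lambda>n. X (r n) x) \<longlonglongrightarrow> u x"
    using fin by (rule eventually_mono) (use conv in \<open>simp only: u_def convergent_LIMSEQ_iff\<close>)
  \<comment> \<open>Fatou is applied along the subsequence with \<open>X m\<close> held fixed. That
    the estimate holds for every \<open>m \<ge> N k\<close> is what yields convergence of the whole
    sequence.\<close>
  have key: "L2 S (\<lambda>x. u x - X m x) \<and> nrm S (\<lambda>x. u x - X m x) \<le> (1/2)^k" if m: "m \<ge> N k" for m k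
  proof -
    have "(\<integral>\<^sup>+x. ennreal ((norm (u x - X m x))\<^sup>2) \<partial>lebesgue_on S)
      = (\<integral>\<^sup>+x. liminf (\<lambda>n. ennreal ((norm (X (r n) x - X m x))\<^sup>2)) \<partial>lebesgue_on S)"
    proof (rule nn_integral_cong_AE)
      show "AE x in lebesgue_on S. ennreal ((norm (u x - X m x))\<^sup>2) = liminf (\<lambda>n. ennreal ((norm (X (r n) x - X m x))\<^sup>2))"
        using u
      proof (rule eventually_mono)
        fix x assume "(\<lambda>n. X (r n) x) \<longlonglongrightarrow> u x"
        then have "(\<lambda>n. ennreal ((norm (X (r n) x - X m x))\<^sup>2)) \<longlonglongrightarrow> ennreal ((norm (u x - X m x))\<^sup>2)"
          by (intro tendsto_intros)
        then show "ennreal ((norm (u x - X m x))\<^sup>2) = liminf (\<lambda>n. ennreal ((norm (X (r n) x - X m x))\<^sup>2))"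
          by (intro lim_imp_Liminf[symmetric]) auto
      qed
    qed
    also have "\<dots> \<le> liminf (\<lambda>n. \<integral>\<^sup>+x. ennreal ((norm (X (r n) x - X m x))\<^sup>2) \<partial>lebesgue_on S)"
      by (rule nn_integral_liminf) measurable
    also have "\<dots> \<le> limsup (\<lambda>n. \<integral>\<^sup>+x. ennreal ((norm (X (r n) x - X m x))\<^sup>2) \<partial>lebesgue_on S)"
      by (rule Liminf_le_Limsup) simp
    also have "\<dots> \<le> ennreal (((1/2)^k)\<^sup>2)"
    proof (rule Limsup_bounded)
      have "(\<integral>\<^sup>+x. ennreal ((norm (X (r n) x - X m x))\<^sup>2) \<partial>lebesgue_on S) \<le> ennreal (((1/2)^k)\<^sup>2)" if "n \<ge> k" for n
      proof -
        have "nrm S (\<lambda>x. X (r n) x - X m x) < (1/2)^k" using N m r that by blast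
        then have "(nrm S (\<lambda>x. X (r n) x - X m x))\<^sup>2 \<le> ((1/2)^k)\<^sup>2" by (intro power_mono) auto
        then show ?thesis unfolding nn_integral_nrm[OF L2_diff[OF L L]] by (rule ennreal_leI)
      qed
      then show "\<forall>\<^sub>F n in sequentially. (\<integral>\<^sup>+x. ennreal ((norm (X (r n) x - X m x))\<^sup>2) \<partial>lebesgue_on S) \<le> ennreal (((1/2)^k)\<^sup>2)"
        using eventually_sequentially by blast
    qed
    finally have "(\<integral>\<^sup>+x. ennreal ((norm (u x - X m x))\<^sup>2) \<partial>lebesgue_on S) \<le> ennreal (((1/2)^k)\<^sup>2)" .
    from L2I_nrm[OF _ _ this] show ?thesis by simp
  qed
  have uL: "L2 S u"
  proof -
    have "L2 S (\<lambda>x. (u x - X (N 0) x) + X (N 0) x)" using key[of 0 "N 0"] by (intro L2_add L) simp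
    then show ?thesis by simp
  qed
  have "(\<lambda>n. nrm S (\<lambda>x. X n x - u x)) \<longlonglongrightarrow> 0"
  proof (rule LIMSEQ_I)
    fix e :: real assume "0 < e"
    then obtain k where k: "(1/2::real)^k < e" using real_arch_pow_inv[of e "1/2"] by auto
    have "norm (nrm S (\<lambda>x. X n x - u x) - 0) < e" if "n \<ge> N k" for n
      using key[OF that] k nrm_diff_commute[of S u "X n"] by simp
    then show "\<exists>no. \<forall>n\<ge>no. norm (nrm S (\<lambda>x. X n x - u x) - 0) < e" by blast
  qed
  then show thesis using that L uL by (simp add: L2conv_def)
qed

section \<open>Riesz representation of a bounded linear relation\<close>

lemma linear_rel_diff:
  fixes Rel :: "(('a::euclidean_space \<Rightarrow> 'b::euclidean_space) \<times> real) set"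
  assumes "\<And>x r y s. (x, r) \<in> Rel \<Longrightarrow> (y, s) \<in> Rel \<Longrightarrow> (\<lambda>p. x p + y p, r + s) \<in> Rel"
    and "\<And>x r c. (x, r) \<in> Rel \<Longrightarrow> (\<lambda>p. c *\<^sub>R x p, c * r) \<in> Rel"
    and "(x, r) \<in> Rel" "(y, s) \<in> Rel"
  shows "(\<lambda>p. x p + c *\<^sub>R y p, r + c * s) \<in> Rel"
  using assms by blast

text \<open>The representer minimises \<open>(nrm S x)\<^sup>2 - 2 * r\<close> over the pairs
  \<open>(x, r)\<close>. A relation spares quotients by null sets and choices of representatives: by
  linearity, the bound forces two values attached to almost equal \<open>x\<close> to agree. The
  minimising sequence is part of the conclusion because it places \<open>u\<close> in the closure of
  the domain, on which density and the zero boundary condition rely.\<close>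

theorem Riesz_linear_relation:
  fixes Rel :: "(('a::euclidean_space \<Rightarrow> 'b::euclidean_space) \<times> real) set"
  assumes zero: "((\<lambda>p. 0), 0) \<in> Rel"
    and add: "\<And>x r y s. (x, r) \<in> Rel \<Longrightarrow> (y, s) \<in> Rel \<Longrightarrow> (\<lambda>p. x p + y p, r + s) \<in> Rel"
    and scale: "\<And>x r c. (x, r) \<in> Rel \<Longrightarrow> (\<lambda>p. c *\<^sub>R x p, c * r) \<in> Rel"
    and L: "\<And>x r. (x, r) \<in> Rel \<Longrightarrow> L2 S x"
    and bound: "\<And>x r. (x, r) \<in> Rel \<Longrightarrow> \<bar>r\<bar> \<le> C * nrm S x"
  obtains u X where "L2 S u" "\<And>x r. (x, r) \<in> Rel \<Longrightarrow> ip S u x = r" "nrm S u \<le> \<bar>C\<bar>"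
    "\<And>n. X n \<in> Rel" "L2conv S (\<lambda>n. fst (X n)) u"
proof -
  define J where "J z = (nrm S (fst z))\<^sup>2 - 2 * snd z" for z :: "('a \<Rightarrow> 'b) \<times> real"
  define m where "m = Inf (J ` Rel)"
  \<comment> \<open>Completing the square: the linear term is at most
    \<open>2 * C * nrm S x\<close>, and \<open>(nrm S x - C)\<^sup>2\<close> is nonnegative.\<close>
  have lower: "- C\<^sup>2 \<le> J z" if "z \<in> Rel" for z
  proof -
    obtain x r where z: "z = (x, r)" by (cases z)
    have "r \<le> C * nrm S x" using bound that z by (metis abs_le_D1)
    moreover have "0 \<le> (nrm S x - C)\<^sup>2" by simp
    ultimately show ?thesis by (simp add: J_def z power2_diff algebra_simps)
  qed
  have bdd: "bdd_below (J ` Rel)" using lower by (intro bdd_belowI2)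
  have m_le: "m \<le> J z" if "z \<in> Rel" for z
    unfolding m_def by (intro cInf_lower bdd imageI that)
  have "\<exists>z\<in>Rel. J z < m + 1 / Suc n" for n :: nat
  proof -
    have "Inf (J ` Rel) < m + 1 / Suc n" by (simp add: m_def)
    then show ?thesis using cInf_lessD[of "J ` Rel"] zero by blast
  qed
  then obtain X where X: "\<And>n. X n \<in> Rel" "\<And>n. J (X n) < m + 1 / Suc n" by metis
  have XL: "L2 S (fst (X n))" for n using X(1)[of n] L by (cases "X n") auto
  \<comment> \<open>Parallelogram law: the midpoint of two nearly optimal elements is again in
    \<open>Rel\<close> and costs at least \<open>m\<close>, which leaves little room for their
    distance.\<close>
  have gap: "(nrm S (\<lambda>p. fst (X i) p - fst (X j) p))\<^sup>2 \<le> 2 / Suc i + 2 / Suc j" for i j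
  proof -
    let ?x = "fst (X i)" and ?y = "fst (X j)"
    have "(\<lambda>p. (1/2) *\<^sub>R (?x p + 1 *\<^sub>R ?y p), (1/2) * (snd (X i) + 1 * snd (X j))) \<in> Rel"
      using X(1)[of i] X(1)[of j] by (intro scale linear_rel_diff[OF add scale]) auto
    from m_le[OF this] have mid: "m \<le> (nrm S (\<lambda>p. (1/2) *\<^sub>R (?x p + ?y p)))\<^sup>2 - (snd (X i) + snd (X j))"
      by (simp add: J_def field_simps)
    have s: "(nrm S (\<lambda>p. (1/2) *\<^sub>R (?x p + ?y p)))\<^sup>2 = (1/4) * ip S (\<lambda>p. ?x p + ?y p) (\<lambda>p. ?x p + ?y p)"
      by (simp only: nrm_scaleR power_mult_distrib nrm_sq) (simp add: power2_eq_square)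
    have p: "ip S (\<lambda>p. ?x p + ?y p) (\<lambda>p. ?x p + ?y p) = (nrm S ?x)\<^sup>2 + 2 * ip S ?x ?y + (nrm S ?y)\<^sup>2"
      using ip_add_self[OF XL XL, of i 1 j] by (simp add: nrm_sq)
    have q: "(nrm S (\<lambda>p. ?x p - ?y p))\<^sup>2 = (nrm S ?x)\<^sup>2 - 2 * ip S ?x ?y + (nrm S ?y)\<^sup>2"
      using ip_add_self[OF XL XL, of i "-1" j] by (simp add: nrm_sq)
    have "(nrm S ?x)\<^sup>2 - 2 * snd (X i) < m + 1 / Suc i" "(nrm S ?y)\<^sup>2 - 2 * snd (X j) < m + 1 / Suc j"
      using X(2)[of i] X(2)[of j] by (auto simp: J_def)
    moreover have "2 / real (Suc i) = 2 * (1 / Suc i)" "2 / real (Suc j) = 2 * (1 / Suc j)" by simp_all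
    ultimately show ?thesis using mid unfolding s p q by argo
  qed
  obtain u where u: "L2conv S (\<lambda>n. fst (X n)) u"
  proof (rule Riesz_Fischer[of S "\<lambda>n. fst (X n)"])
    fix e :: real assume "0 < e"
    then obtain N :: nat where N: "4 / e\<^sup>2 < N" using reals_Archimedean2 by blast
    have "nrm S (\<lambda>p. fst (X i) p - fst (X j) p) < e" if "i \<ge> N" "j \<ge> N" for i j
    proof (rule power2_less_imp_less)
      have N0: "0 < real N" using N \<open>0 < e\<close> by (smt (verit) divide_pos_pos zero_less_power)
      have "2 / Suc i \<le> 2 / N" "2 / Suc j \<le> 2 / N" using that N0 by (auto intro!: divide_left_mono)
      then have "(nrm S (\<lambda>p. fst (X i) p - fst (X j) p))\<^sup>2 \<le> 4 / N" using gap[of i j] by simp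
      also have "\<dots> < e\<^sup>2" using N \<open>0 < e\<close> N0 by (simp add: field_simps)
      finally show "(nrm S (\<lambda>p. fst (X i) p - fst (X j) p))\<^sup>2 < e\<^sup>2" .
    qed (use \<open>0 < e\<close> in simp)
    then show "\<exists>N. \<forall>i\<ge>N. \<forall>j\<ge>N. nrm S (\<lambda>p. fst (X i) p - fst (X j) p) < e" by blast
  qed (use XL in auto)
  then have uL: "L2 S u" by (simp add: L2conv_def)
  have rep: "ip S u y = s" if ys: "(y, s) \<in> Rel" for y s
  proof -
    have yL: "L2 S y" using L ys .
    \<comment> \<open>Minimality is tested in direction \<open>y\<close> along the minimising
      sequence; the defect \<open>1 / Suc n\<close> disappears in the limit and the variation at
      \<open>u\<close> remains.\<close>
    have "0 \<le> 0 + 2 * t * (ip S u y - s) + t\<^sup>2 * ip S y y" for t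
    proof -
      have "m \<le> (m + 1 / Suc n) + 2 * t * (ip S (fst (X n)) y - s) + t\<^sup>2 * ip S y y" for n
      proof -
        have "(\<lambda>p. fst (X n) p + t *\<^sub>R y p, snd (X n) + t * s) \<in> Rel"
          using X(1)[of n] ys by (intro linear_rel_diff[OF add scale]) auto
        from m_le[OF this] show ?thesis using X(2)[of n]
          by (simp add: J_def nrm_sq ip_add_self[OF XL yL] algebra_simps)
      qed
      moreover have "(\<lambda>n. (m + 1 / Suc n) + 2 * t * (ip S (fst (X n)) y - s) + t\<^sup>2 * ip S y y)
         \<longlonglongrightarrow> (m + 0) + 2 * t * (ip S u y - s) + t\<^sup>2 * ip S y y"
        by (intro tendsto_intros L2conv_ip u L2conv_const yL) (use LIMSEQ_inverse_real_of_nat in \<open>simp add: inverse_eq_divide\<close>)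
      ultimately have "m \<le> (m + 0) + 2 * t * (ip S u y - s) + t\<^sup>2 * ip S y y"
        by (intro LIMSEQ_le_const) auto
      then show ?thesis by simp
    qed
    from quadratic_nonneg_imp[OF this ip_self_nonneg] show ?thesis by simp
  qed
  have "nrm S u \<le> \<bar>C\<bar>"
  proof -
    have "ip S u (fst (X n)) \<le> \<bar>C\<bar> * nrm S (fst (X n))" for n
    proof -
      have "(fst (X n), snd (X n)) \<in> Rel" using X(1) by simp
      from rep[OF this] bound[OF this] have "ip S u (fst (X n)) \<le> C * nrm S (fst (X n))" by simp
      also have "\<dots> \<le> \<bar>C\<bar> * nrm S (fst (X n))" by (intro mult_right_mono) auto
      finally show ?thesis .
    qed
    then have "ip S u u \<le> \<bar>C\<bar> * nrm S u"
      by (intro LIMSEQ_le[OF L2conv_ip[OF L2conv_const[OF uL] u] tendsto_mult_left[OF L2conv_nrm[OF u]]]) auto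
    then have "nrm S u * nrm S u \<le> \<bar>C\<bar> * nrm S u" by (simp add: nrm_sq[symmetric] power2_eq_square)
    then show ?thesis
      using nrm_nonneg[of S u] by (cases "nrm S u = 0") (auto simp: mult_le_cancel_right)
  qed
  then show thesis using that uL rep X(1) u by blast
qed

section \<open>Smooth functions and test functions\<close>

lemma pderivs_append: "pderivs (us @ vs) f = pderivs us (pderivs vs f)"
  by (induction us) auto

text \<open>Replaces explicit formulas for iterated derivatives: each smoothness proof only names a
  class stable under one directional derivative. Since \<open>pderivs\<close> puts new directions
  outermost, every iterated derivative stays in the class.\<close>

lemma smooth_fun_coinduct:
  assumes "P f" "\<And>f x. P f \<Longrightarrow> f differentiable (at x)" "\<And>f v. P f \<Longrightarrow> P (pderivs [v] f)"
  shows "smooth_fun f"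
proof -
  have "P (pderivs vs f)" for vs
  proof (induction vs)
    case (Cons v vs) then show ?case using assms(3)[OF Cons, of v] by simp
  qed (simp add: assms)
  then show ?thesis using assms(2) by (simp add: smooth_fun_def)
qed

lemma smooth_fun_differentiable: "smooth_fun f \<Longrightarrow> f differentiable (at x)"
  unfolding smooth_fun_def by (metis pderivs.simps(1))

lemma smooth_fun_pderiv: "smooth_fun f \<Longrightarrow> smooth_fun (pderivs [v] f)"
  unfolding smooth_fun_def by (metis pderivs_append)

lemma smooth_fun_has_derivative: "smooth_fun f \<Longrightarrow> (f has_derivative (\<lambda>v. pderivs [v] f x)) (at x)"
  by (simp add: frechet_derivative_works[symmetric] smooth_fun_differentiable)

lemma pderiv_eq: "(f has_derivative D) (at x) \<Longrightarrow> pderivs [v] f x = D v"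
  by (metis frechet_derivative_at pderivs.simps)

declare pderivs.simps(2) [simp del]

lemma smooth_fun_continuous: "smooth_fun f \<Longrightarrow> continuous_on A f"
  by (meson continuous_at_imp_continuous_on differentiable_imp_continuous_within smooth_fun_differentiable)

text \<open>The product rule yields a sum of products, so products of smooth functions alone do not
  form a class stable under differentiation; the algebra generated by the smooth functions
  does.\<close>

inductive smooth_alg :: "('a::euclidean_space \<Rightarrow> real) \<Rightarrow> bool" where
  "smooth_fun f \<Longrightarrow> smooth_alg f"
| "smooth_alg f \<Longrightarrow> smooth_alg g \<Longrightarrow> smooth_alg (\<lambda>x. f x + g x)"
| "smooth_alg f \<Longrightarrow> smooth_alg g \<Longrightarrow> smooth_alg (\<lambda>x. f x * g x)"

lemma smooth_alg_differentiable: "smooth_alg f \<Longrightarrow> f differentiable (at x)"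
  by (induction rule: smooth_alg.induct) (auto intro: smooth_fun_differentiable)

lemma pderiv_add:
  assumes "f differentiable (at x)" "g differentiable (at x)"
  shows "pderivs [v] (\<lambda>x. f x + g x) x = pderivs [v] f x + pderivs [v] g x"
proof (rule trans[OF pderiv_eq])
  show "((\<lambda>x. f x + g x) has_derivative (\<lambda>h. frechet_derivative f (at x) h + frechet_derivative g (at x) h)) (at x)"
    using assms by (intro has_derivative_add) (simp_all add: frechet_derivative_works)
qed (simp add: pderivs.simps)

lemma pderiv_mult:
  fixes f g :: "'a::euclidean_space \<Rightarrow> real"
  assumes "f differentiable (at x)" "g differentiable (at x)"
  shows "pderivs [v] (\<lambda>x. f x * g x) x = f x * pderivs [v] g x + pderivs [v] f x * g x"
proof (rule trans[OF pderiv_eq])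
  show "((\<lambda>x. f x * g x) has_derivative (\<lambda>h. f x * frechet_derivative g (at x) h + frechet_derivative f (at x) h * g x)) (at x)"
    using assms by (intro has_derivative_mult) (simp_all add: frechet_derivative_works)
qed (simp add: pderivs.simps)

lemma smooth_alg_pderiv: "smooth_alg f \<Longrightarrow> smooth_alg (pderivs [v] f)"
proof (induction rule: smooth_alg.induct)
  case (1 f) then show ?case by (intro smooth_alg.intros smooth_fun_pderiv)
next
  case (2 f g)
  have "pderivs [v] (\<lambda>x. f x + g x) = (\<lambda>x. pderivs [v] f x + pderivs [v] g x)"
    by (rule ext, rule pderiv_add) (auto intro: 2 smooth_alg_differentiable)
  then show ?case using 2 by (auto intro: smooth_alg.intros)
next
  case (3 f g)
  have "pderivs [v] (\<lambda>x. f x * g x) = (\<lambda>x. f x * pderivs [v] g x + pderivs [v] f x * g x)"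
    by (rule ext, rule pderiv_mult) (auto intro: 3 smooth_alg_differentiable)
  then show ?case using 3 by (auto intro: smooth_alg.intros)
qed

lemma smooth_alg_smooth: "smooth_alg f \<Longrightarrow> smooth_fun f"
  by (rule smooth_fun_coinduct[of smooth_alg]) (auto intro: smooth_alg_differentiable smooth_alg_pderiv)

lemma smooth_fun_add: "smooth_fun f \<Longrightarrow> smooth_fun g \<Longrightarrow> smooth_fun (\<lambda>x. f x + g x)"
  by (auto intro: smooth_alg_smooth smooth_alg.intros)

lemma smooth_fun_mult: "smooth_fun f \<Longrightarrow> smooth_fun g \<Longrightarrow> smooth_fun (\<lambda>x. f x * g x)"
  by (auto intro: smooth_alg_smooth smooth_alg.intros)

lemma smooth_fun_affine: "smooth_fun (\<lambda>x. x \<bullet> c + d)"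
proof (rule smooth_fun_coinduct[of "\<lambda>f. \<exists>c d. f = (\<lambda>x. x \<bullet> c + d)"])
  fix f :: "'a \<Rightarrow> real" and v x
  assume "\<exists>c d. f = (\<lambda>x. x \<bullet> c + d)"
  then obtain c d where f: "f = (\<lambda>x. x \<bullet> c + d)" by blast
  have D: "(f has_derivative (\<lambda>v. v \<bullet> c)) (at x)" for x
    unfolding f by (auto intro!: derivative_eq_intros)
  show "f differentiable at x" using D differentiable_def by blast
  have "pderivs [v] f = (\<lambda>x. x \<bullet> 0 + v \<bullet> c)" using pderiv_eq[OF D] by auto
  then show "\<exists>c d. pderivs [v] f = (\<lambda>x. x \<bullet> c + d)" by blast
qed auto

lemma smooth_fun_const: "smooth_fun (\<lambda>x. d)"
  using smooth_fun_affine[of 0 d] by simp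

lemma pderiv_affine: "pderivs [v] (\<lambda>x. x \<bullet> c + d) x = v \<bullet> c"
  by (rule pderiv_eq) (auto intro!: derivative_eq_intros)

lemma
  fixes f :: "'b::euclidean_space \<Rightarrow> real" and L :: "'a::euclidean_space \<Rightarrow> 'b"
  assumes "smooth_fun f" and L: "bounded_linear L"
  shows smooth_fun_compose_affine: "smooth_fun (\<lambda>x. f (L x + c))"
    and pderiv_compose_affine: "pderivs [v] (\<lambda>x. f (L x + c)) x = pderivs [L v] f (L x + c)"
proof -
  have D: "((\<lambda>x. f (L x + c)) has_derivative (\<lambda>v. pderivs [L v] f (L x + c))) (at x)"
    if "smooth_fun f" for f :: "'b \<Rightarrow> real" and x
    by (rule has_derivative_compose[OF _ smooth_fun_has_derivative[OF that], where f="\<lambda>x. L x + c"])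
       (auto intro!: derivative_eq_intros bounded_linear_imp_has_derivative L)
  show "smooth_fun (\<lambda>x. f (L x + c))"
  proof (rule smooth_fun_coinduct[of "\<lambda>h. \<exists>f. smooth_fun f \<and> h = (\<lambda>x. f (L x + c))"])
    fix h :: "'a \<Rightarrow> real" and v x
    assume "\<exists>f. smooth_fun f \<and> h = (\<lambda>x. f (L x + c))"
    then obtain f where h: "h = (\<lambda>x. f (L x + c))" and f: "smooth_fun f" by blast
    show "h differentiable at x" unfolding h using D[OF f] differentiable_def by blast
    have "pderivs [v] h = (\<lambda>x. pderivs [L v] f (L x + c))"
      unfolding h using pderiv_eq[OF D[OF f]] by auto
    then show "\<exists>f. smooth_fun f \<and> pderivs [v] h = (\<lambda>x. f (L x + c))"
      using smooth_fun_pderiv[OF f] by blast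
  qed (use assms in blast)
  show "pderivs [v] (\<lambda>x. f (L x + c)) x = pderivs [L v] f (L x + c)"
    using pderiv_eq[OF D[OF assms(1)]] .
qed

lemma smooth_fun_section:
  assumes "smooth_fun (\<phi> :: 'a::euclidean_space \<times> 'b::euclidean_space \<Rightarrow> real)"
  shows "smooth_fun (\<lambda>x. \<phi> (t, x))"
  using smooth_fun_compose_affine[OF assms, of "\<lambda>x. (0, x)" "(t, 0)"]
  by (simp add: bounded_linear_Pair)

section \<open>A function flat at the origin\<close>

definition flat :: "nat \<Rightarrow> real \<Rightarrow> real" where
  "flat k t = (if t > 0 then exp (- 1 / t) / t ^ k else 0)"

lemma flat_derivative: "(flat k has_real_derivative flat (k + 2) t - k * flat (k + 1) t) (at t)"
proof -
  consider "t > 0" | "t < 0" | "t = 0" by linarith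
  then show ?thesis
  proof cases
    case 1
    have "((\<lambda>t. exp (- 1 / t) / t ^ k) has_real_derivative flat (k + 2) t - k * flat (k + 1) t) (at t)"
    \<comment> \<open>The power rule brings in the exponent \<open>k - Suc 0\<close>, which is
      truncated at 0; hence the separate case.\<close>
    proof (cases k)
      case 0
      then show ?thesis using 1
        by (auto intro!: derivative_eq_intros simp: flat_def field_simps power2_eq_square)
    next
      case (Suc j)
      have "((\<lambda>t. exp (- 1 / t) / t ^ k) has_real_derivative
          ((exp (- 1 / t) * (1 / t\<^sup>2)) * t ^ k - exp (- 1 / t) * (real k * t ^ (k - Suc 0))) / (t ^ k * t ^ k)) (at t)"
        using 1 by (auto intro!: derivative_eq_intros simp: power2_eq_square)
      also have "((exp (- 1 / t) * (1 / t\<^sup>2)) * t ^ k - exp (- 1 / t) * (real k * t ^ (k - Suc 0))) / (t ^ k * t ^ k)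
          = flat (k + 2) t - k * flat (k + 1) t"
        using 1 Suc by (simp add: flat_def field_simps power2_eq_square)
      finally show ?thesis .
    qed
    then show ?thesis
      by (rule has_field_derivative_transform_within_open[where S="{0<..}"]) (use 1 in \<open>auto simp: flat_def\<close>)
  next
    case 2
    have "((\<lambda>t. 0) has_real_derivative flat (k + 2) t - k * flat (k + 1) t) (at t)"
      using 2 by (auto simp: flat_def)
    then show ?thesis
      by (rule has_field_derivative_transform_within_open[where S="{..<0}"]) (use 2 in \<open>auto simp: flat_def\<close>)
  next
    case 3
    have l: "((\<lambda>h. flat k h / h) \<longlongrightarrow> 0) (at_left 0)"
      by (rule tendsto_eventually) (auto simp: flat_def eventually_at_filter)
    have "((\<lambda>h::real. (inverse h) ^ (k + 1) / exp (inverse h)) \<longlongrightarrow> 0) (at_right 0)"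
      by (rule filterlim_compose[OF tendsto_power_div_exp_0 filterlim_inverse_at_top_right])
    then have r: "((\<lambda>h. flat k h / h) \<longlongrightarrow> 0) (at_right 0)"
    proof (rule Lim_transform_eventually)
      show "\<forall>\<^sub>F h in at_right 0. (inverse h) ^ (k + 1) / exp (inverse h) = flat k h / h"
        by (auto simp: eventually_at_filter flat_def exp_minus field_simps)
    qed
    have "((\<lambda>h. (flat k (0 + h) - flat k 0) / h) \<longlongrightarrow> 0) (at 0)"
      using filterlim_split_at[OF l r] by (simp add: flat_def)
    then show ?thesis using 3 by (simp add: DERIV_def flat_def)
  qed
qed

text \<open>The derivative of one member of the family combines two others, so the stable class is
  the linear span.\<close>

inductive flat_span :: "(real \<Rightarrow> real) \<Rightarrow> bool" where
  "flat_span (flat k)"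
| "flat_span f \<Longrightarrow> flat_span g \<Longrightarrow> flat_span (\<lambda>x. a * f x + b * g x)"

lemma flat_span_derivative:
  "flat_span f \<Longrightarrow> \<exists>g. flat_span g \<and> (\<forall>t. (f has_real_derivative g t) (at t))"
proof (induction rule: flat_span.induct)
  case (1 k)
  show ?case
  proof (intro exI conjI allI)
    show "flat_span (\<lambda>t. 1 * flat (k + 2) t + (- real k) * flat (k + 1) t)"
      by (intro flat_span.intros)
    show "(flat k has_real_derivative 1 * flat (k + 2) t + (- real k) * flat (k + 1) t) (at t)" for t
      using flat_derivative[of k t] by simp
  qed
next
  case (2 f g a b)
  then obtain f' g' where "flat_span f'" "flat_span g'" "\<And>t. (f has_real_derivative f' t) (at t)" "\<And>t. (g has_real_derivative g' t) (at t)" by blast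
  then show ?case
    by (intro exI[of _ "\<lambda>x. a * f' x + b * g' x"]) (auto intro!: flat_span.intros derivative_eq_intros)
qed

lemma smooth_fun_flat: "smooth_fun (flat k)"
proof (rule smooth_fun_coinduct[of flat_span])
  fix f v x assume f: "flat_span f"
  obtain g where g: "flat_span g" "\<And>t. (f has_real_derivative g t) (at t)"
    using flat_span_derivative[OF f] by blast
  show "f differentiable at x" using g(2) real_differentiable_def by blast
  have "pderivs [v] f = (\<lambda>t. v * g t + 0 * g t)"
    using pderiv_eq[OF g(2)[unfolded has_field_derivative_def]] by (auto simp: mult.commute)
  then show "flat_span (pderivs [v] f)" using g(1) by (metis flat_span.intros(2))
qed (rule flat_span.intros)

text \<open>The range of integration is fixed and only the integrand moves, so smoothness follows on
  the whole space by differentiation under the integral. For \<open>s\<close> supported in the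
  cylinder and \<open>e = (1, 0)\<close> or \<open>(-1, 0)\<close>, a segment of length
  \<open>T\<close> that starts in the cylinder runs out of it, and the average is a time primitive.
  With a short segment it expresses increments of a function.\<close>

definition tavg :: "real \<Rightarrow> 'a \<Rightarrow> ('a::euclidean_space \<Rightarrow> real) \<Rightarrow> 'a \<Rightarrow> real" where
  "tavg T e s p = integral (cbox 0 T) (\<lambda>r. s (p + r *\<^sub>R e))"

lemma tavg_has_derivative:
  assumes s: "smooth_fun s"
  shows "(tavg T e s has_derivative (\<lambda>v. tavg T e (pderivs [v] s) x)) (at x)"
proof -
  \<comment> \<open>The Leibniz rule expects the derivative as a continuous map into bounded linear
    maps; in finite dimension, continuity in each basis direction suffices.\<close>
  define F where "F x t = Blinfun (\<lambda>v. pderivs [v] s (x + t *\<^sub>R e))" for x t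
  have bl: "bounded_linear (\<lambda>v. pderivs [v] s y)" for y
    using has_derivative_bounded_linear[OF smooth_fun_has_derivative[OF s]] .
  have F: "blinfun_apply (F x t) v = pderivs [v] s (x + t *\<^sub>R e)" for x t v
    unfolding F_def by (simp add: bounded_linear_Blinfun_apply[OF bl])
  have cont: "continuous_on UNIV (\<lambda>(x, t). F x t)"
  proof (rule continuous_on_blinfun_componentwise)
    fix i :: 'a
    have "continuous_on UNIV (\<lambda>z. pderivs [i] s (fst z + snd z *\<^sub>R e))"
      by (rule continuous_on_compose2[OF smooth_fun_continuous[OF smooth_fun_pderiv[OF s], of UNIV]])
         (auto intro!: continuous_intros)
    then show "continuous_on UNIV (\<lambda>z. blinfun_apply (case z of (x, t) \<Rightarrow> F x t) i)"
      by (simp add: F case_prod_beta)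
  qed
  have icont: "continuous_on A (\<lambda>t. F x t)" for x A
    by (rule continuous_on_compose2[OF cont, of A "\<lambda>t. (x, t)", simplified]) (auto intro!: continuous_intros)
  have "((\<lambda>x. integral (cbox 0 T) (\<lambda>t. s (x + t *\<^sub>R e))) has_derivative integral (cbox 0 T) (F x)) (at x within UNIV)"
  proof (rule leibniz_rule)
    show "((\<lambda>x. s (x + t *\<^sub>R e)) has_derivative blinfun_apply (F x t)) (at x within UNIV)" for x t
      by (rule has_derivative_eq_rhs, rule has_derivative_compose[OF _ smooth_fun_has_derivative[OF s], where f="\<lambda>x. x + t *\<^sub>R e"])
         (auto intro!: derivative_eq_intros simp: F)
    show "(\<lambda>t. s (x + t *\<^sub>R e)) integrable_on cbox 0 T" for x
      by (intro integrable_continuous continuous_on_compose2[OF smooth_fun_continuous[OF s, of UNIV]]) (auto intro!: continuous_intros)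
    show "continuous_on (UNIV \<times> cbox 0 T) (\<lambda>(x, t). F x t)" using cont continuous_on_subset by blast
  qed auto
  moreover have "blinfun_apply (integral (cbox 0 T) (F x)) = (\<lambda>v. tavg T e (pderivs [v] s) x)"
  proof
    fix v
    have "F x integrable_on cbox 0 T" by (rule integrable_continuous[OF icont])
    from integral_linear[OF this blinfun.bounded_linear_left[of v]] 
    show "blinfun_apply (integral (cbox 0 T) (F x)) v = tavg T e (pderivs [v] s) x"
      by (simp add: tavg_def F o_def)
  qed
  moreover have "tavg T e s = (\<lambda>x. integral (cbox 0 T) (\<lambda>t. s (x + t *\<^sub>R e)))"
    by (simp add: tavg_def fun_eq_iff)
  ultimately show ?thesis by simp
qed

lemma pderiv_tavg: "smooth_fun s \<Longrightarrow> pderivs [v] (tavg T e s) = tavg T e (pderivs [v] s)"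
  by (rule ext, rule pderiv_eq, rule tavg_has_derivative)

lemma smooth_fun_tavg: assumes "smooth_fun s" shows "smooth_fun (tavg T e s)"
proof (rule smooth_fun_coinduct[of "\<lambda>f. \<exists>s. smooth_fun s \<and> f = tavg T e s"])
  show "f differentiable at x" if "\<exists>s. smooth_fun s \<and> f = tavg T e s" for f x
    using that tavg_has_derivative differentiable_def by blast
  show "\<exists>s. smooth_fun s \<and> pderivs [v] f = tavg T e s" if "\<exists>s. smooth_fun s \<and> f = tavg T e s" for f v
    using that pderiv_tavg smooth_fun_pderiv by metis
qed (use assms in auto)

text \<open>Along the direction of averaging, the integrand of the derivative is itself a derivative
  in \<open>r\<close>, so only the two ends of the segment remain.\<close>

lemma pderiv_tavg_same:
  assumes s: "smooth_fun s" and "0 \<le> T"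
  shows "pderivs [e] (tavg T e s) p = s (p + T *\<^sub>R e) - s p"
proof -
  have "((\<lambda>r. pderivs [e] s (p + r *\<^sub>R e)) has_integral s (p + T *\<^sub>R e) - s (p + 0 *\<^sub>R e)) {0..T}"
  proof (rule fundamental_theorem_of_calculus[OF \<open>0 \<le> T\<close>])
    fix r :: real
    have "((\<lambda>r. s (p + r *\<^sub>R e)) has_derivative (\<lambda>h. pderivs [h *\<^sub>R e] s (p + r *\<^sub>R e))) (at r within {0..T})"
      by (rule has_derivative_eq_rhs, rule has_derivative_compose[OF _ smooth_fun_has_derivative[OF s], where f="\<lambda>r. p + r *\<^sub>R e"])
         (auto intro!: derivative_eq_intros)
    moreover have "pderivs [h *\<^sub>R e] s y = h *\<^sub>R pderivs [e] s y" for h y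
      using linear_scale[OF has_derivative_linear[OF smooth_fun_has_derivative[OF s]]] .
    ultimately show "((\<lambda>r. s (p + r *\<^sub>R e)) has_vector_derivative pderivs [e] s (p + r *\<^sub>R e)) (at r within {0..T})"
      by (simp add: has_vector_derivative_def)
  qed
  then show ?thesis unfolding pderiv_tavg[OF s] tavg_def by (simp add: integral_unique)
qed

section \<open>Test functions and operations preserving them\<close>

lemma test_funI:
  assumes "smooth_fun \<phi>" "compact K" "K \<subseteq> U" "\<And>x. x \<notin> K \<Longrightarrow> \<phi> x = 0"
  shows "test_fun U \<phi>"
proof -
  have "closure {x. \<phi> x \<noteq> 0} \<subseteq> K"
    using assms by (intro closure_minimal compact_imp_closed) auto
  then show ?thesis
    using assms unfolding test_fun_def by (metis bounded_subset closed_closure compact_eq_bounded_closed order_trans)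
qed

lemma test_funE:
  assumes "test_fun U \<phi>"
  obtains K where "smooth_fun \<phi>" "compact K" "K \<subseteq> U" "\<And>x. x \<notin> K \<Longrightarrow> \<phi> x = 0"
proof (rule that[of "closure {x. \<phi> x \<noteq> 0}"])
  show "\<phi> x = 0" if "x \<notin> closure {x. \<phi> x \<noteq> 0}" for x
    by (metis (mono_tags) closure_subset mem_Collect_eq subsetD that)
qed (use assms in \<open>auto simp: test_fun_def\<close>)

lemma test_fun_smooth: "test_fun U \<phi> \<Longrightarrow> smooth_fun \<phi>"
  by (simp add: test_fun_def)

lemma test_fun_outside: "test_fun U \<phi> \<Longrightarrow> x \<notin> U \<Longrightarrow> \<phi> x = 0"
  by (erule test_funE) blast

lemma test_fun_mono: "test_fun U \<phi> \<Longrightarrow> U \<subseteq> V \<Longrightarrow> test_fun V \<phi>"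
  by (auto simp: test_fun_def)

lemma test_fun_zero: "test_fun U (\<lambda>x. 0)"
  by (rule test_funI[of _ "{}"]) (auto intro: smooth_fun_const)

lemma test_fun_smooth_mult: "smooth_fun g \<Longrightarrow> test_fun U \<phi> \<Longrightarrow> test_fun U (\<lambda>x. g x * \<phi> x)"
  by (erule test_funE, rule test_funI) (auto intro: smooth_fun_mult)

lemma test_fun_scale: "test_fun U \<phi> \<Longrightarrow> test_fun U (\<lambda>x. c * \<phi> x)"
  by (intro test_fun_smooth_mult smooth_fun_const)

lemma test_fun_add:
  assumes "test_fun U \<phi>" "test_fun U \<psi>" shows "test_fun U (\<lambda>x. \<phi> x + \<psi> x)"
proof -
  obtain K where "smooth_fun \<phi>" "compact K" "K \<subseteq> U" "\<And>x. x \<notin> K \<Longrightarrow> \<phi> x = 0" using test_funE[OF assms(1)] by blast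
  moreover obtain L where "smooth_fun \<psi>" "compact L" "L \<subseteq> U" "\<And>x. x \<notin> L \<Longrightarrow> \<psi> x = 0" using test_funE[OF assms(2)] by blast
  ultimately show ?thesis
    by (intro test_funI[of _ "K \<union> L"]) (auto intro: smooth_fun_add)
qed

lemma test_fun_pderiv:
  assumes "test_fun U \<phi>" shows "test_fun U (pderivs [v] \<phi>)"
proof -
  obtain K where K: "smooth_fun \<phi>" "compact K" "K \<subseteq> U" "\<And>x. x \<notin> K \<Longrightarrow> \<phi> x = 0" using test_funE[OF assms] by blast
  have "pderivs [v] \<phi> x = 0" if "x \<notin> K" for x
  proof -
    have "(\<phi> has_derivative (\<lambda>v. 0)) (at x)"
      by (rule has_derivative_transform_within_open[of "\<lambda>x. 0" _ _ _ "- K"])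
         (use K that compact_imp_closed in auto)
    then show ?thesis by (rule pderiv_eq)
  qed
  then show ?thesis using K by (intro test_funI[of _ K] smooth_fun_pderiv) auto
qed

lemma test_fun_continuous: "test_fun U \<phi> \<Longrightarrow> continuous_on A \<phi>"
  by (simp add: smooth_fun_continuous test_fun_smooth)

lemma test_fun_bounded:
  assumes "test_fun U \<phi>" obtains B where "0 \<le> B" "\<And>x. \<bar>\<phi> x\<bar> \<le> B"
proof -
  obtain K where K: "smooth_fun \<phi>" "compact K" "K \<subseteq> U" "\<And>x. x \<notin> K \<Longrightarrow> \<phi> x = 0" using test_funE[OF assms] by blast
  have "bounded (\<phi> ` K)" using K by (intro compact_imp_bounded compact_continuous_image smooth_fun_continuous)
  then obtain B where B: "\<forall>x\<in>K. \<bar>\<phi> x\<bar> \<le> B" by (auto simp: bounded_iff)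
  have "\<bar>\<phi> x\<bar> \<le> max B 0" for x using B K(4)[of x] by (cases "x \<in> K") fastforce+
  then show thesis using that[of "max B 0"] by simp
qed

lemma test_fun_tensor:
  fixes h :: "'a::euclidean_space \<Rightarrow> real" and k :: "'b::euclidean_space \<Rightarrow> real"
  assumes "test_fun A h" "test_fun B k" shows "test_fun (A \<times> B) (\<lambda>p. h (fst p) * k (snd p))"
proof -
  obtain K where K: "smooth_fun h" "compact K" "K \<subseteq> A" "\<And>x. x \<notin> K \<Longrightarrow> h x = 0" using test_funE[OF assms(1)] by blast
  obtain L where L: "smooth_fun k" "compact L" "L \<subseteq> B" "\<And>x. x \<notin> L \<Longrightarrow> k x = 0" using test_funE[OF assms(2)] by blast
  show ?thesis
  proof (rule test_funI[of _ "K \<times> L"])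
    show "smooth_fun (\<lambda>p. h (fst p) * k (snd p))"
      using smooth_fun_compose_affine[OF K(1) bounded_linear_fst, of 0] smooth_fun_compose_affine[OF L(1) bounded_linear_snd, of 0]
      by (intro smooth_fun_mult) auto
    show "h (fst p) * k (snd p) = 0" if "p \<notin> K \<times> L" for p
      using that K(4) L(4) by (cases p) auto
  qed (use K L in \<open>auto intro: compact_Times\<close>)
qed

lemma test_fun_section:
  assumes "test_fun (A \<times> U) \<phi>" shows "test_fun U (\<lambda>x. \<phi> (t, x))"
proof -
  obtain K where K: "smooth_fun \<phi>" "compact K" "K \<subseteq> A \<times> U" "\<And>x. x \<notin> K \<Longrightarrow> \<phi> x = 0" using test_funE[OF assms] by blast
  show ?thesis
  proof (rule test_funI[of _ "snd ` K"])
    show "compact (snd ` K)" using K by (intro compact_continuous_image continuous_intros)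
    show "\<phi> (t, x) = 0" if "x \<notin> snd ` K" for x using that K(4)[of "(t, x)"] by force
  qed (use K in \<open>auto intro: smooth_fun_section\<close>)
qed

text \<open>The average at \<open>x\<close> sees \<open>s\<close> at
  \<open>x + r *\<^sub>R e\<close>, so its support is the support of \<open>s\<close> swept
  backwards along \<open>e\<close>; hence the minus sign in the hypothesis.\<close>

lemma test_fun_tavg:
  assumes "test_fun U s" "\<And>p r. p \<in> U \<Longrightarrow> 0 \<le> r \<Longrightarrow> r \<le> T \<Longrightarrow> p - r *\<^sub>R e \<in> V"
  shows "test_fun V (tavg T e s)"
proof -
  obtain K where K: "smooth_fun s" "compact K" "K \<subseteq> U" "\<And>x. x \<notin> K \<Longrightarrow> s x = 0" using test_funE[OF assms(1)] by blast
  let ?K = "(\<lambda>(p, r). p - r *\<^sub>R e) ` (K \<times> {0..T})"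
  show ?thesis
  proof (rule test_funI[of _ ?K])
    show "compact ?K" unfolding case_prod_beta
      by (intro compact_continuous_image continuous_intros compact_Times K) auto
    show "?K \<subseteq> V" using assms(2) K(3) by auto
    show "tavg T e s x = 0" if "x \<notin> ?K" for x
    proof -
      have "s (x + r *\<^sub>R e) = 0" if "r \<in> cbox 0 T" for r
      proof (rule K(4), rule notI)
        assume "x + r *\<^sub>R e \<in> K"
        then have "(\<lambda>(p, r). p - r *\<^sub>R e) (x + r *\<^sub>R e, r) \<in> ?K" using that by (intro imageI) auto
        then show False using \<open>x \<notin> ?K\<close> by simp
      qed
      then have "integral (cbox 0 T) (\<lambda>r. s (x + r *\<^sub>R e)) = integral (cbox 0 T) (\<lambda>r. 0)"
        by (rule Henstock_Kurzweil_Integration.integral_cong)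
      then show ?thesis by (simp add: tavg_def)
    qed
  qed (use K in \<open>auto intro: smooth_fun_tavg\<close>)
qed

section \<open>Smooth cutoff functions of boxes\<close>

lemma smooth_fun_prod:
  "finite I \<Longrightarrow> (\<And>i. i \<in> I \<Longrightarrow> smooth_fun (f i)) \<Longrightarrow> smooth_fun (\<lambda>x. \<Prod>i\<in>I. f i x)"
  by (induction I rule: finite_induct) (auto intro: smooth_fun_const smooth_fun_mult)

lemma flat_bounds: "0 \<le> flat 0 t" "flat 0 t \<le> 1" by (auto simp: flat_def)

text \<open>The shift by 1 makes the cutoff vanish for \<open>s \<le> 1 / Suc n\<close>, which gives
  compact support inside an open box; for fixed \<open>s > 0\<close> the argument still tends to
  infinity, where \<open>flat 0\<close> tends to 1.\<close>

lemma flat_limit: "((\<lambda>n. flat 0 (real (Suc n) * s - 1)) \<longlongrightarrow> (if 0 < s then 1 else 0)) sequentially"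
proof (cases "0 < s")
  case True
  have "((\<lambda>t::real. exp (- 1 / t)) \<longlongrightarrow> exp 0) at_top"
    by (intro tendsto_exp tendsto_divide_0[OF tendsto_const] filterlim_at_top_imp_at_infinity filterlim_ident)
  then have "(flat 0 \<longlongrightarrow> 1) at_top"
    by (simp, elim Lim_transform_eventually) (auto simp: flat_def eventually_at_top_linorder intro!: exI[of _ 1])
  moreover have "filterlim (\<lambda>n. real (Suc n) * s - 1) at_top sequentially"
    using filterlim_tendsto_add_at_top[OF tendsto_const[of "s - 1"]
        filterlim_tendsto_pos_mult_at_top[OF tendsto_const True filterlim_real_sequentially]]
    by (simp add: algebra_simps)
  ultimately show ?thesis using True filterlim_compose by (simp only: if_True)
next
  case False
  have "flat 0 (Suc n * s - 1) = 0" for n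
  proof -
    have "Suc n * s \<le> 0" using False by (intro mult_nonneg_nonpos) auto
    then show ?thesis by (simp add: flat_def)
  qed
  then show ?thesis using False by (simp only: if_False tendsto_const)
qed

definition box_cutoff :: "'a::euclidean_space \<Rightarrow> 'a \<Rightarrow> nat \<Rightarrow> 'a \<Rightarrow> real" where
  "box_cutoff a b n x = (\<Prod>i\<in>Basis. flat 0 (Suc n * (x \<bullet> i - a \<bullet> i) - 1) * flat 0 (Suc n * (b \<bullet> i - x \<bullet> i) - 1))"

lemma box_cutoff_bounds: "0 \<le> box_cutoff a b n x" "box_cutoff a b n x \<le> 1"
  unfolding box_cutoff_def
  by (auto intro!: prod_nonneg prod_le_1 mult_nonneg_nonneg mult_le_one flat_bounds)

lemma smooth_box_cutoff: "smooth_fun (box_cutoff a b n)"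
proof -
  have "smooth_fun (\<lambda>x. flat 0 (Suc n * (x \<bullet> i - a \<bullet> i) - 1))" for i
    using smooth_fun_compose_affine[OF smooth_fun_flat[of 0] bounded_linear_inner_left, of "Suc n *\<^sub>R i" "- (Suc n * (a \<bullet> i)) - 1"]
    by (simp add: algebra_simps)
  moreover have "smooth_fun (\<lambda>x. flat 0 (Suc n * (b \<bullet> i - x \<bullet> i) - 1))" for i
    using smooth_fun_compose_affine[OF smooth_fun_flat[of 0] bounded_linear_inner_left, of "- Suc n *\<^sub>R i" "Suc n * (b \<bullet> i) - 1"]
    by (simp add: algebra_simps)
  ultimately have "smooth_fun (\<lambda>x. flat 0 (Suc n * (x \<bullet> i - a \<bullet> i) - 1) * flat 0 (Suc n * (b \<bullet> i - x \<bullet> i) - 1))" for i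
    by (intro smooth_fun_mult)
  then show ?thesis unfolding box_cutoff_def[abs_def] by (intro smooth_fun_prod) auto
qed

lemma box_cutoff_outside:
  assumes "x \<notin> cbox (a + (1 / Suc n) *\<^sub>R One) (b - (1 / Suc n) *\<^sub>R One)" shows "box_cutoff a b n x = 0"
proof -
  obtain i where i: "i \<in> Basis" "x \<bullet> i < a \<bullet> i + 1 / Suc n \<or> b \<bullet> i - 1 / Suc n < x \<bullet> i"
    using assms by (auto simp: mem_box inner_simps not_le)
  then have "Suc n * (x \<bullet> i - a \<bullet> i) < 1 \<or> Suc n * (b \<bullet> i - x \<bullet> i) < 1"
    by (auto simp: field_simps)
  then have "flat 0 (Suc n * (x \<bullet> i - a \<bullet> i) - 1) * flat 0 (Suc n * (b \<bullet> i - x \<bullet> i) - 1) = 0"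
    by (auto simp: flat_def)
  then show ?thesis unfolding box_cutoff_def using i(1) by (intro prod_zero bexI) auto
qed

lemma test_fun_box_cutoff: "test_fun (box a b) (box_cutoff a b n)"
proof (rule test_funI[OF smooth_box_cutoff compact_cbox _ box_cutoff_outside])
  show "cbox (a + (1 / Suc n) *\<^sub>R One) (b - (1 / Suc n) *\<^sub>R One) \<subseteq> box a b"
  proof
    fix x assume "x \<in> cbox (a + (1 / Suc n) *\<^sub>R One) (b - (1 / Suc n) *\<^sub>R One)"
    moreover define d where "d = 1 / real (Suc n)"
    ultimately have "\<forall>i\<in>Basis. a \<bullet> i + d \<le> x \<bullet> i \<and> x \<bullet> i \<le> b \<bullet> i - d"
      by (simp add: mem_box inner_simps)
    moreover have "0 < d" by (simp add: d_def)
    ultimately show "x \<in> box a b" by (fastforce simp: mem_box)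
  qed
qed

lemma box_cutoff_limit: "(\<lambda>n. box_cutoff a b n x) \<longlonglongrightarrow> indicator (box a b) x"
proof -
  have "(\<lambda>n. box_cutoff a b n x) \<longlonglongrightarrow> (\<Prod>i\<in>Basis. (if 0 < x \<bullet> i - a \<bullet> i then 1 else 0) * (if 0 < b \<bullet> i - x \<bullet> i then 1 else 0))"
    unfolding box_cutoff_def by (intro tendsto_prod tendsto_mult flat_limit)
  moreover have "(\<Prod>i\<in>Basis. (if 0 < x \<bullet> i - a \<bullet> i then 1 else 0) * (if 0 < b \<bullet> i - x \<bullet> i then 1 else 0)) = (indicator (box a b) x :: real)"
  proof (cases "x \<in> box a b")
    case True then show ?thesis by (auto simp: mem_box intro!: prod.neutral)
  next
    case False
    then obtain i where "i \<in> Basis" "\<not> (a \<bullet> i < x \<bullet> i \<and> x \<bullet> i < b \<bullet> i)" by (auto simp: mem_box)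
    then show ?thesis using False by (auto intro!: prod_zero)
  qed
  ultimately show ?thesis by simp
qed

section \<open>The fundamental lemma of the calculus of variations, and density\<close>

lemma continuous_measurable_lebesgue_on:
  fixes f :: "'a::euclidean_space \<Rightarrow> 'b::euclidean_space"
  assumes "continuous_on UNIV f" shows "f \<in> borel_measurable (lebesgue_on S)"
  using borel_measurable_continuous_onI[OF assms]
  by (intro measurable_restrict_space1 measurable_completion) simp

lemma L2_bounded:
  fixes f :: "'a::euclidean_space \<Rightarrow> 'b::euclidean_space"
  assumes "S \<in> lmeasurable" "f \<in> borel_measurable (lebesgue_on S)" "\<And>x. x \<in> S \<Longrightarrow> norm (f x) \<le> B"
  shows "L2 S f"
proof -
  interpret finite_measure "lebesgue_on S" using assms(1) by (rule finite_measure_lebesgue_on)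
  have "integrable (lebesgue_on S) (\<lambda>x. (norm (f x))\<^sup>2)"
  proof (rule integrable_const_bound)
    show "AE x in lebesgue_on S. norm ((norm (f x))\<^sup>2) \<le> B\<^sup>2"
      using assms(3) by (intro AE_I2) (auto intro!: power_mono)
  qed (use assms(2) in measurable)
  then show ?thesis using assms(2) by (simp add: L2_def)
qed

lemma L2_test_fun:
  assumes "S \<in> lmeasurable" "test_fun U \<phi>" shows "L2 S \<phi>"
proof -
  obtain B where "\<And>x. \<bar>\<phi> x\<bar> \<le> B" using test_fun_bounded[OF assms(2)] by blast
  then show ?thesis
    by (intro L2_bounded[OF assms(1) continuous_measurable_lebesgue_on, of _ B] test_fun_continuous[OF assms(2)]) auto
qed

text \<open>Boxes form an intersection-stable generator of the Borel sets, so vanishing integrals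
  spread to all Borel sets by the Dynkin argument; the total integral handles complements. The set
  where the function is positive, and the same set for its negative, then give the claim.\<close>

lemma box_integrals_zero_AE:
  fixes g :: "'a::euclidean_space \<Rightarrow> real"
  assumes g: "integrable lborel g" and tot: "(\<integral>x. g x \<partial>lborel) = 0"
    and box: "\<And>a b. (\<integral>x. indicator (box a b) x * g x \<partial>lborel) = 0"
  shows "AE x in lborel. g x = 0"
proof -
  note [measurable] = borel_measurable_integrable[OF g]
  have int: "integrable lborel (\<lambda>x. indicator A x * g x)" if "A \<in> sets borel" for A
    using integrable_mult_indicator[OF _ g, of A] that by simp
  have zero: "(\<integral>x. indicator A x * g x \<partial>lborel) = 0" if "A \<in> sets borel" for A
  proof -
    have "Int_stable (range (\<lambda>(a, b). box a b :: 'a set))" by (auto simp: Int_stable_def box_Int_box)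
    moreover have "range (\<lambda>(a, b). box a b :: 'a set) \<subseteq> Pow UNIV" by simp
    moreover have "A \<in> sigma_sets UNIV (range (\<lambda>(a, b). box a b))"
      using that unfolding borel_eq_box by simp
    ultimately have "A \<in> sets borel \<and> (\<integral>x. indicator A x * g x \<partial>lborel) = 0"
    proof (induction rule: sigma_sets_induct_disjoint)
      case (basic A) then show ?case using box by auto
    next
      case (compl A)
      have "(\<integral>x. indicator (UNIV - A) x * g x \<partial>lborel) = (\<integral>x. g x - indicator A x * g x \<partial>lborel)"
        by (rule Bochner_Integration.integral_cong) (auto simp: indicator_def)
      also have "\<dots> = 0" using compl int g tot by simp
      finally show ?case using compl by auto
    next
      case (union A)
      then have [measurable]: "\<And>i. A i \<in> sets borel" by auto
      have "(\<lambda>n. \<integral>x. indicator (\<Union>i<n. A i) x * g x \<partial>lborel) \<longlonglongrightarrow> (\<integral>x. indicator (\<Union>i. A i) x * g x \<partial>lborel)"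
      proof (rule integral_dominated_convergence[where w="\<lambda>x. \<bar>g x\<bar>"])
        show "AE x in lborel. (\<lambda>n. indicator (\<Union>i<n. A i) x * g x) \<longlonglongrightarrow> indicator (\<Union>i. A i) x * g x"
        proof (intro AE_I2 tendsto_mult tendsto_const)
          fix x
          show "(\<lambda>n. indicator (\<Union>i<n. A i) x) \<longlonglongrightarrow> (indicator (\<Union>i. A i) x :: real)"
            by (rule LIMSEQ_indicator_UN)
        qed
        show "AE x in lborel. norm (indicator (\<Union>i<n. A i) x * g x) \<le> \<bar>g x\<bar>" for n
          by (auto simp: indicator_def)
      qed (use g in auto)
      moreover have "(\<integral>x. indicator (\<Union>i<n. A i) x * g x \<partial>lborel) = 0" for n
      proof -
        have "(indicator (\<Union>i<n. A i) x :: real) = (\<Sum>i<n. indicator (A i) x)" for x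
          by (rule indicator_UN_disjoint) (use union(1) in \<open>auto simp: disjoint_family_on_def\<close>)
        then have "(\<integral>x. indicator (\<Union>i<n. A i) x * g x \<partial>lborel) = (\<integral>x. (\<Sum>i<n. indicator (A i) x * g x) \<partial>lborel)"
          by (simp add: sum_distrib_right)
        also have "\<dots> = (\<Sum>i<n. \<integral>x. indicator (A i) x * g x \<partial>lborel)"
          by (rule Bochner_Integration.integral_sum) (auto intro: int)
        finally show ?thesis using union by simp
      qed
      ultimately have "(\<lambda>n. 0) \<longlonglongrightarrow> (\<integral>x. indicator (\<Union>i. A i) x * g x \<partial>lborel)" by (simp only:)
      then show ?case using union by (auto simp: LIMSEQ_const_iff)
    qed auto
    then show ?thesis by simp
  qed
  have part: "AE x in lborel. h x \<le> 0" if [measurable]: "h \<in> borel_measurable borel" and h: "integrable lborel h"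
    and z: "\<And>A. A \<in> sets borel \<Longrightarrow> (\<integral>x. indicator A x * h x \<partial>lborel) = 0" for h :: "'a \<Rightarrow> real"
  proof -
    let ?A = "{x. h x > 0}"
    have A: "?A \<in> sets borel" by measurable
    have "AE x in lborel. indicator ?A x * h x = 0"
      using integral_nonneg_eq_0_iff_AE[of lborel "\<lambda>x. indicator ?A x * h x"] z[OF A] 
        integrable_mult_indicator[OF _ h, of ?A] A
      by (auto simp: indicator_def)
    then show ?thesis by eventually_elim (auto simp: indicator_def split: if_splits)
  qed
  have "AE x in lborel. g x \<le> 0" by (rule part) (use g zero in auto)
  moreover have "AE x in lborel. - g x \<le> 0" by (rule part) (use g zero in auto)
  ultimately show ?thesis by eventually_elim auto
qed

lemma intg_eq_lebesgue:
  fixes f :: "'a::euclidean_space \<Rightarrow> real"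
  assumes "S \<in> sets lebesgue"
  shows "intg S f = (\<integral>x. indicator S x * f x \<partial>lebesgue)"
  using assms by (subst integral_restrict_space) auto

text \<open>Cutoffs of a box contained in \<open>S\<close> converge boundedly to its indicator, so
  the integral of \<open>u\<close> over each such box vanishes. The conclusion is local and is
  assembled from a countable cover of \<open>S\<close> by boxes.\<close>

lemma test_fun_orthogonal_AE:
  fixes u :: "'a::euclidean_space \<Rightarrow> real"
  assumes S: "open S" "bounded S" and u: "L2 S u"
    and orth: "\<And>\<phi>. test_fun S \<phi> \<Longrightarrow> ip S u \<phi> = 0"
  shows "AE x in lebesgue_on S. u x = 0"
proof -
  have Sm: "S \<in> lmeasurable" using S by (simp add: lmeasurable_open)
  then have Sl: "S \<in> sets lebesgue" by (simp add: fmeasurableD)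
  have one: "L2 S (\<lambda>x. 1::real)" by (rule L2_bounded[OF Sm, of _ 1]) auto
  have ui: "integrable (lebesgue_on S) u" using L2_integrable_mult[OF u one] by simp
  have boxz: "(\<integral>x. indicator (box a b) x * (indicator S x * u x) \<partial>lebesgue) = 0" if "box a b \<subseteq> S" for a b
  proof -
    have t: "test_fun S (box_cutoff a b n)" for n
      using test_fun_mono[OF test_fun_box_cutoff that] .
    have "(\<lambda>n. intg S (\<lambda>x. u x * box_cutoff a b n x)) \<longlonglongrightarrow> intg S (\<lambda>x. u x * indicator (box a b) x)"
    proof (rule integral_dominated_convergence[where w="\<lambda>x. \<bar>u x\<bar>"])
      show "(\<lambda>x. u x * box_cutoff a b n x) \<in> borel_measurable (lebesgue_on S)" for n
        using L2_integrable_mult[OF u L2_test_fun[OF Sm t]] by (rule borel_measurable_integrable)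
      have "indicator (box a b) \<in> borel_measurable (lebesgue_on S)"
        by (intro measurable_restrict_space1 borel_measurable_indicator) auto
      then show "(\<lambda>x. u x * indicator (box a b) x) \<in> borel_measurable (lebesgue_on S)"
        using L2_measurable[OF u] by (intro borel_measurable_times) auto
      show "AE x in lebesgue_on S. (\<lambda>n. u x * box_cutoff a b n x) \<longlonglongrightarrow> u x * indicator (box a b) x"
        by (intro AE_I2 tendsto_mult tendsto_const box_cutoff_limit)
      show "AE x in lebesgue_on S. norm (u x * box_cutoff a b n x) \<le> \<bar>u x\<bar>" for n
        using box_cutoff_bounds[of a b n] by (auto simp: abs_mult mult_left_le)
    qed (use ui in auto)
    moreover have "intg S (\<lambda>x. u x * box_cutoff a b n x) = 0" for n
      using orth[OF t, of n] by (simp add: ip_def)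
    ultimately have "(\<lambda>n. 0) \<longlonglongrightarrow> intg S (\<lambda>x. u x * indicator (box a b) x)" by (simp only:)
    then have "intg S (\<lambda>x. u x * indicator (box a b) x) = 0" by (simp add: LIMSEQ_const_iff)
    then show ?thesis by (simp add: intg_eq_lebesgue[OF Sl] mult_ac)
  qed
  \<comment> \<open>Only boxes inside \<open>S\<close> are within reach of test functions. The
    indicator of \<open>box c d\<close> reduces an arbitrary box to an intersection, which is again
    a box inside \<open>S\<close>.\<close>
  have loc: "AE x in lebesgue. x \<in> box c d \<longrightarrow> u x = 0" if cd: "box c d \<subseteq> S" for c d
  proof -
    let ?g = "\<lambda>x. indicator (box c d) x * (indicator S x * u x)"
    have gi: "integrable lebesgue ?g"
    proof -
      have "integrable lebesgue (\<lambda>x. indicator S x * u x)"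
        using ui Sl by (simp add: integrable_restrict_space)
      from integrable_mult_indicator[OF _ this, of "box c d"] show ?thesis by simp
    qed
    \<comment> \<open>The product is only Lebesgue measurable, whereas the Dynkin argument runs over
      Borel sets; hence a Borel representative.\<close>
    obtain h where h: "h \<in> borel_measurable lborel" "AE x in lborel. ?g x = h x"
      using completion_ex_borel_measurable_real[OF borel_measurable_integrable[OF gi]] by blast
    have hl: "AE x in lebesgue. ?g x = h x" using AE_completion[OF h(2)] .
    have eq: "(\<integral>x. indicator A x * h x \<partial>lborel) = (\<integral>x. indicator A x * ?g x \<partial>lebesgue)" if A: "A \<in> sets borel" for A
    proof -
      have "(\<lambda>x. indicator A x * h x) \<in> borel_measurable lborel"
        using h(1) A by measurable
      then have "(\<integral>x. indicator A x * h x \<partial>lborel) = (\<integral>x. indicator A x * h x \<partial>lebesgue)"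
        by (rule integral_completion[symmetric])
      also have "\<dots> = (\<integral>x. indicator A x * ?g x \<partial>lebesgue)"
      proof (rule integral_cong_AE)
        have "indicator A \<in> borel_measurable (lebesgue :: 'a measure)"
          using A by (intro borel_measurable_indicator) auto
        then show "(\<lambda>x. indicator A x * h x) \<in> borel_measurable lebesgue"
          "(\<lambda>x. indicator A x * ?g x) \<in> borel_measurable lebesgue"
          using measurable_completion[OF h(1)] borel_measurable_integrable[OF gi]
          by (auto intro!: borel_measurable_times)
      qed (use hl in auto)
      finally show ?thesis .
    qed
    have inter: "\<exists>a' b'. box a b \<inter> box c d = box a' b'" for a b :: 'a
      by (auto simp: box_Int_box)
    have "AE x in lborel. h x = 0"
    proof (rule box_integrals_zero_AE)
      show "integrable lborel h"
        using integrable_cong_AE_imp[OF gi measurable_completion[OF h(1)]] hl integrable_completion[OF h(1)]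
        by (auto simp: eq_commute)
      show "(\<integral>x. h x \<partial>lborel) = 0"
        using eq[of UNIV] boxz[OF cd] by simp
      show "(\<integral>x. indicator (box a b) x * h x \<partial>lborel) = 0" for a b
      proof -
        obtain a' b' where i: "box a b \<inter> box c d = box a' b'" using inter by blast
        have "(\<integral>x. indicator (box a b) x * h x \<partial>lborel) = (\<integral>x. indicator (box a' b') x * (indicator S x * u x) \<partial>lebesgue)"
          unfolding eq[OF borel_open[OF open_box]] i[symmetric] by (simp add: indicator_inter_arith mult_ac)
        then show ?thesis using boxz[of a' b'] i cd by auto
      qed
    qed
    then have "AE x in lebesgue. h x = 0" by (rule AE_completion)
    with hl show ?thesis by eventually_elim (use cd in \<open>auto simp: indicator_def split: if_splits\<close>)
  qed
  obtain D where D: "countable D" "\<And>X. X \<in> D \<Longrightarrow> \<exists>a b. X = box a b" "D \<subseteq> Pow S" "\<Union>D = S"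
    using open_countable_Union_open_box[OF S(1)] by metis
  have "AE x in lebesgue. \<forall>X\<in>D. x \<in> X \<longrightarrow> u x = 0"
    unfolding AE_ball_countable[OF D(1)] using D(2,3) loc by blast
  then have "AE x in lebesgue. x \<in> S \<longrightarrow> u x = 0" by eventually_elim (use D(4) in blast)
  then show ?thesis using Sl by (simp add: AE_restrict_space_iff)
qed

lemma L2conv_AE_cong:
  assumes "L2conv S X u" "AE x in lebesgue_on S. u x = w x" "L2 S w" shows "L2conv S X w"
proof -
  have L: "\<And>n. L2 S (X n)" "L2 S u" using assms by (auto simp: L2conv_def)
  have "nrm S (\<lambda>x. X n x - u x) = nrm S (\<lambda>x. X n x - w x)" for n
  proof -
    have ae: "AE x in lebesgue_on S. X n x - u x = X n x - w x" using assms(2) by eventually_elim simp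
    have l: "L2 S (\<lambda>x. X n x - u x)" "L2 S (\<lambda>x. X n x - w x)" using L assms(3) by (auto intro: L2_diff)
    show ?thesis unfolding nrm_def
      using ip_AE_cong[OF l(1,2,1) ae] ip_AE_cong[OF l(1,2,2) ae] by (simp add: ip_commute)
  qed
  then show ?thesis using assms(1,3) by (simp add: L2conv_def)
qed

text \<open>No mollifiers: the functional \<open>ip S u\<close> on test functions is represented by
  a limit \<open>w\<close> of test functions, and \<open>w - u\<close> is orthogonal to all of them,
  hence zero almost everywhere.\<close>

lemma test_fun_dense:
  fixes u :: "'a::euclidean_space \<Rightarrow> real"
  assumes S: "open S" "bounded S" and u: "L2 S u"
  obtains s where "\<And>n. test_fun S (s n)" "L2conv S s u"
proof -
  have Sm: "S \<in> lmeasurable" using S by (simp add: lmeasurable_open)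
  note L = L2_test_fun[OF Sm]
  define Rel where "Rel = {(\<phi>, r). test_fun S \<phi> \<and> r = ip S u \<phi>}"
  obtain w X where w: "L2 S w" "\<And>x r. (x, r) \<in> Rel \<Longrightarrow> ip S w x = r" "nrm S w \<le> \<bar>nrm S u\<bar>"
    "\<And>n. X n \<in> Rel" "L2conv S (\<lambda>n. fst (X n)) w"
  proof (rule Riesz_linear_relation[of Rel S "nrm S u"])
    show "(\<lambda>p. 0, 0) \<in> Rel" by (simp add: Rel_def test_fun_zero)
    show "(\<lambda>p. x p + y p, r + s) \<in> Rel" if "(x, r) \<in> Rel" "(y, s) \<in> Rel" for x r y s
      using that L u by (auto simp: Rel_def ip_add_right intro: test_fun_add)
    show "(\<lambda>p. c *\<^sub>R x p, c * r) \<in> Rel" if "(x, r) \<in> Rel" for x r c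
      using that by (auto simp: Rel_def ip_scaleR_right[of S u c x, simplified] intro: test_fun_scale)
    show "L2 S x" if "(x, r) \<in> Rel" for x r using that L by (auto simp: Rel_def)
    show "\<bar>r\<bar> \<le> nrm S u * nrm S x" if "(x, r) \<in> Rel" for x r
      using that L u by (auto simp: Rel_def intro: ip_Cauchy_Schwarz)
  qed auto
  have "AE x in lebesgue_on S. w x - u x = 0"
  proof (rule test_fun_orthogonal_AE[OF S L2_diff[OF w(1) u]])
    show "ip S (\<lambda>x. w x - u x) \<phi> = 0" if "test_fun S \<phi>" for \<phi>
      using w(2)[of \<phi> "ip S u \<phi>"] that by (simp add: Rel_def ip_diff_left[OF w(1) u L[OF that]])
  qed
  then have "L2conv S (\<lambda>n. fst (X n)) u" using L2conv_AE_cong[OF w(5) _ u] by simp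
  moreover have "test_fun S (fst (X n))" for n using w(4)[of n] by (auto simp: Rel_def)
  ultimately show thesis by (intro that[of "\<lambda>n. fst (X n)"]) auto
qed

lemma ip_cong: "(\<And>x. x \<in> S \<Longrightarrow> f x = f' x) \<Longrightarrow> (\<And>x. x \<in> S \<Longrightarrow> g x = g' x) \<Longrightarrow> ip S f g = ip S f' g'"
  unfolding ip_def by (rule Bochner_Integration.integral_cong) auto

lemma L2_cong: "(\<And>x. x \<in> S \<Longrightarrow> f x = f' x) \<Longrightarrow> L2 S f = L2 S f'"
proof -
  assume eq: "\<And>x. x \<in> S \<Longrightarrow> f x = f' x"
  have "f \<in> borel_measurable (lebesgue_on S) \<longleftrightarrow> f' \<in> borel_measurable (lebesgue_on S)"
    by (rule measurable_cong) (use eq in auto)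
  moreover have "integrable (lebesgue_on S) (\<lambda>x. (norm (f x))\<^sup>2) \<longleftrightarrow> integrable (lebesgue_on S) (\<lambda>x. (norm (f' x))\<^sup>2)"
    by (rule Bochner_Integration.integrable_cong) (use eq in auto)
  ultimately show ?thesis by (simp add: L2_def)
qed

lemma intg_cong: "(\<And>x. x \<in> S \<Longrightarrow> f x = f' x) \<Longrightarrow> intg S f = intg S f'"
  by (rule Bochner_Integration.integral_cong) auto

lemma nrm_cong: "(\<And>x. x \<in> S \<Longrightarrow> f x = f' x) \<Longrightarrow> nrm S f = nrm S f'"
  unfolding nrm_def using ip_cong[of S f f' f f'] by simp

section \<open>Integrals of derivatives of test functions\<close>

lemma integrable_test_fun:
  assumes "test_fun U \<phi>" shows "integrable lborel \<phi>"
proof -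
  obtain K where K: "smooth_fun \<phi>" "compact K" "K \<subseteq> U" "\<And>x. x \<notin> K \<Longrightarrow> \<phi> x = 0" using test_funE[OF assms] by blast
  have "(\<lambda>x. indicator K x *\<^sub>R \<phi> x) = \<phi>" using K(4) by (auto simp: indicator_def fun_eq_iff)
  then show ?thesis
    using borel_integrable_compact[OF K(2) smooth_fun_continuous[OF K(1)]] by simp
qed

lemma intg_eq_lborel:
  fixes f :: "'a::euclidean_space \<Rightarrow> real"
  assumes "U \<in> sets lebesgue" "f \<in> borel_measurable borel" "\<And>x. x \<notin> U \<Longrightarrow> f x = 0"
  shows "intg U f = (\<integral>x. f x \<partial>lborel)"
proof -
  have "intg U f = (\<integral>x. f x \<partial>lebesgue)"
    unfolding intg_eq_lebesgue[OF assms(1)] using assms(3)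
    by (intro Bochner_Integration.integral_cong) (auto simp: indicator_def)
  also have "\<dots> = (\<integral>x. f x \<partial>lborel)" by (rule integral_completion) (use assms(2) in simp)
  finally show ?thesis .
qed

lemma borel_measurable_test_fun: "test_fun U \<phi> \<Longrightarrow> \<phi> \<in> borel_measurable borel"
  by (intro borel_measurable_continuous_onI test_fun_continuous)

lemma integral_lborel_translation:
  fixes f :: "'a::euclidean_space \<Rightarrow> real"
  assumes "f \<in> borel_measurable borel"
  shows "(\<integral>x. f (x + c) \<partial>lborel) = (\<integral>x. f x \<partial>lborel)"
proof -
  have "(\<integral>x. f x \<partial>lborel) = (\<integral>x. f x \<partial>distr lborel borel ((+) c))"
    by (simp only: lborel_distr_plus)
  also have "\<dots> = (\<integral>x. f (c + x) \<partial>lborel)"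
    by (rule integral_distr) (use assms in auto)
  finally show ?thesis by (simp add: add.commute)
qed

lemma smooth_fun_difference_quotient:
  fixes \<phi> :: "'a::euclidean_space \<Rightarrow> real"
  assumes "smooth_fun \<phi>"
  shows "(\<lambda>n. Suc n * (\<phi> (x + (1 / Suc n) *\<^sub>R v) - \<phi> x)) \<longlonglongrightarrow> pderivs [v] \<phi> x"
proof -
  have "((\<lambda>h. \<phi> (x + h *\<^sub>R v)) has_derivative (\<lambda>h. pderivs [h *\<^sub>R v] \<phi> (x + 0 *\<^sub>R v))) (at 0)"
    by (rule has_derivative_eq_rhs, rule has_derivative_compose[OF _ smooth_fun_has_derivative[OF assms], where f="\<lambda>h. x + h *\<^sub>R v"])
       (auto intro!: derivative_eq_intros)
  moreover have "pderivs [h *\<^sub>R v] \<phi> y = h *\<^sub>R pderivs [v] \<phi> y" for h y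
    using linear_scale[OF has_derivative_linear[OF smooth_fun_has_derivative[OF assms]]] .
  moreover have "(*) (pderivs [v] \<phi> x) = (\<lambda>h. h * pderivs [v] \<phi> x)"
    by (simp add: fun_eq_iff mult.commute)
  ultimately have "((\<lambda>h. \<phi> (x + h *\<^sub>R v)) has_real_derivative pderivs [v] \<phi> x) (at 0)"
    by (simp add: has_field_derivative_def)
  then have "((\<lambda>h. (\<phi> (x + h *\<^sub>R v) - \<phi> x) / h) \<longlongrightarrow> pderivs [v] \<phi> x) (at 0)"
    by (simp add: DERIV_def)
  moreover have "filterlim (\<lambda>n. 1 / real (Suc n)) (at 0) sequentially"
    unfolding filterlim_at using LIMSEQ_inverse_real_of_nat by (simp add: inverse_eq_divide)
  ultimately have "(\<lambda>n. (\<phi> (x + (1 / real (Suc n)) *\<^sub>R v) - \<phi> x) / (1 / real (Suc n))) \<longlonglongrightarrow> pderivs [v] \<phi> x"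
    by (rule filterlim_compose)
  then show ?thesis by (simp add: mult.commute)
qed

lemma test_fun_compose_translation:
  assumes "test_fun U \<phi>" shows "test_fun ((\<lambda>x. x - c) ` U) (\<lambda>x. \<phi> (x + c))"
proof -
  obtain K where K: "smooth_fun \<phi>" "compact K" "K \<subseteq> U" "\<And>x. x \<notin> K \<Longrightarrow> \<phi> x = 0" using test_funE[OF assms] by blast
  show ?thesis
  proof (rule test_funI[of _ "(\<lambda>x. x - c) ` K"])
    show "smooth_fun (\<lambda>x. \<phi> (x + c))" by (rule smooth_fun_compose_affine[OF K(1) bounded_linear_ident])
    show "compact ((\<lambda>x. x - c) ` K)" by (intro compact_continuous_image continuous_intros K)
    show "\<phi> (x + c) = 0" if "x \<notin> (\<lambda>x. x - c) ` K" for x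
      using that K(4)[of "x + c"] by (metis add_diff_cancel_right' imageI)
  qed (use K in auto)
qed

text \<open>Difference quotients in direction \<open>v\<close> have integral zero by translation
  invariance of Lebesgue measure, and they converge boundedly inside one ball. All directions are
  treated alike, with no iterated integrals.\<close>

lemma integral_pderiv_test_fun:
  assumes t: "test_fun U \<phi>" shows "(\<integral>x. pderivs [v] \<phi> x \<partial>lborel) = 0"
proof -
  note [measurable] = borel_measurable_test_fun[OF t] borel_measurable_test_fun[OF test_fun_pderiv[OF t, of v]]
  obtain K where K: "smooth_fun \<phi>" "compact K" "K \<subseteq> U" "\<And>x. x \<notin> K \<Longrightarrow> \<phi> x = 0" using test_funE[OF t] by blast
  obtain B where B: "0 \<le> B" "\<And>x. \<bar>pderivs [v] \<phi> x\<bar> \<le> B" using test_fun_bounded[OF test_fun_pderiv[OF t]] by blast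
  let ?D = "\<lambda>n x. Suc n * (\<phi> (x + (1 / Suc n) *\<^sub>R v) - \<phi> x)"
  obtain r where r: "\<And>x. x \<in> K \<Longrightarrow> norm x \<le> r" using compact_imp_bounded[OF K(2)] by (auto simp: bounded_iff)
  \<comment> \<open>The increment is an integral of the derivative over a segment of length
    \<open>1 / Suc n\<close>; the factor \<open>Suc n\<close> cancels and the bound of the
    derivative remains.\<close>
  have bound: "\<bar>?D n x\<bar> \<le> B" for n x
  proof -
    let ?h = "1 / real (Suc n)"
    have "\<phi> (x + ?h *\<^sub>R v) - \<phi> x = integral (cbox 0 ?h) (\<lambda>r. pderivs [v] \<phi> (x + r *\<^sub>R v))"
      using pderiv_tavg_same[OF K(1), of ?h v x] by (simp add: pderiv_tavg[OF K(1)] tavg_def)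
    also have "norm \<dots> \<le> B * measure lborel (cbox 0 ?h)"
    proof (rule integrable_bound[OF B(1)])
      show "(\<lambda>r. pderivs [v] \<phi> (x + r *\<^sub>R v)) integrable_on cbox 0 ?h"
        by (intro integrable_continuous continuous_on_compose2[OF test_fun_continuous[OF test_fun_pderiv[OF t], of UNIV]])
           (auto intro!: continuous_intros)
    qed (use B(2) in auto)
    finally have "\<bar>\<phi> (x + ?h *\<^sub>R v) - \<phi> x\<bar> \<le> B * ?h" by simp
    then have "real (Suc n) * \<bar>\<phi> (x + ?h *\<^sub>R v) - \<phi> x\<bar> \<le> real (Suc n) * (B * ?h)" by (intro mult_left_mono) auto
    then show ?thesis by (simp add: abs_mult)
  qed
  \<comment> \<open>No shift is longer than \<open>norm v\<close>, so one enlarged ball contains the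
    supports of all quotients.\<close>
  have out: "?D n x = 0" if x: "x \<notin> cball 0 (r + norm v)" for n x
  proof -
    have n: "norm ((1 / real (Suc n)) *\<^sub>R v) \<le> norm v" by (simp add: mult_left_le_one_le field_simps)
    have "norm x > r + norm v" using x by simp
    moreover have "norm x \<le> norm (x + (1 / Suc n) *\<^sub>R v) + norm ((1 / Suc n) *\<^sub>R v)"
      using norm_triangle_ineq4[of "x + (1 / Suc n) *\<^sub>R v" "(1 / Suc n) *\<^sub>R v"] by simp
    ultimately have "r < norm (x + (1 / Suc n) *\<^sub>R v)" "r < norm x" using n norm_ge_zero[of v] by linarith+
    then show ?thesis using K(4) r by (metis diff_zero less_le_not_le mult_zero_right)
  qed
  have "(\<lambda>n. \<integral>x. ?D n x \<partial>lborel) \<longlonglongrightarrow> (\<integral>x. pderivs [v] \<phi> x \<partial>lborel)"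
  proof (rule integral_dominated_convergence[where w="\<lambda>x. indicator (cball 0 (r + norm v)) x *\<^sub>R B"])
    show "integrable lborel (\<lambda>x::'a. indicator (cball 0 (r + norm v)) x *\<^sub>R B)"
      by (rule borel_integrable_compact) auto
    show "AE x in lborel. norm (?D n x) \<le> indicator (cball 0 (r + norm v)) x *\<^sub>R B" for n
      using bound[of n] out[of _ n] by (auto simp: indicator_def)
    show "AE x in lborel. (\<lambda>n. ?D n x) \<longlonglongrightarrow> pderivs [v] \<phi> x"
      using smooth_fun_difference_quotient[OF K(1)] by auto
  qed measurable
  moreover have "(\<integral>x. ?D n x \<partial>lborel) = 0" for n
  proof -
    have i: "integrable lborel (\<lambda>x. \<phi> (x + (1 / Suc n) *\<^sub>R v))"
      using integrable_test_fun[OF test_fun_compose_translation[OF t]] .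
    show ?thesis
      using i integrable_test_fun[OF t] integral_lborel_translation[of \<phi>] by simp
  qed
  ultimately have "(\<lambda>n. 0) \<longlonglongrightarrow> (\<integral>x. pderivs [v] \<phi> x \<partial>lborel)" by (simp only:)
  then show ?thesis by (simp add: LIMSEQ_const_iff)
qed

lemma intg_pderiv_test_fun:
  assumes "test_fun U \<phi>" "U \<in> sets lebesgue" shows "intg U (pderivs [v] \<phi>) = 0"
  using intg_eq_lborel[OF assms(2) borel_measurable_test_fun[OF test_fun_pderiv[OF assms(1)]]]
    test_fun_outside[OF test_fun_pderiv[OF assms(1)]] integral_pderiv_test_fun[OF assms(1)] by simp

section \<open>Derivatives in time and in space\<close>

lemma dt_eq: "dt \<phi> = pderivs [(1, 0)] \<phi>" by (simp add: dt_def)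

abbreviation dx :: "'d \<Rightarrow> (real \<times> (real^'d) \<Rightarrow> real) \<Rightarrow> real \<times> (real^'d) \<Rightarrow> real" where
  "dx i \<equiv> pderivs [(0, axis i 1)]"

lemma gradx_nth: "gradx \<phi> p $ i = dx i \<phi> p" by (simp add: gradx_def)

lemma dt_mult: "smooth_fun f \<Longrightarrow> smooth_fun g \<Longrightarrow> dt (\<lambda>p. f p * g p) p = f p * dt g p + dt f p * g p"
  unfolding dt_eq by (intro pderiv_mult smooth_fun_differentiable)

lemma gradx_mult: "smooth_fun f \<Longrightarrow> smooth_fun g \<Longrightarrow> gradx (\<lambda>p. f p * g p) p = f p *\<^sub>R gradx g p + g p *\<^sub>R gradx f p"
  by (simp add: vec_eq_iff gradx_nth pderiv_mult smooth_fun_differentiable mult.commute)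

lemma pderiv_scale: "smooth_fun f \<Longrightarrow> pderivs [v] (\<lambda>p. c * f p) p = c * pderivs [v] f p"
  by (rule pderiv_eq) (intro has_derivative_mult_right smooth_fun_has_derivative)

lemma pderiv_diff: "smooth_fun f \<Longrightarrow> smooth_fun g \<Longrightarrow> pderivs [v] (\<lambda>p. f p - g p) p = pderivs [v] f p - pderivs [v] g p"
  by (rule pderiv_eq) (intro has_derivative_diff smooth_fun_has_derivative)

lemma test_fun_diff: "test_fun U f \<Longrightarrow> test_fun U g \<Longrightarrow> test_fun U (\<lambda>x. f x - g x)"
  using test_fun_add[of U f "\<lambda>x. -1 * g x"] test_fun_scale[of U g "-1"] by simp

lemma smooth_fun_time: "smooth_fun (\<lambda>p. fst p :: real)"
  using smooth_fun_affine[of "(1 :: real, 0)" 0] by (simp add: inner_prod_def inner_real_def)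

lemma dt_time: "dt (\<lambda>p. fst p) p = 1"
  using pderiv_affine[of "(1 :: real, 0)" "(1, 0)" 0 p] by (simp add: dt_eq inner_prod_def)

text \<open>The reason why t, T - t and time cutoffs can be multiplied into weak gradient and
  divergence relations: they pass through the spatial gradient.\<close>

lemma gradx_time_fun:
  assumes "smooth_fun (h :: real \<Rightarrow> real)" shows "gradx (\<lambda>p. h (fst p)) p = 0"
proof -
  have "dx i (\<lambda>p. h (fst p)) p = pderivs [0] h (fst p)" for i
    using pderiv_compose_affine[OF assms bounded_linear_fst, of "(0, axis i 1)" 0 p] by simp
  moreover have "pderivs [0] h (fst p) = 0"
    using linear_0[OF has_derivative_linear[OF smooth_fun_has_derivative[OF assms]]] .
  ultimately show ?thesis by (simp add: vec_eq_iff gradx_nth)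
qed

section \<open>Convergence and components in the square norm\<close>

lemma ip_lin_left:
  assumes "L2 S f" "L2 S g" "L2 S h"
  shows "ip S (\<lambda>x. c * f x + d * g x :: real) h = c * ip S f h + d * ip S g h"
  using ip_add_left[of S "\<lambda>x. c * f x" "\<lambda>x. d * g x" h] ip_scaleR_left[of S c f h] ip_scaleR_left[of S d g h]
    assms by (simp add: L2_mult_left)

lemma L2_lin: "L2 S f \<Longrightarrow> L2 S g \<Longrightarrow> L2 S (\<lambda>x. c * f x + d * g x :: real)"
  by (intro L2_add L2_mult_left)

lemma L2conv_Cauchy:
  assumes "L2conv S X u" "0 < e"
  shows "\<exists>N. \<forall>m\<ge>N. \<forall>n\<ge>N. nrm S (\<lambda>x. X m x - X n x) < e"
proof -
  have L: "\<And>n. L2 S (X n)" "L2 S u" and conv: "(\<lambda>n. nrm S (\<lambda>x. X n x - u x)) \<longlonglongrightarrow> 0"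
    using assms by (auto simp: L2conv_def)
  obtain N where "\<forall>n\<ge>N. norm (nrm S (\<lambda>x. X n x - u x) - 0) < e / 2"
    using LIMSEQ_D[OF conv half_gt_zero[OF \<open>0 < e\<close>]] by blast
  then have N: "\<And>n. n \<ge> N \<Longrightarrow> nrm S (\<lambda>x. X n x - u x) < e / 2" by simp
  have "nrm S (\<lambda>x. X m x - X n x) < e" if "m \<ge> N" "n \<ge> N" for m n
    using nrm_triangle_diff[OF L(1) L(2) L(1), of m n] N[OF that(1)] N[OF that(2)] nrm_diff_commute[of S "X n" u] by simp
  then show ?thesis by blast
qed

text \<open>Extension by continuity of an operation known only on an approximating sequence: the
  bound on differences transports the Cauchy property, possibly to functions on another
  domain.\<close>

lemma L2conv_of_Cauchy_bound:
  assumes X: "L2conv S X u" and Y: "\<And>n. L2 S' (Y n)"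
    and bound: "\<And>m n. nrm S' (\<lambda>x. Y m x - Y n x) \<le> C * nrm S (\<lambda>x. X m x - X n x)"
  obtains w where "L2conv S' Y w"
proof (rule Riesz_Fischer[OF Y])
  fix e :: real assume "0 < e"
  \<comment> \<open>The divisor \<open>\<bar>C\<bar> + 1\<close> keeps the threshold positive
    whatever the value of \<open>C\<close>.\<close>
  then obtain N where N: "\<And>m n. m \<ge> N \<Longrightarrow> n \<ge> N \<Longrightarrow> nrm S (\<lambda>x. X m x - X n x) < e / (\<bar>C\<bar> + 1)"
    using L2conv_Cauchy[OF X, of "e / (\<bar>C\<bar> + 1)"] by auto
  have "nrm S' (\<lambda>x. Y m x - Y n x) < e" if "m \<ge> N" "n \<ge> N" for m n
  proof -
    have "nrm S' (\<lambda>x. Y m x - Y n x) \<le> C * nrm S (\<lambda>x. X m x - X n x)" by (rule bound)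
    also have "\<dots> \<le> (\<bar>C\<bar> + 1) * nrm S (\<lambda>x. X m x - X n x)" by (intro mult_right_mono) auto
    also have "\<dots> < e" using N[OF that] by (simp add: field_simps)
    finally show ?thesis .
  qed
  then show "\<exists>N. \<forall>m\<ge>N. \<forall>n\<ge>N. nrm S' (\<lambda>x. Y m x - Y n x) < e" by blast
qed

lemma LIMSEQ_eq_unique:
  fixes a b :: "'a::t2_space"
  assumes "X \<longlonglongrightarrow> a" "Y \<longlonglongrightarrow> b" "\<And>n. X n = Y n" shows "a = b"
proof -
  have "X = Y" using assms(3) by (rule ext)
  then show ?thesis using LIMSEQ_unique assms(1,2) by metis
qed

lemma square_le_mult_imp_le: "x\<^sup>2 \<le> c * x \<Longrightarrow> 0 \<le> x \<Longrightarrow> 0 \<le> c \<Longrightarrow> x \<le> (c::real)"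
  by (cases "x = 0") (auto simp: power2_eq_square)

lemma LIMSEQ_zero_le:
  fixes f :: "nat \<Rightarrow> real"
  assumes "g \<longlonglongrightarrow> 0" "\<And>n. 0 \<le> f n" "\<And>n. f n \<le> g n" shows "f \<longlonglongrightarrow> 0"
  by (rule tendsto_sandwich[OF _ _ tendsto_const assms(1)]) (use assms in auto)

lemma L2_integrable:
  assumes "S \<in> lmeasurable" "L2 S f" shows "integrable (lebesgue_on S) f"
proof (rule Bochner_Integration.integrable_bound)
  interpret finite_measure "lebesgue_on S" using assms(1) by (rule finite_measure_lebesgue_on)
  show "integrable (lebesgue_on S) (\<lambda>x. 1 + (norm (f x))\<^sup>2)"
    by (intro Bochner_Integration.integrable_add L2_sq assms integrable_const)
  show "AE x in lebesgue_on S. norm (f x) \<le> norm (1 + (norm (f x))\<^sup>2)"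
  proof (rule AE_I2)
    fix x
    have "2 * norm (f x) * 1 \<le> (norm (f x))\<^sup>2 + 1\<^sup>2" by (rule sum_squares_bound)
    moreover have "norm (f x) \<le> 2 * norm (f x) * 1" by simp
    ultimately have "norm (f x) \<le> (norm (f x))\<^sup>2 + 1\<^sup>2" by (rule order_trans[rotated])
    then show "norm (f x) \<le> norm (1 + (norm (f x))\<^sup>2)" by simp
  qed
qed (rule L2_measurable[OF assms(2)])

lemma intg_nth:
  fixes f :: "'a::euclidean_space \<Rightarrow> real^'n"
  assumes "S \<in> lmeasurable" "L2 S f" shows "intg S f $ i = intg S (\<lambda>x. f x $ i)"
  using integral_bounded_linear[OF bounded_linear_vec_nth L2_integrable[OF assms], of i] by simp

lemma L2_test_scaleR:
  assumes "S \<in> lmeasurable" "test_fun U \<phi>" "L2 S f" shows "L2 S (\<lambda>x. \<phi> x *\<^sub>R f x)"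
proof -
  obtain B where "\<And>x. \<bar>\<phi> x\<bar> \<le> B" using test_fun_bounded[OF assms(2)] by blast
  then show ?thesis
    by (intro L2_bounded_mult[OF assms(3) continuous_measurable_lebesgue_on, of _ B] test_fun_continuous[OF assms(2)]) auto
qed

lemma intg_scaleR_nth:
  fixes f :: "'a::euclidean_space \<Rightarrow> real^'n"
  assumes "S \<in> lmeasurable" "test_fun U \<phi>" "L2 S f"
  shows "intg S (\<lambda>x. \<phi> x *\<^sub>R f x) $ i = ip S (\<lambda>x. f x $ i) \<phi>"
  unfolding intg_nth[OF assms(1) L2_test_scaleR[OF assms]] by (simp add: ip_def mult.commute)

lemma L2conv_vec:
  fixes X :: "nat \<Rightarrow> 'a::euclidean_space \<Rightarrow> real^'n"
  assumes "\<And>i. L2conv S (\<lambda>n x. X n x $ i) (\<lambda>x. u x $ i)" shows "L2conv S X u"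
proof -
  have L: "\<And>n. L2 S (X n)" "L2 S u" using assms by (auto simp: L2conv_def intro: L2_vec)
  have "(\<lambda>n. \<Sum>i\<in>UNIV. (nrm S (\<lambda>x. X n x $ i - u x $ i))\<^sup>2) \<longlonglongrightarrow> (\<Sum>i\<in>(UNIV::'n set). 0\<^sup>2)"
    using assms by (intro tendsto_sum tendsto_power) (auto simp: L2conv_def)
  moreover have "(nrm S (\<lambda>x. X n x - u x))\<^sup>2 = (\<Sum>i\<in>UNIV. (nrm S (\<lambda>x. X n x $ i - u x $ i))\<^sup>2)" for n
    unfolding nrm_sq by (subst ip_vec) (use L in \<open>auto intro: L2_diff\<close>)
  ultimately have "(\<lambda>n. sqrt ((nrm S (\<lambda>x. X n x - u x))\<^sup>2)) \<longlonglongrightarrow> sqrt 0" by (intro tendsto_real_sqrt) simp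
  then show ?thesis using L by (simp add: L2conv_def)
qed

lemma L2conv_nth:
  fixes X :: "nat \<Rightarrow> 'a::euclidean_space \<Rightarrow> real^'n"
  assumes "L2conv S X u" shows "L2conv S (\<lambda>n x. X n x $ i) (\<lambda>x. u x $ i)"
proof -
  have L: "\<And>n. L2 S (X n)" "L2 S u" using assms by (auto simp: L2conv_def)
  have "nrm S (\<lambda>x. X n x $ i - u x $ i) \<le> nrm S (\<lambda>x. X n x - u x)" for n
  proof (rule power2_le_imp_le)
    have "(nrm S (\<lambda>x. X n x - u x))\<^sup>2 = (\<Sum>i\<in>UNIV. (nrm S (\<lambda>x. X n x $ i - u x $ i))\<^sup>2)"
      unfolding nrm_sq by (subst ip_vec) (use L in \<open>auto intro: L2_diff\<close>)
    moreover have "(nrm S (\<lambda>x. X n x $ i - u x $ i))\<^sup>2 \<le> (\<Sum>i\<in>UNIV. (nrm S (\<lambda>x. X n x $ i - u x $ i))\<^sup>2)"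
      by (rule member_le_sum[where f="\<lambda>i. (nrm S (\<lambda>x. X n x $ i - u x $ i))\<^sup>2"]) auto
    ultimately show "(nrm S (\<lambda>x. X n x $ i - u x $ i))\<^sup>2 \<le> (nrm S (\<lambda>x. X n x - u x))\<^sup>2" by (simp only:)
  qed simp
  moreover have "(\<lambda>n. nrm S (\<lambda>x. X n x - u x)) \<longlonglongrightarrow> 0" using assms by (simp add: L2conv_def)
  ultimately have "(\<lambda>n. nrm S (\<lambda>x. X n x $ i - u x $ i)) \<longlonglongrightarrow> 0" by (intro LIMSEQ_zero_le[OF _ nrm_nonneg])
  then show ?thesis using L by (simp add: L2conv_def L2_nth)
qed

lemma L2conv_eventually: "L2conv S X u \<Longrightarrow> 0 < e \<Longrightarrow> \<forall>\<^sub>F n in sequentially. nrm S (\<lambda>x. X n x - u x) < e"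
  by (auto simp: L2conv_def intro: order_tendstoD(2))

text \<open>Dominated convergence with majorant \<open>(norm (f x))\<^sup>2\<close>, since
  \<open>m n x - 1\<close> has modulus at most 1. It serves to insert time cutoffs.\<close>

lemma L2conv_cutoff:
  fixes f :: "'a::euclidean_space \<Rightarrow> 'b::euclidean_space"
  assumes f: "L2 S f" and m: "\<And>n. m n \<in> borel_measurable (lebesgue_on S)"
    and b: "\<And>n x. 0 \<le> m n x \<and> m n x \<le> (1::real)" and lim: "\<And>x. x \<in> S \<Longrightarrow> (\<lambda>n. m n x) \<longlonglongrightarrow> 1"
  shows "L2conv S (\<lambda>n x. m n x *\<^sub>R f x) f"
proof -
  have L: "L2 S (\<lambda>x. m n x *\<^sub>R f x)" for n
    by (rule L2_bounded_mult[OF f m, of _ 1]) (use b in auto)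
  have "(\<lambda>n. intg S (\<lambda>x. (norm (m n x *\<^sub>R f x - f x))\<^sup>2)) \<longlonglongrightarrow> intg S (\<lambda>x. 0)"
  proof (rule integral_dominated_convergence[where w="\<lambda>x. (norm (f x))\<^sup>2"])
    show "AE x in lebesgue_on S. (\<lambda>n. (norm (m n x *\<^sub>R f x - f x))\<^sup>2) \<longlonglongrightarrow> 0"
    proof (rule AE_I2)
      fix x assume "x \<in> space (lebesgue_on S)"
      then have "(\<lambda>n. (norm (m n x *\<^sub>R f x - f x))\<^sup>2) \<longlonglongrightarrow> (norm (1 *\<^sub>R f x - f x))\<^sup>2"
        by (intro tendsto_intros lim) simp
      then show "(\<lambda>n. (norm (m n x *\<^sub>R f x - f x))\<^sup>2) \<longlonglongrightarrow> 0" by simp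
    qed
    show "AE x in lebesgue_on S. norm ((norm (m n x *\<^sub>R f x - f x))\<^sup>2) \<le> (norm (f x))\<^sup>2" for n
    proof (rule AE_I2)
      fix x
      have "m n x *\<^sub>R f x - f x = (m n x - 1) *\<^sub>R f x" by (simp add: algebra_simps)
      then have "norm (m n x *\<^sub>R f x - f x) \<le> norm (f x)"
        using b[of n x] by (simp add: mult_left_le_one_le)
      then show "norm ((norm (m n x *\<^sub>R f x - f x))\<^sup>2) \<le> (norm (f x))\<^sup>2" by (simp add: power_mono)
    qed
    show "(\<lambda>x. (norm (m n x *\<^sub>R f x - f x))\<^sup>2) \<in> borel_measurable (lebesgue_on S)" for n
      by (rule borel_measurable_integrable[OF L2_sq[OF L2_diff[OF L f]]])
  qed (use L2_sq[OF f] in auto)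
  then have "(\<lambda>n. sqrt (ip S (\<lambda>x. m n x *\<^sub>R f x - f x) (\<lambda>x. m n x *\<^sub>R f x - f x))) \<longlonglongrightarrow> sqrt 0"
    unfolding ip_self by (intro tendsto_real_sqrt) simp
  then show ?thesis using L f by (simp add: L2conv_def nrm_def)
qed

lemma ip_lin_right:
  assumes "L2 S f" "L2 S g" "L2 S h"
  shows "ip S h (\<lambda>x. c *\<^sub>R f x + d *\<^sub>R g x) = c * ip S h f + d * ip S h g"
  using assms by (simp add: ip_add_right ip_scaleR_right L2_scaleR)

lemma ip_lin_left':
  assumes "L2 S f" "L2 S g" "L2 S h"
  shows "ip S (\<lambda>x. c *\<^sub>R f x + d *\<^sub>R g x) h = c * ip S f h + d * ip S g h"
  using assms by (simp add: ip_add_left ip_scaleR_left L2_scaleR)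

lemma test_fun_lin: "test_fun U f \<Longrightarrow> test_fun U g \<Longrightarrow> test_fun U (\<lambda>p. c * f p + d * g p)"
  by (intro test_fun_add test_fun_scale)

lemma pderiv_lin:
  assumes "smooth_fun f" "smooth_fun g"
  shows "pderivs [v] (\<lambda>p. c * f p + d * g p) p = c * pderivs [v] f p + d * pderivs [v] g p"
  by (rule pderiv_eq) (intro has_derivative_add has_derivative_mult_right smooth_fun_has_derivative assms)

lemma nrm_sq_Pair:
  assumes "L2 S f" "L2 S g"
  shows "(nrm S (\<lambda>x. (f x, g x)))\<^sup>2 = (nrm S f)\<^sup>2 + (nrm S g)\<^sup>2"
  unfolding nrm_sq by (rule ip_Pair) (use assms in auto)

lemma nrm_fst_snd_le:
  assumes "L2 S f" shows "nrm S (\<lambda>x. fst (f x)) \<le> nrm S f" "nrm S (\<lambda>x. snd (f x)) \<le> nrm S f"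
proof -
  have "(nrm S f)\<^sup>2 = (nrm S (\<lambda>x. fst (f x)))\<^sup>2 + (nrm S (\<lambda>x. snd (f x)))\<^sup>2"
    using nrm_sq_Pair[OF L2_fst[OF assms] L2_snd[OF assms]] by simp
  then show "nrm S (\<lambda>x. fst (f x)) \<le> nrm S f" "nrm S (\<lambda>x. snd (f x)) \<le> nrm S f"
    by (auto intro: power2_le_imp_le)
qed

lemma L2conv_fst_snd:
  assumes "L2conv S X u" shows "L2conv S (\<lambda>n x. fst (X n x)) (\<lambda>x. fst (u x))" "L2conv S (\<lambda>n x. snd (X n x)) (\<lambda>x. snd (u x))"
proof -
  have L: "\<And>n. L2 S (X n)" "L2 S u" and lim: "(\<lambda>n. nrm S (\<lambda>x. X n x - u x)) \<longlonglongrightarrow> 0"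
    using assms by (auto simp: L2conv_def)
  note le = nrm_fst_snd_le[OF L2_diff[OF L(1) L(2)]]
  show "L2conv S (\<lambda>n x. fst (X n x)) (\<lambda>x. fst (u x))" "L2conv S (\<lambda>n x. snd (X n x)) (\<lambda>x. snd (u x))"
    unfolding L2conv_def
    using LIMSEQ_zero_le[OF lim nrm_nonneg le(1)] LIMSEQ_zero_le[OF lim nrm_nonneg le(2)]
    by (auto intro: L2_fst L2_snd L)
qed

lemma ip_self_zero_AE: "L2 S f \<Longrightarrow> ip S f f = 0 \<Longrightarrow> AE x in lebesgue_on S. f x = 0"
  by (rule nrm_zero_AE) (simp_all add: nrm_def)

section \<open>Integration by parts on the space-time cylinder\<close>

locale space_time_cylinder =
  fixes T :: real and \<Omega> :: "(real^'d) set"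
  assumes T_pos: "0 < T" and open_Omega: "open \<Omega>" and bounded_Omega: "bounded \<Omega>"
begin

abbreviation "Q \<equiv> cyl T \<Omega>"

lemma open_Q: "open Q" and bounded_Q: "bounded Q"
  using open_Omega bounded_Omega by (auto simp: cyl_def open_Times bounded_Times)

lemma lmeasurable_Q: "Q \<in> lmeasurable" and lmeasurable_Omega: "\<Omega> \<in> lmeasurable"
  using open_Q bounded_Q open_Omega bounded_Omega by (auto intro: lmeasurable_open)

lemmas L2_Q_test = L2_test_fun[OF lmeasurable_Q]
lemmas L2_Omega_test = L2_test_fun[OF lmeasurable_Omega]

lemma test_fun_Times: "test_fun (A \<times> \<Omega>) \<phi> \<Longrightarrow> test_fun (UNIV \<times> \<Omega>) \<phi>"
  by (erule test_fun_mono) auto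

lemma L2_gradx: "test_fun U \<phi> \<Longrightarrow> L2 Q (gradx \<phi>)"
  by (rule L2_vec) (simp add: gradx_nth L2_Q_test[OF test_fun_pderiv])

lemma L2_dt: "test_fun U \<phi> \<Longrightarrow> L2 Q (dt \<phi>)"
  by (simp add: dt_eq L2_Q_test[OF test_fun_pderiv])

lemma L2_Omega_section: "test_fun (A \<times> \<Omega>) \<phi> \<Longrightarrow> L2 \<Omega> (\<lambda>x. \<phi> (t, x))"
  by (rule L2_Omega_test[OF test_fun_section])

text \<open>Fubini with time as the inner variable and the fundamental theorem of calculus on each
  line; in space the function vanishes outside \<open>\<Omega>\<close>, so the integrals may run
  over the whole space.\<close>

lemma intg_dt:
  assumes t: "test_fun (UNIV \<times> \<Omega>) \<psi>"
  shows "intg Q (dt \<psi>) = intg \<Omega> (\<lambda>x. \<psi> (T, x)) - intg \<Omega> (\<lambda>x. \<psi> (0, x))"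
proof -
  have td: "test_fun (UNIV \<times> \<Omega>) (dt \<psi>)" unfolding dt_eq by (rule test_fun_pderiv[OF t])
  note [measurable] = borel_measurable_test_fun[OF td]
  have Qs: "Q \<in> sets lebesgue" "\<Omega> \<in> sets lebesgue" using lmeasurable_Q lmeasurable_Omega by (auto simp: fmeasurableD)
  \<comment> \<open>The derivative of \<open>\<psi>\<close> need not vanish outside the time
    interval, so that interval is cut out explicitly.\<close>
  define f where "f p = indicator ({0<..<T} \<times> UNIV) p * dt \<psi> p" for p :: "real \<times> (real^'d)"
  have "{0<..<T} \<times> (UNIV :: (real^'d) set) \<in> sets borel" by (intro borel_open open_Times) auto
  then have f_borel [measurable]: "f \<in> borel_measurable borel" unfolding f_def by measurable
  have f_int: "integrable lborel f"
    by (rule Bochner_Integration.integrable_bound[OF integrable_test_fun[OF td]])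
       (auto simp: f_def indicator_def)
  have "intg Q (dt \<psi>) = intg Q f"
    by (rule intg_cong) (auto simp: f_def cyl_def)
  also have "\<dots> = (\<integral>p. f p \<partial>lborel)"
  proof (rule intg_eq_lborel[OF Qs(1)])
    show "f p = 0" if "p \<notin> Q" for p
      using that test_fun_outside[OF td, of p] by (cases p) (auto simp: f_def cyl_def indicator_def)
  qed measurable
  also have "\<dots> = (\<integral>p. (case p of (t, x) \<Rightarrow> f (t, x)) \<partial>(lborel \<Otimes>\<^sub>M lborel))"
    by (simp add: lborel_prod)
  also have "\<dots> = (\<integral>x. (\<integral>t. f (t, x) \<partial>lborel) \<partial>lborel)"
    by (rule lborel_pair.integral_snd[symmetric]) (use f_int in \<open>simp add: lborel_prod\<close>)
  also have "\<dots> = (\<integral>x. \<psi> (T, x) - \<psi> (0, x) \<partial>lborel)"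
  proof (rule Bochner_Integration.integral_cong[OF refl])
    fix x :: "real^'d"
    have c: "continuous_on UNIV (\<lambda>t. dt \<psi> (t, x))"
      by (rule continuous_on_compose2[OF test_fun_continuous[OF td, of UNIV]]) (auto intro!: continuous_intros)
    \<comment> \<open>The cylinder has an open time interval, the fundamental theorem a closed one;
      the endpoints form a null set.\<close>
    have "(\<integral>t. f (t, x) \<partial>lborel) = (\<integral>t. indicator {0..T} t *\<^sub>R dt \<psi> (t, x) \<partial>lborel)"
    proof (rule integral_cong_AE)
      have "AE t in lborel. t \<noteq> 0 \<and> t \<noteq> T" using AE_lborel_singleton[of 0] AE_lborel_singleton[of T] by auto
      then show "AE t in lborel. f (t, x) = indicator {0..T} t *\<^sub>R dt \<psi> (t, x)"
        by eventually_elim (auto simp: f_def indicator_def)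
      show "(\<lambda>t. f (t, x)) \<in> borel_measurable lborel"
        using borel_measurable_continuous_onI[OF c] by (simp add: f_def indicator_times)
    qed (use borel_measurable_continuous_onI[OF c] in simp)
    also have "\<dots> = \<psi> (T, x) - \<psi> (0, x)"
    proof (rule integral_FTC_atLeastAtMost)
      fix t :: real
      have "((\<lambda>t. \<psi> (t, x)) has_derivative (\<lambda>h. pderivs [(h, 0)] \<psi> (t, x))) (at t within {0..T})"
        by (rule has_derivative_eq_rhs, rule has_derivative_compose[OF _ smooth_fun_has_derivative[OF test_fun_smooth[OF t]], where f="\<lambda>t. (t, x)"])
           (auto intro!: derivative_eq_intros)
      moreover have "pderivs [(h, 0)] \<psi> (t, x) = h *\<^sub>R dt \<psi> (t, x)" for h
        using linear_scale[OF has_derivative_linear[OF smooth_fun_has_derivative[OF test_fun_smooth[OF t]]], of h "(1, 0)"] by (simp add: dt_eq)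
      ultimately show "((\<lambda>t. \<psi> (t, x)) has_vector_derivative dt \<psi> (t, x)) (at t within {0..T})"
        by (simp add: has_vector_derivative_def)
    qed (use T_pos c continuous_on_subset in auto)
    finally show "(\<integral>t. f (t, x) \<partial>lborel) = \<psi> (T, x) - \<psi> (0, x)" .
  qed
  also have "\<dots> = (\<integral>x. \<psi> (T, x) \<partial>lborel) - (\<integral>x. \<psi> (0, x) \<partial>lborel)"
    by (intro Bochner_Integration.integral_diff integrable_test_fun[OF test_fun_section[OF t]])
  also have "\<dots> = intg \<Omega> (\<lambda>x. \<psi> (T, x)) - intg \<Omega> (\<lambda>x. \<psi> (0, x))"
    using intg_eq_lborel[OF Qs(2) borel_measurable_test_fun[OF test_fun_section[OF t]] test_fun_outside[OF test_fun_section[OF t]]]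
    by simp
  finally show ?thesis .
qed

text \<open>The condition at \<open>T\<close> concerns the product because the factor that vanishes
  there varies with the use: a test function, a backward primitive, or a function carrying the
  weight T - t.\<close>

lemma dt_parts:
  assumes t: "test_fun (A \<times> \<Omega>) \<phi>" and a: "smooth_fun a"
    and fin: "\<And>x. \<phi> (T, x) * a (T, x) = 0"
  shows "ip Q \<phi> (dt a) + ip Q (dt \<phi>) a = - ip \<Omega> (\<lambda>x. \<phi> (0, x)) (\<lambda>x. a (0, x))"
proof -
  have t1: "test_fun (UNIV \<times> \<Omega>) (\<lambda>p. a p * \<phi> p)" by (rule test_fun_smooth_mult[OF a test_fun_Times[OF t]])
  have s: "smooth_fun \<phi>" using test_fun_smooth[OF t] .
  have "intg Q (dt (\<lambda>p. a p * \<phi> p)) = - intg \<Omega> (\<lambda>x. a (0, x) * \<phi> (0, x))"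
  proof -
    have "(\<lambda>x. a (T, x) * \<phi> (T, x)) = (\<lambda>x. 0)" using fin by (simp only: mult.commute)
    then show ?thesis unfolding intg_dt[OF t1] by simp
  qed
  moreover have "intg Q (dt (\<lambda>p. a p * \<phi> p)) = intg Q (\<lambda>p. \<phi> p * dt a p + dt \<phi> p * a p)"
    by (rule intg_cong) (simp add: dt_mult[OF a s])
  moreover have "intg Q (\<lambda>p. \<phi> p * dt a p + dt \<phi> p * a p) = intg Q (\<lambda>p. \<phi> p * dt a p) + intg Q (\<lambda>p. dt \<phi> p * a p)"
  proof (rule Bochner_Integration.integral_add)
    have "test_fun (A \<times> \<Omega>) (\<lambda>p. dt a p * \<phi> p)" unfolding dt_eq by (intro test_fun_smooth_mult smooth_fun_pderiv a t)
    from L2_integrable_mult[OF L2_Q_test[OF this] L2_bounded[OF lmeasurable_Q, of "\<lambda>_. 1" 1]]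
    show "integrable (lebesgue_on Q) (\<lambda>p. \<phi> p * dt a p)" by (simp add: mult.commute)
    have "test_fun (A \<times> \<Omega>) (\<lambda>p. a p * dt \<phi> p)" unfolding dt_eq by (intro test_fun_smooth_mult test_fun_pderiv a t)
    from L2_integrable_mult[OF L2_Q_test[OF this] L2_bounded[OF lmeasurable_Q, of "\<lambda>_. 1" 1]]
    show "integrable (lebesgue_on Q) (\<lambda>p. dt \<phi> p * a p)" by (simp add: mult.commute)
  qed
  ultimately show ?thesis by (simp add: ip_def mult.commute)
qed

section \<open>Primitives in time\<close>

text \<open>For \<open>s\<close> supported in \<open>Q\<close> and 0 < t < T, the backward and
  forward averages are the integrals of \<open>s\<close> over (t, T) and over (0, t). The first
  vanishes near \<open>T\<close>, the second near 0, which decides what each may be paired with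
  without boundary terms.\<close>

abbreviation bavg :: "(real \<times> (real^'d) \<Rightarrow> real) \<Rightarrow> real \<times> (real^'d) \<Rightarrow> real" where "bavg \<equiv> tavg T (1, 0)"
abbreviation favg :: "(real \<times> (real^'d) \<Rightarrow> real) \<Rightarrow> real \<times> (real^'d) \<Rightarrow> real" where "favg \<equiv> tavg T (-1, 0)"

lemma test_fun_bavg: "test_fun Q s \<Longrightarrow> test_fun ({..<T} \<times> \<Omega>) (bavg s)"
  by (erule test_fun_tavg) (auto simp: cyl_def)

lemma test_fun_favg: "test_fun Q s \<Longrightarrow> test_fun ({0<..} \<times> \<Omega>) (favg s)"
  by (erule test_fun_tavg) (auto simp: cyl_def)

lemma dt_bavg:
  assumes "test_fun Q s" "p \<in> Q" shows "dt (bavg s) p = - s p"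
proof -
  have "p + T *\<^sub>R (1, 0) \<notin> Q" using assms(2) by (cases p) (auto simp: cyl_def)
  then show ?thesis using test_fun_outside[OF assms(1)] T_pos
    by (simp add: dt_eq pderiv_tavg_same[OF test_fun_smooth[OF assms(1)]])
qed

lemma dt_favg:
  assumes "test_fun Q s" "p \<in> Q" shows "dt (favg s) p = s p"
proof -
  have sm: "smooth_fun (favg s)" using smooth_fun_tavg[OF test_fun_smooth[OF assms(1)]] .
  have "p + T *\<^sub>R (-1, 0) \<notin> Q" using assms(2) by (cases p) (auto simp: cyl_def)
  then have "pderivs [(-1, 0)] (favg s) p = - s p" using test_fun_outside[OF assms(1)] T_pos
    by (simp add: pderiv_tavg_same[OF test_fun_smooth[OF assms(1)]])
  moreover have "pderivs [(-1, 0)] (favg s) p = - pderivs [(1, 0)] (favg s) p"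
    using linear_neg[OF has_derivative_linear[OF smooth_fun_has_derivative[OF sm, of p]], of "(1, 0)"] by simp
  ultimately show ?thesis by (simp add: dt_eq)
qed

lemma pderiv_bavg: "test_fun Q s \<Longrightarrow> pderivs [v] (bavg s) = bavg (pderivs [v] s)"
  by (rule pderiv_tavg[OF test_fun_smooth])

lemma pderiv_favg: "test_fun Q s \<Longrightarrow> pderivs [v] (favg s) = favg (pderivs [v] s)"
  by (rule pderiv_tavg[OF test_fun_smooth])

text \<open>\<open>is_bprim b \<tau> \<tau>0\<close> says that \<open>\<tau>(t) = \<integral>\<^sub>t\<^sup>T b\<close> with \<open>\<tau>0 = \<tau>(0)\<close>, and \<open>is_fprim a A\<close> that \<open>A(t) = \<integral>\<^sub>0\<^sup>t a\<close>,
  both in duality with test functions.\<close>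

definition is_bprim :: "(real \<times> (real^'d) \<Rightarrow> real) \<Rightarrow> (real \<times> (real^'d) \<Rightarrow> real) \<Rightarrow> (real^'d \<Rightarrow> real) \<Rightarrow> bool" where
  "is_bprim b \<tau> \<tau>0 \<longleftrightarrow> L2 Q b \<and> L2 Q \<tau> \<and> L2 \<Omega> \<tau>0 \<and>
     (\<forall>a. test_fun ({..<T} \<times> \<Omega>) a \<longrightarrow> ip Q b a - ip Q \<tau> (dt a) = ip \<Omega> \<tau>0 (\<lambda>x. a (0, x))) \<and>
     (\<forall>s. test_fun Q s \<longrightarrow> ip Q \<tau> s = ip Q b (favg s))"

definition is_fprim :: "(real \<times> (real^'d) \<Rightarrow> real) \<Rightarrow> (real \<times> (real^'d) \<Rightarrow> real) \<Rightarrow> bool" where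
  "is_fprim a A \<longleftrightarrow> L2 Q a \<and> L2 Q A \<and> (\<forall>\<psi>. test_fun ({..<T} \<times> \<Omega>) \<psi> \<longrightarrow> ip Q A (dt \<psi>) = - ip Q a \<psi>)"

lemma is_bprimD:
  assumes "is_bprim b \<tau> \<tau>0"
  shows "L2 Q b" "L2 Q \<tau>" "L2 \<Omega> \<tau>0"
    and "test_fun ({..<T} \<times> \<Omega>) a \<Longrightarrow> ip Q b a - ip Q \<tau> (dt a) = ip \<Omega> \<tau>0 (\<lambda>x. a (0, x))"
    and "test_fun Q s \<Longrightarrow> ip Q \<tau> s = ip Q b (favg s)"
  using assms by (auto simp: is_bprim_def)

lemma is_fprimD:
  assumes "is_fprim a A"
  shows "L2 Q a" "L2 Q A" "test_fun ({..<T} \<times> \<Omega>) \<psi> \<Longrightarrow> ip Q A (dt \<psi>) = - ip Q a \<psi>"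
  using assms by (auto simp: is_fprim_def)

lemma is_bprim_cong:
  assumes "is_bprim b \<tau> \<tau>0" "\<And>p. p \<in> Q \<Longrightarrow> b p = b' p"
  shows "is_bprim b' \<tau> \<tau>0"
proof -
  have "ip Q b a = ip Q b' a" for a :: "real \<times> (real^'d) \<Rightarrow> real" by (rule ip_cong) (use assms(2) in auto)
  moreover have "L2 Q b = L2 Q b'" by (rule L2_cong) (use assms(2) in auto)
  ultimately show ?thesis using assms(1) by (simp add: is_bprim_def)
qed

lemma is_bprim_lin:
  assumes "is_bprim b \<tau> \<tau>0" "is_bprim b' \<tau>' \<tau>0'"
  shows "is_bprim (\<lambda>p. c * b p + d * b' p) (\<lambda>p. c * \<tau> p + d * \<tau>' p) (\<lambda>x. c * \<tau>0 x + d * \<tau>0' x)"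
proof -
  note L = is_bprimD(1-3)[OF assms(1)] is_bprimD(1-3)[OF assms(2)]
  have "c * ip Q b a + d * ip Q b' a - (c * ip Q \<tau> (dt a) + d * ip Q \<tau>' (dt a)) 
      = c * ip \<Omega> \<tau>0 (\<lambda>x. a (0, x)) + d * ip \<Omega> \<tau>0' (\<lambda>x. a (0, x))" if a: "test_fun ({..<T} \<times> \<Omega>) a" for a
  proof -
    have "c * ip Q b a + d * ip Q b' a - (c * ip Q \<tau> (dt a) + d * ip Q \<tau>' (dt a))
      = c * (ip Q b a - ip Q \<tau> (dt a)) + d * (ip Q b' a - ip Q \<tau>' (dt a))" by (simp add: algebra_simps)
    then show ?thesis by (simp only: is_bprimD(4)[OF assms(1) a] is_bprimD(4)[OF assms(2) a])
  qed
  then show ?thesis unfolding is_bprim_def using L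
    by (auto simp: ip_lin_left L2_lin L2_Q_test L2_dt L2_Omega_section is_bprimD(5)[OF assms(1)] is_bprimD(5)[OF assms(2)]
          L2_Q_test[OF test_fun_favg])
qed

lemma is_bprim_limit:
  assumes "\<And>n. is_bprim (b n) (\<tau> n) (\<tau>0 n)"
    and b: "L2conv Q b b'" and \<tau>: "L2conv Q \<tau> \<tau>'" and \<tau>0: "L2conv \<Omega> \<tau>0 \<tau>0'"
  shows "is_bprim b' \<tau>' \<tau>0'"
  unfolding is_bprim_def
proof (intro conjI allI impI)
  show "L2 Q b'" "L2 Q \<tau>'" "L2 \<Omega> \<tau>0'" using b \<tau> \<tau>0 by (auto simp: L2conv_def)
  fix a assume a: "test_fun ({..<T} \<times> \<Omega>) a"
  have "(\<lambda>n. ip Q (b n) a - ip Q (\<tau> n) (dt a)) \<longlonglongrightarrow> ip Q b' a - ip Q \<tau>' (dt a)"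
    by (intro tendsto_intros L2conv_ip b \<tau> L2conv_const L2_Q_test[OF a] L2_dt[OF a])
  moreover have "(\<lambda>n. ip \<Omega> (\<tau>0 n) (\<lambda>x. a (0, x))) \<longlonglongrightarrow> ip \<Omega> \<tau>0' (\<lambda>x. a (0, x))"
    by (intro L2conv_ip \<tau>0 L2conv_const L2_Omega_section[OF a])
  ultimately show "ip Q b' a - ip Q \<tau>' (dt a) = ip \<Omega> \<tau>0' (\<lambda>x. a (0, x))"
    using is_bprimD(4)[OF assms(1) a] LIMSEQ_unique by simp
next
  fix s assume s: "test_fun Q s"
  have "(\<lambda>n. ip Q (\<tau> n) s) \<longlonglongrightarrow> ip Q \<tau>' s" "(\<lambda>n. ip Q (b n) (favg s)) \<longlonglongrightarrow> ip Q b' (favg s)"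
    by (intro L2conv_ip b \<tau> L2conv_const L2_Q_test[OF s] L2_Q_test[OF test_fun_favg[OF s]])+
  then show "ip Q \<tau>' s = ip Q b' (favg s)" using is_bprimD(5)[OF assms(1) s] LIMSEQ_unique by simp
qed

lemma is_fprim_limit:
  assumes "\<And>n. is_fprim (a n) (A n)" and a: "L2conv Q a a'" and A: "L2conv Q A A'"
  shows "is_fprim a' A'"
  unfolding is_fprim_def
proof (intro conjI allI impI)
  show "L2 Q a'" "L2 Q A'" using a A by (auto simp: L2conv_def)
  fix \<psi> assume p: "test_fun ({..<T} \<times> \<Omega>) \<psi>"
  have "(\<lambda>n. ip Q (A n) (dt \<psi>)) \<longlonglongrightarrow> ip Q A' (dt \<psi>)" "(\<lambda>n. - ip Q (a n) \<psi>) \<longlonglongrightarrow> - ip Q a' \<psi>"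
    by (intro tendsto_minus L2conv_ip a A L2conv_const L2_Q_test[OF p] L2_dt[OF p])+
  then show "ip Q A' (dt \<psi>) = - ip Q a' \<psi>" using is_fprimD(3)[OF assms(1) p] LIMSEQ_unique by simp
qed

text \<open>Both clauses are one integration by parts: \<open>\<phi>\<close> removes the term at
  \<open>T\<close>, and in the second clause \<open>favg s\<close> removes the term at 0.\<close>

lemma is_bprim_test_fun:
  assumes p: "test_fun ({..<T} \<times> \<Omega>) \<phi>"
  shows "is_bprim (\<lambda>p. - dt \<phi> p) \<phi> (\<lambda>x. \<phi> (0, x))"
  unfolding is_bprim_def
proof (intro conjI allI impI)
  show "L2 Q (\<lambda>p. - dt \<phi> p)" "L2 Q \<phi>" "L2 \<Omega> (\<lambda>x. \<phi> (0, x))"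
    using p by (auto intro: L2_minus L2_dt L2_Q_test L2_Omega_section)
  have fin: "\<phi> (T, x) = 0" for x by (rule test_fun_outside[OF p]) simp
  show "ip Q (\<lambda>p. - dt \<phi> p) a - ip Q \<phi> (dt a) = ip \<Omega> (\<lambda>x. \<phi> (0, x)) (\<lambda>x. a (0, x))"
    if "test_fun ({..<T} \<times> \<Omega>) a" for a
    using dt_parts[OF p test_fun_smooth[OF that]] fin by (simp add: ip_minus_left)
  show "ip Q \<phi> s = ip Q (\<lambda>p. - dt \<phi> p) (favg s)" if s: "test_fun Q s" for s
  proof -
    have "favg s (0, x) = 0" for x by (rule test_fun_outside[OF test_fun_favg[OF s]]) simp
    moreover have "ip Q \<phi> (dt (favg s)) = ip Q \<phi> s" by (rule ip_cong) (auto simp: dt_favg[OF s])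
    ultimately show ?thesis
      using dt_parts[OF p test_fun_smooth[OF test_fun_favg[OF s]]] fin by (simp add: ip_minus_left)
  qed
qed

lemma is_bprim_bavg: "test_fun Q s \<Longrightarrow> is_bprim s (bavg s) (\<lambda>x. bavg s (0, x))"
  by (rule is_bprim_cong[OF is_bprim_test_fun[OF test_fun_bavg]]) (auto simp: dt_bavg)

lemma is_fprim_favg:
  assumes s: "test_fun Q s" shows "is_fprim s (favg s)"
  unfolding is_fprim_def
proof (intro conjI allI impI)
  show "L2 Q s" "L2 Q (favg s)" using s L2_Q_test[OF s] L2_Q_test[OF test_fun_favg[OF s]] by auto
  fix \<psi> assume p: "test_fun ({..<T} \<times> \<Omega>) \<psi>"
  have "favg s (0, x) = 0" for x by (rule test_fun_outside[OF test_fun_favg[OF s]]) simp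
  moreover have "\<psi> (T, x) = 0" for x by (rule test_fun_outside[OF p]) simp
  moreover have "ip Q (dt (favg s)) \<psi> = ip Q s \<psi>" by (rule ip_cong) (auto simp: dt_favg[OF s])
  ultimately show "ip Q (favg s) (dt \<psi>) = - ip Q s \<psi>"
    using dt_parts[OF test_fun_favg[OF s] test_fun_smooth[OF p]] by simp
qed

lemma time_weight:
  shows "(\<lambda>p. fst p) \<in> borel_measurable (lebesgue_on Q)" "(\<lambda>p. T - fst p) \<in> borel_measurable (lebesgue_on Q)"
    and "p \<in> Q \<Longrightarrow> \<bar>fst p\<bar> \<le> T" "p \<in> Q \<Longrightarrow> \<bar>T - fst p\<bar> \<le> T"
  by (auto simp: cyl_def intro!: continuous_measurable_lebesgue_on continuous_intros)

lemma
  assumes "L2 Q (f :: _ \<Rightarrow> real)"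
  shows L2_time: "L2 Q (\<lambda>p. fst p * f p)" and L2_time': "L2 Q (\<lambda>p. (T - fst p) * f p)"
    and nrm_time: "nrm Q (\<lambda>p. fst p * f p) \<le> T * nrm Q f" and nrm_time': "nrm Q (\<lambda>p. (T - fst p) * f p) \<le> T * nrm Q f"
  using L2_bounded_mult[OF assms time_weight(1,3)] L2_bounded_mult[OF assms time_weight(2,4)]
    nrm_bounded_mult[OF assms time_weight(1,3)] nrm_bounded_mult[OF assms time_weight(2,4)] T_pos by auto

text \<open>Integrating the time derivative of \<open>\<phi>\<^sup>2\<close> leaves the value at 0.
  With the weight t in front this value disappears too, and the squared norm over \<open>Q\<close>
  remains. Cauchy-Schwarz with a weight bounded by \<open>T\<close> gives the constant 2 * T;
  inserted into the first identity it gives sqrt (4 * T) for the trace.\<close>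

lemma bprim_test_fun_bounds:
  assumes p: "test_fun ({..<T} \<times> \<Omega>) \<phi>"
  shows "ip Q \<phi> (dt \<phi>) = - (1/2) * ip \<Omega> (\<lambda>x. \<phi> (0, x)) (\<lambda>x. \<phi> (0, x))"
    and "ip Q (\<lambda>p. fst p * \<phi> p) (dt \<phi>) = - (1/2) * ip Q \<phi> \<phi>"
    and "nrm Q \<phi> \<le> 2 * T * nrm Q (dt \<phi>)"
    and "nrm \<Omega> (\<lambda>x. \<phi> (0, x)) \<le> 2 * sqrt T * nrm Q (dt \<phi>)"
proof -
  have L: "L2 Q \<phi>" "L2 Q (dt \<phi>)" using L2_Q_test[OF p] L2_dt[OF p] .
  have fin: "\<phi> (T, x) = 0" for x by (rule test_fun_outside[OF p]) simp
  show 1: "ip Q \<phi> (dt \<phi>) = - (1/2) * ip \<Omega> (\<lambda>x. \<phi> (0, x)) (\<lambda>x. \<phi> (0, x))"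
    using dt_parts[OF p test_fun_smooth[OF p]] fin by (simp add: ip_commute[of Q "dt \<phi>"])
  have "ip Q \<phi> (dt (\<lambda>p. fst p * \<phi> p)) + ip Q (dt \<phi>) (\<lambda>p. fst p * \<phi> p) = 0"
    using dt_parts[OF p smooth_fun_mult[OF smooth_fun_time test_fun_smooth[OF p]]] fin by simp
  moreover have "dt (\<lambda>p. fst p * \<phi> p) = (\<lambda>p. fst p * dt \<phi> p + \<phi> p)"
    by (rule ext) (simp add: dt_mult[OF smooth_fun_time test_fun_smooth[OF p]] dt_time)
  moreover have "ip Q \<phi> (\<lambda>p. fst p * dt \<phi> p + \<phi> p) = ip Q \<phi> (\<lambda>p. fst p * dt \<phi> p) + ip Q \<phi> \<phi>"
    using L by (intro ip_add_right L2_time)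
  moreover have "ip Q \<phi> (\<lambda>p. fst p * dt \<phi> p) = ip Q (\<lambda>p. fst p * \<phi> p) (dt \<phi>)"
    by (simp add: ip_def mult_ac)
  ultimately show 2: "ip Q (\<lambda>p. fst p * \<phi> p) (dt \<phi>) = - (1/2) * ip Q \<phi> \<phi>"
    by (simp add: ip_commute[of Q "dt \<phi>"])
  have "(nrm Q \<phi>)\<^sup>2 \<le> 2 * (nrm Q (\<lambda>p. fst p * \<phi> p) * nrm Q (dt \<phi>))"
    using ip_Cauchy_Schwarz[OF L2_time[OF L(1)] L(2)] 2 by (simp add: nrm_sq)
  also have "\<dots> \<le> 2 * ((T * nrm Q \<phi>) * nrm Q (dt \<phi>))"
    by (intro mult_left_mono mult_right_mono nrm_time L) auto
  also have "\<dots> = (2 * T * nrm Q (dt \<phi>)) * nrm Q \<phi>" by (simp only: mult_ac)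
  finally show 3: "nrm Q \<phi> \<le> 2 * T * nrm Q (dt \<phi>)"
    by (rule square_le_mult_imp_le) (use T_pos in auto)
  show "nrm \<Omega> (\<lambda>x. \<phi> (0, x)) \<le> 2 * sqrt T * nrm Q (dt \<phi>)"
  proof (rule power2_le_imp_le)
    have "(nrm \<Omega> (\<lambda>x. \<phi> (0, x)))\<^sup>2 \<le> 2 * (nrm Q \<phi> * nrm Q (dt \<phi>))"
      using ip_Cauchy_Schwarz[OF L] 1 by (simp add: nrm_sq)
    also have "\<dots> \<le> 2 * ((2 * T * nrm Q (dt \<phi>)) * nrm Q (dt \<phi>))"
      by (intro mult_left_mono mult_right_mono 3) auto
    also have "\<dots> = (2 * sqrt T * nrm Q (dt \<phi>))\<^sup>2"
      using T_pos by (simp add: power_mult_distrib) (simp add: power2_eq_square)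
    finally show "(nrm \<Omega> (\<lambda>x. \<phi> (0, x)))\<^sup>2 \<le> (2 * sqrt T * nrm Q (dt \<phi>))\<^sup>2" .
  qed (use T_pos in simp)
qed

text \<open>The mirror image for functions vanishing at time 0: the weight T - t removes the term at
  the final time.\<close>

lemma fprim_test_fun_bounds:
  assumes p: "test_fun ({0<..} \<times> \<Omega>) \<phi>"
  shows "ip Q (\<lambda>p. (T - fst p) * \<phi> p) (dt \<phi>) = (1/2) * ip Q \<phi> \<phi>"
    and "nrm Q \<phi> \<le> 2 * T * nrm Q (dt \<phi>)"
proof -
  have L: "L2 Q \<phi>" "L2 Q (dt \<phi>)" using L2_Q_test[OF p] L2_dt[OF p] .
  have ini: "\<phi> (0, x) = 0" for x by (rule test_fun_outside[OF p]) simp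
  have w: "smooth_fun (\<lambda>p. T - fst p :: real)" "dt (\<lambda>p. T - fst p) p = -1" for p
    using smooth_fun_affine[of "(-1 :: real, 0)" T] pderiv_affine[of "(1 :: real, 0)" "(-1, 0)" T p]
    by (simp_all add: inner_prod_def dt_eq)
  have "ip Q \<phi> (dt (\<lambda>p. (T - fst p) * \<phi> p)) + ip Q (dt \<phi>) (\<lambda>p. (T - fst p) * \<phi> p) = 0"
    using dt_parts[OF p smooth_fun_mult[OF w(1) test_fun_smooth[OF p]]] ini by simp
  moreover have "dt (\<lambda>p. (T - fst p) * \<phi> p) = (\<lambda>p. (T - fst p) * dt \<phi> p - \<phi> p)"
    by (rule ext) (simp add: dt_mult[OF w(1) test_fun_smooth[OF p]] w(2))
  moreover have "ip Q \<phi> (\<lambda>p. (T - fst p) * dt \<phi> p - \<phi> p) = ip Q \<phi> (\<lambda>p. (T - fst p) * dt \<phi> p) - ip Q \<phi> \<phi>"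
    using L by (intro ip_diff_right L2_time')
  moreover have "ip Q \<phi> (\<lambda>p. (T - fst p) * dt \<phi> p) = ip Q (\<lambda>p. (T - fst p) * \<phi> p) (dt \<phi>)"
    by (simp add: ip_def mult_ac)
  ultimately show 2: "ip Q (\<lambda>p. (T - fst p) * \<phi> p) (dt \<phi>) = (1/2) * ip Q \<phi> \<phi>"
    by (simp add: ip_commute[of Q "dt \<phi>"])
  have "(nrm Q \<phi>)\<^sup>2 \<le> 2 * (nrm Q (\<lambda>p. (T - fst p) * \<phi> p) * nrm Q (dt \<phi>))"
    using ip_Cauchy_Schwarz[OF L2_time'[OF L(1)] L(2)] 2 by (simp add: nrm_sq)
  also have "\<dots> \<le> 2 * ((T * nrm Q \<phi>) * nrm Q (dt \<phi>))"
    by (intro mult_left_mono mult_right_mono nrm_time' L) auto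
  also have "\<dots> = (2 * T * nrm Q (dt \<phi>)) * nrm Q \<phi>" by (simp only: mult_ac)
  finally show "nrm Q \<phi> \<le> 2 * T * nrm Q (dt \<phi>)"
    by (rule square_le_mult_imp_le) (use T_pos in auto)
qed

text \<open>The second clause of \<open>is_bprim\<close> determines \<open>\<tau>\<close> by pairing
  it with arbitrary test functions of \<open>Q\<close>. The first clause then determines
  \<open>\<tau>0\<close>, given product test functions with a nonzero factor at time 0.\<close>

lemma bprim_unique:
  assumes "is_bprim (\<lambda>p. 0) \<tau> \<tau>0"
  shows "AE p in lebesgue_on Q. \<tau> p = 0" "AE x in lebesgue_on \<Omega>. \<tau>0 x = 0"
proof -
  note L = is_bprimD(1-3)[OF assms]
  show 1: "AE p in lebesgue_on Q. \<tau> p = 0"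
    by (rule test_fun_orthogonal_AE[OF open_Q bounded_Q L(2)]) (simp add: is_bprimD(5)[OF assms])
  show "AE x in lebesgue_on \<Omega>. \<tau>0 x = 0"
  proof (rule test_fun_orthogonal_AE[OF open_Omega bounded_Omega L(3)])
    fix k assume k: "test_fun \<Omega> k"
    \<comment> \<open>The cutoff of (-T, T) with index \<open>n\<close> is positive at 0 exactly
      when \<open>Suc n * T > 1\<close>.\<close>
    obtain n :: nat where "1 / T < n" using reals_Archimedean2 by blast
    then have "1 < real n * T" using T_pos by (simp add: field_simps)
    then have n: "1 < real (Suc n) * T" using T_pos by (simp add: distrib_right)
    define h where "h = box_cutoff (-T) T n"
    have "h 0 = flat 0 (Suc n * T - 1) * flat 0 (Suc n * T - 1)" by (simp add: h_def box_cutoff_def)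
    then have h0: "h 0 \<noteq> 0" using n by (simp add: flat_def)
    have "test_fun (box (-T) T \<times> \<Omega>) (\<lambda>p. h (fst p) * k (snd p))"
      unfolding h_def by (rule test_fun_tensor[OF test_fun_box_cutoff k])
    then have a: "test_fun ({..<T} \<times> \<Omega>) (\<lambda>p. h (fst p) * k (snd p))"
      by (rule test_fun_mono) auto
    have "ip Q \<tau> (dt (\<lambda>p. h (fst p) * k (snd p))) = 0"
      using ip_AE_cong[OF L(2) L2_zero L2_dt[OF a] 1] by simp
    then have "ip \<Omega> \<tau>0 (\<lambda>x. h 0 * k x) = 0" using is_bprimD(4)[OF assms a] by simp
    then show "ip \<Omega> \<tau>0 k = 0" using ip_scaleR_right[of \<Omega> \<tau>0 "h 0" k] h0 by simp
  qed
qed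

lemma fprim_unique:
  assumes "is_fprim (\<lambda>p. 0) A" shows "AE p in lebesgue_on Q. A p = 0"
proof (rule test_fun_orthogonal_AE[OF open_Q bounded_Q is_fprimD(2)[OF assms]])
  fix s assume s: "test_fun Q s"
  have "ip Q A (dt (bavg s)) = ip Q A (\<lambda>p. - s p)" by (rule ip_cong) (auto simp: dt_bavg[OF s])
  then show "ip Q A s = 0" using is_fprimD(3)[OF assms test_fun_bavg[OF s]] by (simp add: ip_minus_right)
qed

text \<open>The bounds with 2 * T and 2 * sqrt T, applied to differences, make the averages and
  their traces Cauchy. The sequence is exported because identities for primitives are proved on it
  and passed to the limit.\<close>

lemma bprim_exists_approx:
  assumes b: "L2 Q b"
  obtains s \<tau> \<tau>0 where "\<And>n. test_fun Q (s n)" "L2conv Q s b" "L2conv Q (\<lambda>n. bavg (s n)) \<tau>"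
    "L2conv \<Omega> (\<lambda>n x. bavg (s n) (0, x)) \<tau>0" "is_bprim b \<tau> \<tau>0"
proof -
  obtain s where s: "\<And>n. test_fun Q (s n)" "L2conv Q s b"
    using test_fun_dense[OF open_Q bounded_Q b] by blast
  note t = test_fun_bavg[OF s(1)]
  have d: "test_fun ({..<T} \<times> \<Omega>) (\<lambda>p. bavg (s m) p - bavg (s n) p)" for m n by (rule test_fun_diff[OF t t])
  have "nrm Q (dt (\<lambda>p. bavg (s m) p - bavg (s n) p)) = nrm Q (\<lambda>p. - (s m p - s n p))" for m n
    by (rule nrm_cong) (simp add: dt_eq pderiv_diff[OF test_fun_smooth[OF t] test_fun_smooth[OF t]] dt_bavg[OF s(1), unfolded dt_eq])
  then have e: "nrm Q (dt (\<lambda>p. bavg (s m) p - bavg (s n) p)) = nrm Q (\<lambda>p. s m p - s n p)" for m n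
    by (simp only: nrm_minus)
  obtain \<tau> where \<tau>: "L2conv Q (\<lambda>n. bavg (s n)) \<tau>"
    by (rule L2conv_of_Cauchy_bound[OF s(2), of Q "\<lambda>n. bavg (s n)" "2 * T"])
      (use bprim_test_fun_bounds(3)[OF d] L2_Q_test[OF t] e in auto)
  obtain \<tau>0 where \<tau>0: "L2conv \<Omega> (\<lambda>n x. bavg (s n) (0, x)) \<tau>0"
    by (rule L2conv_of_Cauchy_bound[OF s(2), of \<Omega> "\<lambda>n x. bavg (s n) (0, x)" "2 * sqrt T"])
      (use bprim_test_fun_bounds(4)[OF d] L2_Omega_section[OF t] e in auto)
  show thesis using that[OF s \<tau> \<tau>0 is_bprim_limit[OF is_bprim_bavg[OF s(1)] s(2) \<tau> \<tau>0]] .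
qed

text \<open>By uniqueness, an arbitrary primitive inherits the approximation constructed for one
  particular primitive of \<open>b\<close>.\<close>

lemma bprim_approx:
  assumes "is_bprim b \<tau> \<tau>0"
  obtains s where "\<And>n. test_fun Q (s n)" "L2conv Q s b" "L2conv Q (\<lambda>n. bavg (s n)) \<tau>"
    "L2conv \<Omega> (\<lambda>n x. bavg (s n) (0, x)) \<tau>0"
proof -
  note L = is_bprimD(1-3)[OF assms]
  obtain s \<tau>' \<tau>0' where s: "\<And>n. test_fun Q (s n)" "L2conv Q s b" and \<tau>: "L2conv Q (\<lambda>n. bavg (s n)) \<tau>'"
    and \<tau>0: "L2conv \<Omega> (\<lambda>n x. bavg (s n) (0, x)) \<tau>0'" and b: "is_bprim b \<tau>' \<tau>0'"
    using bprim_exists_approx[OF L(1)] by metis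
  have "is_bprim (\<lambda>p. 0) (\<lambda>p. \<tau>' p - \<tau> p) (\<lambda>x. \<tau>0' x - \<tau>0 x)"
    using is_bprim_lin[OF b assms, of 1 "-1"] by simp
  from bprim_unique[OF this] have "AE p in lebesgue_on Q. \<tau>' p = \<tau> p" "AE x in lebesgue_on \<Omega>. \<tau>0' x = \<tau>0 x" by auto
  then show thesis using that[OF s] L2conv_AE_cong[OF \<tau> _ L(2)] L2conv_AE_cong[OF \<tau>0 _ L(3)] by blast
qed

text \<open>Limits of the identities for averages of test functions. The signs are opposite to those
  in \<open>bprim_test_fun_bounds\<close> because \<open>bavg (s n)\<close> has time derivative
  \<open>- s n\<close> in \<open>Q\<close>.\<close>

lemma bprim_energy:
  assumes "is_bprim b \<tau> \<tau>0"
  shows "ip Q \<tau> b = (1/2) * ip \<Omega> \<tau>0 \<tau>0" "ip Q (\<lambda>p. fst p * \<tau> p) b = (1/2) * ip Q \<tau> \<tau>"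
    and bprim_nrm: "nrm Q \<tau> \<le> 2 * T * nrm Q b"
proof -
  obtain s where s: "\<And>n. test_fun Q (s n)" "L2conv Q s b" and \<tau>: "L2conv Q (\<lambda>n. bavg (s n)) \<tau>"
    and \<tau>0: "L2conv \<Omega> (\<lambda>n x. bavg (s n) (0, x)) \<tau>0"
    using bprim_approx[OF assms] by metis
  note t = bprim_test_fun_bounds[OF test_fun_bavg[OF s(1)]]
  have m: "ip Q f (dt (bavg (s n))) = - ip Q f (s n)" for n and f :: "real \<times> (real^'d) \<Rightarrow> real"
  proof -
    have "ip Q f (dt (bavg (s n))) = ip Q f (\<lambda>p. - s n p)" by (rule ip_cong) (auto simp: dt_bavg[OF s(1)])
    then show ?thesis by (simp add: ip_minus_right)
  qed
  have nm: "nrm Q (dt (bavg (s n))) = nrm Q (s n)" for n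
    using m[of "dt (bavg (s n))" n] m[of "s n" n] by (simp add: nrm_def ip_commute)
  have "(\<lambda>n. ip Q (bavg (s n)) (s n)) \<longlonglongrightarrow> ip Q \<tau> b"
    "(\<lambda>n. (1/2) * ip \<Omega> (\<lambda>x. bavg (s n) (0, x)) (\<lambda>x. bavg (s n) (0, x))) \<longlonglongrightarrow> (1/2) * ip \<Omega> \<tau>0 \<tau>0"
    by (intro tendsto_intros L2conv_ip s \<tau> \<tau>0)+
  moreover have "ip Q (bavg (s n)) (s n) = (1/2) * ip \<Omega> (\<lambda>x. bavg (s n) (0, x)) (\<lambda>x. bavg (s n) (0, x))" for n
    using t(1)[of n] unfolding m by simp
  ultimately show "ip Q \<tau> b = (1/2) * ip \<Omega> \<tau>0 \<tau>0" by (rule LIMSEQ_eq_unique)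
  have "(\<lambda>n. ip Q (\<lambda>p. fst p * bavg (s n) p) (s n)) \<longlonglongrightarrow> ip Q (\<lambda>p. fst p * \<tau> p) b"
    by (rule L2conv_ip[OF L2conv_bounded_mult[OF \<tau> time_weight(1,3), unfolded real_scaleR_def] s(2)])
  moreover have "(\<lambda>n. (1/2) * ip Q (bavg (s n)) (bavg (s n))) \<longlonglongrightarrow> (1/2) * ip Q \<tau> \<tau>"
    by (rule tendsto_mult_left[OF L2conv_ip[OF \<tau> \<tau>]])
  moreover have "ip Q (\<lambda>p. fst p * bavg (s n) p) (s n) = (1/2) * ip Q (bavg (s n)) (bavg (s n))" for n
    using t(2)[of n] unfolding m by simp
  ultimately show "ip Q (\<lambda>p. fst p * \<tau> p) b = (1/2) * ip Q \<tau> \<tau>" by (rule LIMSEQ_eq_unique)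
  show "nrm Q \<tau> \<le> 2 * T * nrm Q b"
    by (rule LIMSEQ_le[OF L2conv_nrm[OF \<tau>] tendsto_mult_left[OF L2conv_nrm[OF s(2)]]])
       (use t(3) nm in auto)
qed

text \<open>The definition tests only with functions vanishing near \<open>T\<close>. Since the
  approximating averages vanish at \<open>T\<close> themselves, no end term arises in general; this
  is how the conditions \<open>zero_at_T\<close> are obtained later.\<close>

lemma bprim_test_all:
  assumes "is_bprim b \<tau> \<tau>0" and a: "test_fun (A \<times> \<Omega>) a"
  shows "ip Q b a - ip Q \<tau> (dt a) = ip \<Omega> \<tau>0 (\<lambda>x. a (0, x))"
proof -
  obtain s where s: "\<And>n. test_fun Q (s n)" "L2conv Q s b" and \<tau>: "L2conv Q (\<lambda>n. bavg (s n)) \<tau>"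
    and \<tau>0: "L2conv \<Omega> (\<lambda>n x. bavg (s n) (0, x)) \<tau>0"
    using bprim_approx[OF assms(1)] by metis
  have "(\<lambda>n. ip Q (s n) a - ip Q (bavg (s n)) (dt a)) \<longlonglongrightarrow> ip Q b a - ip Q \<tau> (dt a)"
    "(\<lambda>n. ip \<Omega> (\<lambda>x. bavg (s n) (0, x)) (\<lambda>x. a (0, x))) \<longlonglongrightarrow> ip \<Omega> \<tau>0 (\<lambda>x. a (0, x))"
    by (intro tendsto_intros L2conv_ip s \<tau> \<tau>0 L2conv_const L2_Q_test[OF a] L2_dt[OF a] L2_Omega_section[OF a])+
  moreover have "ip Q (s n) a - ip Q (bavg (s n)) (dt a) = ip \<Omega> (\<lambda>x. bavg (s n) (0, x)) (\<lambda>x. a (0, x))" for n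
  proof -
    have "bavg (s n) (T, x) = 0" for x by (rule test_fun_outside[OF test_fun_bavg[OF s(1)]]) simp
    moreover have "ip Q (dt (bavg (s n))) a = ip Q (\<lambda>p. - s n p) a" by (rule ip_cong) (auto simp: dt_bavg[OF s(1)])
    ultimately show ?thesis
      using dt_parts[OF test_fun_bavg[OF s(1)] test_fun_smooth[OF a], of n] by (simp add: ip_minus_left)
  qed
  ultimately show ?thesis by (rule LIMSEQ_eq_unique)
qed

lemma bprim_exists:
  assumes "L2 Q b" obtains \<tau> \<tau>0 where "is_bprim b \<tau> \<tau>0"
  using bprim_exists_approx[OF assms] by metis

lemma fprim_exists_approx:
  assumes a: "L2 Q a"
  obtains s A where "\<And>n. test_fun Q (s n)" "L2conv Q s a" "L2conv Q (\<lambda>n. favg (s n)) A" "is_fprim a A"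
proof -
  obtain s where s: "\<And>n. test_fun Q (s n)" "L2conv Q s a"
    using test_fun_dense[OF open_Q bounded_Q a] by blast
  note t = test_fun_favg[OF s(1)]
  have d: "test_fun ({0<..} \<times> \<Omega>) (\<lambda>p. favg (s m) p - favg (s n) p)" for m n by (rule test_fun_diff[OF t t])
  have e: "nrm Q (dt (\<lambda>p. favg (s m) p - favg (s n) p)) = nrm Q (\<lambda>p. s m p - s n p)" for m n
    by (rule nrm_cong) (simp add: dt_eq pderiv_diff[OF test_fun_smooth[OF t] test_fun_smooth[OF t]] dt_favg[OF s(1), unfolded dt_eq])
  obtain A where A: "L2conv Q (\<lambda>n. favg (s n)) A"
    by (rule L2conv_of_Cauchy_bound[OF s(2), of Q "\<lambda>n. favg (s n)" "2 * T"])
      (use fprim_test_fun_bounds(2)[OF d] L2_Q_test[OF t] e in auto)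
  show thesis using that[OF s A is_fprim_limit[OF is_fprim_favg[OF s(1)] s(2) A]] .
qed

lemma fprim_exists:
  assumes "L2 Q a" obtains A where "is_fprim a A"
  using fprim_exists_approx[OF assms] by metis

lemma is_fprim_diff:
  assumes "is_fprim a A" "is_fprim a' A'"
  shows "is_fprim (\<lambda>p. a p - a' p) (\<lambda>p. A p - A' p)"
  using is_fprimD[OF assms(1)] is_fprimD[OF assms(2)] unfolding is_fprim_def
  by (auto simp: L2_diff ip_diff_left L2_dt L2_Q_test)

lemma fprim_energy:
  assumes "is_fprim a A" shows "ip Q (\<lambda>p. (T - fst p) * A p) a = (1/2) * ip Q A A"
proof -
  note L = is_fprimD(1,2)[OF assms]
  obtain s A' where s: "\<And>n. test_fun Q (s n)" "L2conv Q s a" and A': "L2conv Q (\<lambda>n. favg (s n)) A'" "is_fprim a A'"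
    using fprim_exists_approx[OF L(1)] by metis
  have "is_fprim (\<lambda>p. 0) (\<lambda>p. A' p - A p)" using is_fprim_diff[OF A'(2) assms] by simp
  from fprim_unique[OF this] have "AE p in lebesgue_on Q. A' p = A p" by simp
  then have A: "L2conv Q (\<lambda>n. favg (s n)) A" using L2conv_AE_cong[OF A'(1) _ L(2)] by simp
  have "(\<lambda>n. ip Q (\<lambda>p. (T - fst p) * favg (s n) p) (s n)) \<longlonglongrightarrow> ip Q (\<lambda>p. (T - fst p) * A p) a"
    by (rule L2conv_ip[OF L2conv_bounded_mult[OF A time_weight(2,4), unfolded real_scaleR_def] s(2)])
  moreover have "(\<lambda>n. (1/2) * ip Q (favg (s n)) (favg (s n))) \<longlonglongrightarrow> (1/2) * ip Q A A"
    by (rule tendsto_mult_left[OF L2conv_ip[OF A A]])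
  moreover have "ip Q (\<lambda>p. (T - fst p) * favg (s n) p) (s n) = (1/2) * ip Q (favg (s n)) (favg (s n))" for n
  proof -
    have "ip Q (\<lambda>p. (T - fst p) * favg (s n) p) (dt (favg (s n))) = ip Q (\<lambda>p. (T - fst p) * favg (s n) p) (s n)"
      by (rule ip_cong) (auto simp: dt_favg[OF s(1)])
    then show ?thesis using fprim_test_fun_bounds(1)[OF test_fun_favg[OF s(1)], of n] by simp
  qed
  ultimately show ?thesis by (rule LIMSEQ_eq_unique)
qed

text \<open>Both sides integrate a(r) b(t) over the triangle r < t: integration forwards from 0 and
  backwards from \<open>T\<close> are adjoint. This moves primitives between a solution and its test
  function.\<close>

lemma fprim_bprim_dual:
  assumes "is_fprim a A" "is_bprim b B B0" shows "ip Q A b = ip Q a B"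
proof -
  note L = is_fprimD(1,2)[OF assms(1)]
  obtain s where s: "\<And>n. test_fun Q (s n)" "L2conv Q s b" and B: "L2conv Q (\<lambda>n. bavg (s n)) B"
    using bprim_approx[OF assms(2)] by metis
  have "(\<lambda>n. ip Q A (s n)) \<longlonglongrightarrow> ip Q A b" "(\<lambda>n. ip Q a (bavg (s n))) \<longlonglongrightarrow> ip Q a B"
    by (intro L2conv_ip s B L2conv_const L)+
  moreover have "ip Q A (s n) = ip Q a (bavg (s n))" for n
  proof -
    have "ip Q A (dt (bavg (s n))) = ip Q A (\<lambda>p. - s n p)" by (rule ip_cong) (auto simp: dt_bavg[OF s(1)])
    then show ?thesis using is_fprimD(3)[OF assms(1) test_fun_bavg[OF s(1)], of n] by (simp add: ip_minus_right)
  qed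
  ultimately show ?thesis by (rule LIMSEQ_eq_unique)
qed

section \<open>Weak spatial derivatives and the zero boundary condition\<close>

lemma zero_bc_intg:
  assumes "L2 Q u" "L2 Q U" "test_fun Q s"
  shows "intg Q (\<lambda>p. (s p - u p)\<^sup>2 + (norm (gradx s p - U p))\<^sup>2)
      = (nrm Q (\<lambda>p. s p - u p))\<^sup>2 + (nrm Q (\<lambda>p. gradx s p - U p))\<^sup>2"
proof -
  have "integrable (lebesgue_on Q) (\<lambda>p. (s p - u p)\<^sup>2)" "integrable (lebesgue_on Q) (\<lambda>p. (norm (gradx s p - U p))\<^sup>2)"
    using L2_sq[OF L2_diff[OF L2_Q_test[OF assms(3)] assms(1)]] L2_sq[OF L2_diff[OF L2_gradx[OF assms(3)] assms(2)]] by auto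
  then show ?thesis by (simp add: nrm_sq ip_self)
qed

lemma zero_bcI:
  assumes "L2 Q u" "L2 Q U"
    and "\<And>e. 0 < e \<Longrightarrow> \<exists>s. test_fun Q s \<and> nrm Q (\<lambda>p. s p - u p) < e \<and> nrm Q (\<lambda>p. gradx s p - U p) < e"
  shows "zero_bc Q u U"
proof -
  have "\<forall>n. \<exists>s. test_fun Q s \<and> nrm Q (\<lambda>p. s p - u p) < 1 / Suc n \<and> nrm Q (\<lambda>p. gradx s p - U p) < 1 / Suc n"
    by (intro allI assms(3)) simp
  from choice[OF this] obtain s where s: "\<And>n. test_fun Q (s n)" "\<And>n. nrm Q (\<lambda>p. s n p - u p) < 1 / Suc n"
    "\<And>n. nrm Q (\<lambda>p. gradx (s n) p - U p) < 1 / Suc n" by blast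
  have lim: "(\<lambda>n. 1 / real (Suc n)) \<longlonglongrightarrow> 0" using LIMSEQ_inverse_real_of_nat by (simp add: inverse_eq_divide)
  have "(\<lambda>n. nrm Q (\<lambda>p. s n p - u p)) \<longlonglongrightarrow> 0"
    by (rule LIMSEQ_zero_le[OF lim nrm_nonneg less_imp_le[OF s(2)]])
  moreover have "(\<lambda>n. nrm Q (\<lambda>p. gradx (s n) p - U p)) \<longlonglongrightarrow> 0"
    by (rule LIMSEQ_zero_le[OF lim nrm_nonneg less_imp_le[OF s(3)]])
  ultimately have "(\<lambda>n. (nrm Q (\<lambda>p. s n p - u p))\<^sup>2 + (nrm Q (\<lambda>p. gradx (s n) p - U p))\<^sup>2) \<longlonglongrightarrow> 0\<^sup>2 + 0\<^sup>2"
    by (intro tendsto_intros)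
  then show ?thesis unfolding zero_bc_def using s(1) by (intro exI[of _ s]) (simp add: zero_bc_intg assms)
qed

lemma zero_bcE:
  assumes L: "L2 Q u" "L2 Q U" and "zero_bc Q u U"
  obtains s where "\<And>n. test_fun Q (s n)" "L2conv Q s u" "L2conv Q (\<lambda>n. gradx (s n)) U"
proof -
  obtain s where s: "\<And>n. test_fun Q (s n)"
    "(\<lambda>n. intg Q (\<lambda>p. (s n p - u p)\<^sup>2 + (norm (gradx (s n) p - U p))\<^sup>2)) \<longlonglongrightarrow> 0"
    using assms(3) unfolding zero_bc_def by blast
  let ?a = "\<lambda>n. nrm Q (\<lambda>p. s n p - u p)" and ?b = "\<lambda>n. nrm Q (\<lambda>p. gradx (s n) p - U p)"
  have "(\<lambda>n. sqrt ((?a n)\<^sup>2 + (?b n)\<^sup>2)) \<longlonglongrightarrow> sqrt 0"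
    using s by (intro tendsto_real_sqrt) (simp add: zero_bc_intg L)
  then have lim: "(\<lambda>n. sqrt ((?a n)\<^sup>2 + (?b n)\<^sup>2)) \<longlonglongrightarrow> 0" by simp
  have "?a \<longlonglongrightarrow> 0" "?b \<longlonglongrightarrow> 0"
    by (rule LIMSEQ_zero_le[OF lim nrm_nonneg], simp add: real_le_rsqrt)+
  then show thesis using that[OF s(1)] L L2_Q_test[OF s(1)] L2_gradx[OF s(1)] by (simp add: L2conv_def)
qed

lemma zero_bcI_conv:
  assumes "\<And>n. test_fun Q (s n)" "L2conv Q s u" "L2conv Q (\<lambda>n. gradx (s n)) U"
  shows "zero_bc Q u U"
proof (rule zero_bcI)
  show "L2 Q u" "L2 Q U" using assms by (auto simp: L2conv_def)
  fix e :: real assume "0 < e"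
  then have "\<forall>\<^sub>F n in sequentially. nrm Q (\<lambda>p. s n p - u p) < e" "\<forall>\<^sub>F n in sequentially. nrm Q (\<lambda>p. gradx (s n) p - U p) < e"
    using L2conv_eventually assms(2,3) by blast+
  then have "\<forall>\<^sub>F n in sequentially. nrm Q (\<lambda>p. s n p - u p) < e \<and> nrm Q (\<lambda>p. gradx (s n) p - U p) < e"
    by eventually_elim simp
  then show "\<exists>s. test_fun Q s \<and> nrm Q (\<lambda>p. s p - u p) < e \<and> nrm Q (\<lambda>p. gradx s p - U p) < e"
    using assms(1) eventually_happens'[OF sequentially_bot] by blast
qed

lemma zero_bc_closure:
  assumes z: "\<And>n. zero_bc Q (w n) (W n)" and w: "L2conv Q w u" and W: "L2conv Q W U"
  shows "zero_bc Q u U"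
proof (rule zero_bcI)
  have L: "L2 Q u" "L2 Q U" "\<And>n. L2 Q (w n)" "\<And>n. L2 Q (W n)" using w W by (auto simp: L2conv_def)
  then show "L2 Q u" "L2 Q U" by auto
  fix e :: real assume e: "0 < e"
  have "\<forall>\<^sub>F n in sequentially. nrm Q (\<lambda>p. w n p - u p) < e / 2" "\<forall>\<^sub>F n in sequentially. nrm Q (\<lambda>p. W n p - U p) < e / 2"
    by (intro L2conv_eventually w W half_gt_zero e)+
  then have "\<forall>\<^sub>F n in sequentially. nrm Q (\<lambda>p. w n p - u p) < e / 2 \<and> nrm Q (\<lambda>p. W n p - U p) < e / 2"
    by eventually_elim simp
  then obtain n where n: "nrm Q (\<lambda>p. w n p - u p) < e / 2" "nrm Q (\<lambda>p. W n p - U p) < e / 2"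
    using eventually_happens'[OF sequentially_bot] by blast
  obtain s where s: "\<And>n. test_fun Q (s n)" "L2conv Q s (w n)" "L2conv Q (\<lambda>n. gradx (s n)) (W n)"
    using zero_bcE[OF L(3,4) z] by metis
  have "\<forall>\<^sub>F k in sequentially. nrm Q (\<lambda>p. s k p - w n p) < e / 2" "\<forall>\<^sub>F k in sequentially. nrm Q (\<lambda>p. gradx (s k) p - W n p) < e / 2"
    by (intro L2conv_eventually s half_gt_zero e)+
  then have "\<forall>\<^sub>F k in sequentially. nrm Q (\<lambda>p. s k p - w n p) < e / 2 \<and> nrm Q (\<lambda>p. gradx (s k) p - W n p) < e / 2"
    by eventually_elim simp
  then obtain k where k: "nrm Q (\<lambda>p. s k p - w n p) < e / 2" "nrm Q (\<lambda>p. gradx (s k) p - W n p) < e / 2"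
    using eventually_happens'[OF sequentially_bot] by blast
  have "nrm Q (\<lambda>p. s k p - u p) < e" "nrm Q (\<lambda>p. gradx (s k) p - U p) < e"
    using n k nrm_triangle_diff[OF L2_Q_test[OF s(1)] L(3) L(1), of k n] nrm_triangle_diff[OF L2_gradx[OF s(1)] L(4) L(2), of k n] by auto
  then show "\<exists>s. test_fun Q s \<and> nrm Q (\<lambda>p. s p - u p) < e \<and> nrm Q (\<lambda>p. gradx s p - U p) < e"
    using s(1) by blast
qed

text \<open>What counts for \<open>zero_bc\<close> is compact support in space: time cutoffs commute
  with the spatial gradient and converge in the square norm. This covers averages of test functions,
  each of which vanishes near one end of the time interval only.\<close>

lemma zero_bc_test_fun:
  assumes w: "test_fun (A \<times> \<Omega>) w" shows "zero_bc Q w (gradx w)"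
proof -
  define h where "h n = box_cutoff 0 T n" for n
  have sm: "smooth_fun (\<lambda>p. h n (fst p))" for n
    using smooth_fun_compose_affine[OF smooth_box_cutoff bounded_linear_fst, of 0 T n 0] by (simp add: h_def)
  obtain K where K: "smooth_fun w" "compact K" "K \<subseteq> A \<times> \<Omega>" "\<And>x. x \<notin> K \<Longrightarrow> w x = 0" using test_funE[OF w] by blast
  \<comment> \<open>\<open>K\<close> may extend beyond the time interval, so its projection to space
    is combined with the support of the cutoff in time.\<close>
  have t: "test_fun Q (\<lambda>p. h n (fst p) * w p)" for n
  proof -
    obtain I where I: "smooth_fun (h n)" "compact I" "I \<subseteq> box 0 T" "\<And>t. t \<notin> I \<Longrightarrow> h n t = 0"
      using test_funE[OF test_fun_box_cutoff[of 0 T n]] unfolding h_def by metis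
    show ?thesis
    proof (rule test_funI[of _ "I \<times> snd ` K"])
      show "smooth_fun (\<lambda>p. h n (fst p) * w p)" by (intro smooth_fun_mult sm K)
      show "compact (I \<times> snd ` K)" using K I by (intro compact_Times compact_continuous_image continuous_intros)
      show "I \<times> snd ` K \<subseteq> Q" using I(3) K(3) by (auto simp: cyl_def)
      show "h n (fst p) * w p = 0" if "p \<notin> I \<times> snd ` K" for p
        using that I(4)[of "fst p"] K(4)[of p] by (cases "p \<in> K") (auto simp: mem_Times_iff)
    qed
  qed
  have g: "gradx (\<lambda>p. h n (fst p) * w p) = (\<lambda>p. h n (fst p) *\<^sub>R gradx w p)" for n
    by (rule ext) (simp add: gradx_mult[OF sm K(1)] gradx_time_fun[OF smooth_box_cutoff[of 0 T n], folded h_def])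
  have m: "(\<lambda>p. h n (fst p)) \<in> borel_measurable (lebesgue_on Q)" for n
    by (rule continuous_measurable_lebesgue_on[OF smooth_fun_continuous[OF sm]])
  have lim: "(\<lambda>n. h n (fst p)) \<longlonglongrightarrow> 1" if "p \<in> Q" for p
    using box_cutoff_limit[of 0 T "fst p"] that by (auto simp: h_def cyl_def)
  have b: "0 \<le> h n (fst p) \<and> h n (fst p) \<le> 1" for n and p :: "real \<times> (real^'d)"
    using box_cutoff_bounds[of 0 T n] by (simp add: h_def)
  show ?thesis
  proof (rule zero_bcI_conv[OF t])
    show "L2conv Q (\<lambda>n p. h n (fst p) * w p) w"
      using L2conv_cutoff[OF L2_Q_test[OF w] m b lim] by simp
    show "L2conv Q (\<lambda>n. gradx (\<lambda>p. h n (fst p) * w p)) (gradx w)"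
      unfolding g by (rule L2conv_cutoff[OF L2_gradx[OF w] m b lim])
  qed
qed

text \<open>\<open>zero_bc\<close> is a closure in the norm of the pairs (s, \<nabla>s), so
  identities continuous in this norm extend from test functions. Green's formulas for
  \<open>wgrad\<close> and \<open>wdiv\<close> are instances.\<close>

lemma zero_bc_pairing:
  assumes L: "L2 Q u" "L2 Q U" "L2 Q a" "L2 Q B" and z: "zero_bc Q u U"
    and s: "\<And>s. test_fun Q s \<Longrightarrow> ip Q a s = ip Q B (gradx s)"
  shows "ip Q a u = ip Q B U"
proof -
  obtain X where X: "\<And>n. test_fun Q (X n)" "L2conv Q X u" "L2conv Q (\<lambda>n. gradx (X n)) U"
    using zero_bcE[OF L(1,2) z] by metis
  show ?thesis
    by (rule LIMSEQ_eq_unique[OF L2conv_ip[OF L2conv_const[OF L(3)] X(2)] L2conv_ip[OF L2conv_const[OF L(4)] X(3)] s[OF X(1)]])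
qed

lemma pairing_test_fun:
  assumes L: "L2 Q a" "L2 Q B" and w: "test_fun (A \<times> \<Omega>) w"
    and s: "\<And>s. test_fun Q s \<Longrightarrow> ip Q a s = ip Q B (gradx s)"
  shows "ip Q a w = ip Q B (gradx w)"
  by (rule zero_bc_pairing[OF L2_Q_test[OF w] L2_gradx[OF w] L zero_bc_test_fun[OF w] s])

text \<open>\<open>weak_grad\<close> read off component by component as scalar inner products, the
  form in which time primitives and density arguments apply.\<close>

definition wgrad :: "(real \<times> (real^'d) \<Rightarrow> real) \<Rightarrow> (real \<times> (real^'d) \<Rightarrow> real^'d) \<Rightarrow> bool" where
  "wgrad u U \<longleftrightarrow> (\<forall>s i. test_fun Q s \<longrightarrow> ip Q (\<lambda>p. U p $ i) s = - ip Q u (dx i s))"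

lemma wgrad_iff:
  assumes L: "L2 Q u" "L2 Q U"
  shows "weak_grad Q u U \<longleftrightarrow> wgrad u U"
proof -
  have "intg Q (\<lambda>p. s p *\<^sub>R U p) = - intg Q (\<lambda>p. u p *\<^sub>R gradx s p) \<longleftrightarrow>
      (\<forall>i. ip Q (\<lambda>p. U p $ i) s = - ip Q u (dx i s))" if s: "test_fun Q s" for s
  proof -
    have "L2 Q (\<lambda>p. u p *\<^sub>R gradx s p)"
    proof (rule L2_vec)
      fix i
      have "L2 Q (\<lambda>p. dx i s p *\<^sub>R u p)"
        by (rule L2_test_scaleR[OF lmeasurable_Q test_fun_pderiv[OF s] L(1)])
      then show "L2 Q (\<lambda>p. (u p *\<^sub>R gradx s p) $ i)" by (simp add: gradx_nth mult.commute)
    qed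
    from intg_nth[OF lmeasurable_Q this]
    show ?thesis
      by (simp add: vec_eq_iff intg_scaleR_nth[OF lmeasurable_Q s L(2)] gradx_nth ip_def)
  qed
  then show ?thesis unfolding weak_grad_def wgrad_def by blast
qed

lemma ip_axis: "ip Q (\<lambda>p. u p *\<^sub>R axis i 1) V = ip Q u (\<lambda>p. V p $ i)"
  by (simp add: ip_def inner_axis' inner_axis)

lemma wgrad_test_fun:
  assumes L: "L2 Q u" "L2 Q U" and g: "wgrad u U" and w: "test_fun (A \<times> \<Omega>) w"
  shows "ip Q (\<lambda>p. U p $ i) w = - ip Q u (dx i w)"
proof -
  \<comment> \<open>The vector field \<open>- u p *\<^sub>R axis i 1\<close> fits an identity for a
    single partial derivative into a pairing with the full gradient.\<close>
  have e: "ip Q (\<lambda>p. - u p *\<^sub>R axis i 1) (gradx w) = - ip Q u (dx i w)" for w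
    unfolding ip_axis by (simp add: gradx_nth ip_minus_left)
  have "ip Q (\<lambda>p. U p $ i) w = ip Q (\<lambda>p. - u p *\<^sub>R axis i 1) (gradx w)"
  proof (rule pairing_test_fun[OF _ _ w])
    show "L2 Q (\<lambda>p. - u p *\<^sub>R axis i 1 :: real^'d)" by (intro L2_real_scaleR_const L2_minus L)
    show "ip Q (\<lambda>p. U p $ i) s = ip Q (\<lambda>p. - u p *\<^sub>R axis i 1) (gradx s)" if "test_fun Q s" for s
      unfolding e using g that unfolding wgrad_def by blast
  qed (rule L2_nth[OF L(2)])
  then show ?thesis by (simp only: e)
qed

text \<open>The two components in the closure are not independent: integration by parts for a
  product of two test functions identifies, in the limit, the second as the weak gradient of the
  first.\<close>

lemma zero_bc_wgrad:
  assumes L: "L2 Q u" "L2 Q U" and z: "zero_bc Q u U" shows "wgrad u U"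
  unfolding wgrad_def
proof (intro allI impI)
  fix s i assume s: "test_fun Q s"
  obtain X where X: "\<And>n. test_fun Q (X n)" "L2conv Q X u" "L2conv Q (\<lambda>n. gradx (X n)) U"
    using zero_bcE[OF L z] by metis
  have ds: "test_fun Q (dx i s)" by (rule test_fun_pderiv[OF s])
  show "ip Q (\<lambda>p. U p $ i) s = - ip Q u (dx i s)"
  proof (rule LIMSEQ_eq_unique)
    show "(\<lambda>n. ip Q (\<lambda>p. gradx (X n) p $ i) s) \<longlonglongrightarrow> ip Q (\<lambda>p. U p $ i) s"
      by (intro L2conv_ip L2conv_nth X L2conv_const L2_Q_test[OF s])
    show "(\<lambda>n. - ip Q (X n) (dx i s)) \<longlonglongrightarrow> - ip Q u (dx i s)"
      by (intro tendsto_minus L2conv_ip X L2conv_const L2_Q_test[OF ds])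
    fix n
    have dX: "test_fun Q (dx i (X n))" by (rule test_fun_pderiv[OF X(1)])
    have "intg Q (dx i (\<lambda>p. X n p * s p)) = 0"
      by (rule intg_pderiv_test_fun[OF test_fun_smooth_mult[OF test_fun_smooth[OF X(1)] s] fmeasurableD[OF lmeasurable_Q]])
    also have "dx i (\<lambda>p. X n p * s p) = (\<lambda>p. X n p * dx i s p + dx i (X n) p * s p)"
      by (rule ext) (intro pderiv_mult smooth_fun_differentiable test_fun_smooth[OF s] test_fun_smooth[OF X(1)])
    finally show "ip Q (\<lambda>p. gradx (X n) p $ i) s = - ip Q (X n) (dx i s)"
      using L2_integrable_mult[OF L2_Q_test[OF X(1)] L2_Q_test[OF ds]] L2_integrable_mult[OF L2_Q_test[OF dX] L2_Q_test[OF s]]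
      by (simp add: ip_def gradx_nth)
  qed
qed

section \<open>Primitives of vector fields\<close>

definition is_vbprim :: "(real \<times> (real^'d) \<Rightarrow> real^'d) \<Rightarrow> (real \<times> (real^'d) \<Rightarrow> real^'d) \<Rightarrow> (real^'d \<Rightarrow> real^'d) \<Rightarrow> bool" where
  "is_vbprim b \<tau> \<tau>0 \<longleftrightarrow> (\<forall>i. is_bprim (\<lambda>p. b p $ i) (\<lambda>p. \<tau> p $ i) (\<lambda>x. \<tau>0 x $ i))"

definition is_vfprim :: "(real \<times> (real^'d) \<Rightarrow> real^'d) \<Rightarrow> (real \<times> (real^'d) \<Rightarrow> real^'d) \<Rightarrow> bool" where
  "is_vfprim a A \<longleftrightarrow> (\<forall>i. is_fprim (\<lambda>p. a p $ i) (\<lambda>p. A p $ i))"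

lemma is_vbprimD:
  assumes "is_vbprim b \<tau> \<tau>0"
  shows "L2 Q b" "L2 Q \<tau>" "L2 \<Omega> \<tau>0" "is_bprim (\<lambda>p. b p $ i) (\<lambda>p. \<tau> p $ i) (\<lambda>x. \<tau>0 x $ i)"
  using assms unfolding is_vbprim_def by (auto intro!: L2_vec dest: is_bprimD(1-3))

lemma is_vfprimD:
  assumes "is_vfprim a A"
  shows "L2 Q a" "L2 Q A" "is_fprim (\<lambda>p. a p $ i) (\<lambda>p. A p $ i)"
  using assms unfolding is_vfprim_def by (auto intro!: L2_vec dest: is_fprimD(1-2))

lemma vbprim_exists:
  assumes "L2 Q b" obtains \<tau> \<tau>0 where "is_vbprim b \<tau> \<tau>0"
proof -
  have "\<exists>\<tau> \<tau>0. is_bprim (\<lambda>p. b p $ i) \<tau> \<tau>0" for i using bprim_exists[OF L2_nth[OF assms]] by metis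
  then obtain \<tau> \<tau>0 where "\<And>i. is_bprim (\<lambda>p. b p $ i) (\<tau> i) (\<tau>0 i)" by metis
  then have "is_vbprim b (\<lambda>p. \<chi> i. \<tau> i p) (\<lambda>x. \<chi> i. \<tau>0 i x)" by (simp add: is_vbprim_def)
  then show thesis using that by blast
qed

lemma vfprim_exists:
  assumes "L2 Q a" obtains A where "is_vfprim a A"
proof -
  have "\<exists>A. is_fprim (\<lambda>p. a p $ i) A" for i using fprim_exists[OF L2_nth[OF assms]] by metis
  then obtain A where "\<And>i. is_fprim (\<lambda>p. a p $ i) (A i)" by metis
  then have "is_vfprim a (\<lambda>p. \<chi> i. A i p)" by (simp add: is_vfprim_def)
  then show thesis using that by blast
qed

lemma L2_time_vec:
  assumes "L2 Q (f :: _ \<Rightarrow> real^'d)" shows "L2 Q (\<lambda>p. fst p *\<^sub>R f p)" "L2 Q (\<lambda>p. (T - fst p) *\<^sub>R f p)"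
  using L2_bounded_mult[OF assms time_weight(1,3)] L2_bounded_mult[OF assms time_weight(2,4)] by auto

lemma vbprim_energy:
  assumes "is_vbprim b \<tau> \<tau>0"
  shows "ip Q \<tau> b = (1/2) * ip \<Omega> \<tau>0 \<tau>0" "ip Q (\<lambda>p. fst p *\<^sub>R \<tau> p) b = (1/2) * ip Q \<tau> \<tau>"
proof -
  note L = is_vbprimD(1-3)[OF assms]
  show "ip Q \<tau> b = (1/2) * ip \<Omega> \<tau>0 \<tau>0"
    unfolding ip_vec[OF L(2) L(1)] ip_vec[OF L(3) L(3)] sum_distrib_left
    by (intro sum.cong refl bprim_energy(1)[OF is_vbprimD(4)[OF assms]])
  show "ip Q (\<lambda>p. fst p *\<^sub>R \<tau> p) b = (1/2) * ip Q \<tau> \<tau>"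
    unfolding ip_vec[OF L2_time_vec(1)[OF L(2)] L(1)] ip_vec[OF L(2) L(2)] sum_distrib_left vector_scaleR_component real_scaleR_def
    by (intro sum.cong refl bprim_energy(2)[OF is_vbprimD(4)[OF assms]])
qed

lemma vfprim_energy:
  assumes "is_vfprim a A" shows "ip Q (\<lambda>p. (T - fst p) *\<^sub>R A p) a = (1/2) * ip Q A A"
proof -
  note L = is_vfprimD(1-2)[OF assms]
  show ?thesis
    unfolding ip_vec[OF L2_time_vec(2)[OF L(2)] L(1)] ip_vec[OF L(2) L(2)] sum_distrib_left vector_scaleR_component real_scaleR_def
    by (intro sum.cong refl fprim_energy[OF is_vfprimD(3)[OF assms]])
qed

lemma vfprim_vbprim_dual:
  assumes "is_vfprim a A" "is_vbprim b B B0" shows "ip Q A b = ip Q a B"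
  unfolding ip_vec[OF is_vfprimD(2)[OF assms(1)] is_vbprimD(1)[OF assms(2)]] ip_vec[OF is_vfprimD(1)[OF assms(1)] is_vbprimD(2)[OF assms(2)]]
  by (intro sum.cong refl fprim_bprim_dual[OF is_vfprimD(3)[OF assms(1)] is_vbprimD(4)[OF assms(2)]])

lemma bprim_conv:
  assumes "\<And>n. is_bprim (b n) (\<tau> n) (\<tau>0 n)" "is_bprim b' \<tau>' \<tau>0'" "L2conv Q b b'"
  shows "L2conv Q \<tau> \<tau>'"
proof -
  have "nrm Q (\<lambda>p. \<tau> n p - \<tau>' p) \<le> 2 * T * nrm Q (\<lambda>p. b n p - b' p)" for n
    using bprim_nrm[OF is_bprim_lin[OF assms(1) assms(2), where c=1 and d="-1"]] by simp
  moreover have "(\<lambda>n. 2 * T * nrm Q (\<lambda>p. b n p - b' p)) \<longlonglongrightarrow> 0"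
    using assms(3) by (auto simp: L2conv_def intro: tendsto_mult_right_zero)
  ultimately have "(\<lambda>n. nrm Q (\<lambda>p. \<tau> n p - \<tau>' p)) \<longlonglongrightarrow> 0" by (intro LIMSEQ_zero_le[OF _ nrm_nonneg])
  then show ?thesis using is_bprimD(2)[OF assms(1)] is_bprimD(2)[OF assms(2)] by (simp add: L2conv_def)
qed

text \<open>Backward averaging commutes with spatial derivatives and keeps compact support in space,
  so averages of the approximating test functions lie in the closure by
  \<open>zero_bc_test_fun\<close>; continuity of the primitive does the rest.\<close>

lemma zero_bc_bprim:
  assumes z: "zero_bc Q u U" and u: "is_bprim u u1 u10" and U: "is_vbprim U U1 U10"
  shows "zero_bc Q u1 U1"
proof -
  obtain s where s: "\<And>n. test_fun Q (s n)" "L2conv Q s u" "L2conv Q (\<lambda>n. gradx (s n)) U"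
    using zero_bcE[OF is_bprimD(1)[OF u] is_vbprimD(1)[OF U] z] by metis
  show ?thesis
  proof (rule zero_bc_closure[OF zero_bc_test_fun[OF test_fun_bavg[OF s(1)]]])
    show "L2conv Q (\<lambda>n. bavg (s n)) u1" by (rule bprim_conv[OF is_bprim_bavg[OF s(1)] u s(2)])
    show "L2conv Q (\<lambda>n. gradx (bavg (s n))) U1"
    proof (rule L2conv_vec)
      fix i
      have "L2conv Q (\<lambda>n. bavg (dx i (s n))) (\<lambda>p. U1 p $ i)"
        by (rule bprim_conv[OF is_bprim_bavg[OF test_fun_pderiv[OF s(1)]] is_vbprimD(4)[OF U]])
          (use L2conv_nth[OF s(3), of i] in \<open>simp add: gradx_nth\<close>)
      then show "L2conv Q (\<lambda>n p. gradx (bavg (s n)) p $ i) (\<lambda>p. U1 p $ i)"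
        by (simp add: gradx_nth pderiv_bavg[OF s(1)])
    qed
  qed
qed

section \<open>Existence\<close>

lemma is_dtdiv_iff:
  assumes "L2 Q v" "L2 Q \<sigma>"
  shows "is_dtdiv Q v \<sigma> f \<longleftrightarrow> (\<forall>\<phi>. test_fun Q \<phi> \<longrightarrow> ip Q f \<phi> = - ip Q v (dt \<phi>) + ip Q \<sigma> (gradx \<phi>))"
  unfolding is_dtdiv_def ip_def
  using L2_integrable_mult[OF assms(1) L2_dt] L2_integrable_inner[OF assms(2) L2_gradx] by simp

lemma is_trace0_v_iff:
  assumes "L2 Q v" "L2 Q \<sigma>" "L2 Q f"
  shows "is_trace0_v T \<Omega> v \<sigma> f v0 \<longleftrightarrow> (\<forall>\<phi>. test_fun ({..<T} \<times> \<Omega>) \<phi> \<longrightarrow>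
     ip \<Omega> v0 (\<lambda>x. \<phi> (0, x)) = - ip Q v (dt \<phi>) + ip Q \<sigma> (gradx \<phi>) - ip Q f \<phi>)"
  unfolding is_trace0_v_def ip_def
  using L2_integrable_mult[OF assms(1) L2_dt] L2_integrable_inner[OF assms(2) L2_gradx] L2_integrable_mult[OF assms(3) L2_Q_test] by simp

lemma L2_scaleR_gradx:
  assumes "test_fun U \<phi>" "L2 Q v" shows "L2 Q (\<lambda>p. v p *\<^sub>R gradx \<phi> p)"
proof (rule L2_vec)
  fix i
  have "L2 Q (\<lambda>p. dx i \<phi> p *\<^sub>R v p)"
    by (rule L2_test_scaleR[OF lmeasurable_Q test_fun_pderiv[OF assms(1)] assms(2)])
  then show "L2 Q (\<lambda>p. (v p *\<^sub>R gradx \<phi> p) $ i)" by (simp add: gradx_nth mult.commute)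
qed

lemma intg_scaleR_gradx_nth:
  assumes "test_fun U \<phi>" "L2 Q v"
  shows "intg Q (\<lambda>p. v p *\<^sub>R gradx \<phi> p) $ i = ip Q v (dx i \<phi>)"
  using intg_nth[OF lmeasurable_Q L2_scaleR_gradx[OF assms], of i] by (simp add: ip_def gradx_nth)

lemma intg_scaleR_dt_nth:
  assumes "test_fun U \<phi>" "L2 Q (\<sigma> :: _ \<Rightarrow> real^'d)"
  shows "intg Q (\<lambda>p. dt \<phi> p *\<^sub>R \<sigma> p) $ i = ip Q (\<lambda>p. \<sigma> p $ i) (dt \<phi>)"
  unfolding dt_eq by (rule intg_scaleR_nth[OF lmeasurable_Q test_fun_pderiv[OF assms(1)] assms(2)])

lemma is_dtgrad_iff:
  assumes L: "L2 Q v" "L2 Q \<sigma>" "L2 Q g"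
  shows "is_dtgrad Q \<sigma> v g \<longleftrightarrow> (\<forall>\<phi> i. test_fun Q \<phi> \<longrightarrow>
     ip Q (\<lambda>p. g p $ i) \<phi> = - ip Q (\<lambda>p. \<sigma> p $ i) (dt \<phi>) + ip Q v (dx i \<phi>))"
proof -
  have "intg Q (\<lambda>p. \<phi> p *\<^sub>R g p) = intg Q (\<lambda>p. - (dt \<phi> p *\<^sub>R \<sigma> p) + v p *\<^sub>R gradx \<phi> p) \<longleftrightarrow>
     (\<forall>i. ip Q (\<lambda>p. g p $ i) \<phi> = - ip Q (\<lambda>p. \<sigma> p $ i) (dt \<phi>) + ip Q v (dx i \<phi>))"
    if t: "test_fun Q \<phi>" for \<phi>
  proof -
    have "integrable (lebesgue_on Q) (\<lambda>p. dt \<phi> p *\<^sub>R \<sigma> p)" unfolding dt_eq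
      by (rule L2_integrable[OF lmeasurable_Q L2_test_scaleR[OF lmeasurable_Q test_fun_pderiv[OF t] L(2)]])
    then have "intg Q (\<lambda>p. - (dt \<phi> p *\<^sub>R \<sigma> p) + v p *\<^sub>R gradx \<phi> p)
      = - intg Q (\<lambda>p. dt \<phi> p *\<^sub>R \<sigma> p) + intg Q (\<lambda>p. v p *\<^sub>R gradx \<phi> p)"
      using L2_integrable[OF lmeasurable_Q L2_scaleR_gradx[OF t L(1)]] by simp
    then show ?thesis
      by (simp add: vec_eq_iff intg_scaleR_nth[OF lmeasurable_Q t L(3)] intg_scaleR_dt_nth[OF t L(2)] intg_scaleR_gradx_nth[OF t L(1)])
  qed
  then show ?thesis unfolding is_dtgrad_def by blast
qed

lemma is_trace0_sigma_iff:
  assumes L: "L2 Q v" "L2 Q \<sigma>" "L2 Q g" "L2 \<Omega> \<sigma>0"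
  shows "is_trace0_sigma T \<Omega> \<sigma> v g \<sigma>0 \<longleftrightarrow> (\<forall>\<phi> i. test_fun ({..<T} \<times> \<Omega>) \<phi> \<longrightarrow>
     ip \<Omega> (\<lambda>x. \<sigma>0 x $ i) (\<lambda>x. \<phi> (0, x)) = - ip Q (\<lambda>p. \<sigma> p $ i) (dt \<phi>) + ip Q v (dx i \<phi>) - ip Q (\<lambda>p. g p $ i) \<phi>)"
proof -
  have "intg \<Omega> (\<lambda>x. \<phi> (0, x) *\<^sub>R \<sigma>0 x) = intg Q (\<lambda>p. - (dt \<phi> p *\<^sub>R \<sigma> p) + v p *\<^sub>R gradx \<phi> p - \<phi> p *\<^sub>R g p) \<longleftrightarrow>
     (\<forall>i. ip \<Omega> (\<lambda>x. \<sigma>0 x $ i) (\<lambda>x. \<phi> (0, x)) = - ip Q (\<lambda>p. \<sigma> p $ i) (dt \<phi>) + ip Q v (dx i \<phi>) - ip Q (\<lambda>p. g p $ i) \<phi>)"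
    if t: "test_fun ({..<T} \<times> \<Omega>) \<phi>" for \<phi>
  proof -
    have "integrable (lebesgue_on Q) (\<lambda>p. dt \<phi> p *\<^sub>R \<sigma> p)" unfolding dt_eq
      by (rule L2_integrable[OF lmeasurable_Q L2_test_scaleR[OF lmeasurable_Q test_fun_pderiv[OF t] L(2)]])
    then have "intg Q (\<lambda>p. - (dt \<phi> p *\<^sub>R \<sigma> p) + v p *\<^sub>R gradx \<phi> p - \<phi> p *\<^sub>R g p)
      = - intg Q (\<lambda>p. dt \<phi> p *\<^sub>R \<sigma> p) + intg Q (\<lambda>p. v p *\<^sub>R gradx \<phi> p) - intg Q (\<lambda>p. \<phi> p *\<^sub>R g p)"
      using L2_integrable[OF lmeasurable_Q L2_scaleR_gradx[OF t L(1)]]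
        L2_integrable[OF lmeasurable_Q L2_test_scaleR[OF lmeasurable_Q t L(3)]] by simp
    then show ?thesis
      by (simp add: vec_eq_iff intg_scaleR_nth[OF lmeasurable_Q t L(3)] intg_scaleR_dt_nth[OF t L(2)] intg_scaleR_gradx_nth[OF t L(1)]
          intg_scaleR_nth[OF lmeasurable_Omega test_fun_section[OF t] L(4)])
  qed
  then show ?thesis unfolding is_trace0_sigma_def by blast
qed

lemma weak_dt_iff:
  "weak_dt Q u w \<longleftrightarrow> (\<forall>\<phi>. test_fun Q \<phi> \<longrightarrow> ip Q w \<phi> = - ip Q u (dt \<phi>))"
  unfolding weak_dt_def ip_def by (simp add: mult.commute)

lemma zero_at_T_iff:
  "zero_at_T T \<Omega> u w \<longleftrightarrow> (\<forall>\<psi>. test_fun ({0<..} \<times> \<Omega>) \<psi> \<longrightarrow> ip Q w \<psi> = - ip Q u (dt \<psi>))"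
  unfolding zero_at_T_def ip_def by simp

lemma trace0_vec_iff:
  assumes L: "L2 Q G" "L2 Q H" "L2 \<Omega> G0"
  shows "trace0_vec T \<Omega> G H G0 \<longleftrightarrow> (\<forall>\<psi> i. test_fun ({..<T} \<times> \<Omega>) \<psi> \<longrightarrow>
    ip \<Omega> (\<lambda>x. G0 x $ i) (\<lambda>x. \<psi> (0, x)) = - ip Q (\<lambda>p. G p $ i) (dt \<psi>) - ip Q (\<lambda>p. H p $ i) \<psi>)"
proof -
  have "intg \<Omega> (\<lambda>x. \<psi> (0, x) *\<^sub>R G0 x) = - intg Q (\<lambda>p. dt \<psi> p *\<^sub>R G p + \<psi> p *\<^sub>R H p) \<longleftrightarrow>
    (\<forall>i. ip \<Omega> (\<lambda>x. G0 x $ i) (\<lambda>x. \<psi> (0, x)) = - ip Q (\<lambda>p. G p $ i) (dt \<psi>) - ip Q (\<lambda>p. H p $ i) \<psi>)"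
    if t: "test_fun ({..<T} \<times> \<Omega>) \<psi>" for \<psi>
  proof -
    have "integrable (lebesgue_on Q) (\<lambda>p. dt \<psi> p *\<^sub>R G p)" unfolding dt_eq
      by (rule L2_integrable[OF lmeasurable_Q L2_test_scaleR[OF lmeasurable_Q test_fun_pderiv[OF t] L(1)]])
    then have "intg Q (\<lambda>p. dt \<psi> p *\<^sub>R G p + \<psi> p *\<^sub>R H p) = intg Q (\<lambda>p. dt \<psi> p *\<^sub>R G p) + intg Q (\<lambda>p. \<psi> p *\<^sub>R H p)"
      using L2_integrable[OF lmeasurable_Q L2_test_scaleR[OF lmeasurable_Q t L(2)]] by simp
    then show ?thesis
      by (simp add: vec_eq_iff intg_scaleR_nth[OF lmeasurable_Q t L(2)] intg_scaleR_dt_nth[OF t L(1)]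
          intg_scaleR_nth[OF lmeasurable_Omega test_fun_section[OF t] L(3)])
  qed
  then show ?thesis unfolding trace0_vec_def by blast
qed

section \<open>Weak divergence and the adjoint wave operator\<close>

definition wdiv :: "(real \<times> (real^'d) \<Rightarrow> real^'d) \<Rightarrow> (real \<times> (real^'d) \<Rightarrow> real) \<Rightarrow> bool" where
  "wdiv \<tau> \<delta> \<longleftrightarrow> (\<forall>s. test_fun Q s \<longrightarrow> ip Q \<delta> s = - ip Q \<tau> (gradx s))"

lemma wdiv_test_fun:
  assumes L: "L2 Q \<tau>" "L2 Q \<delta>" and d: "wdiv \<tau> \<delta>" and w: "test_fun (A \<times> \<Omega>) w"
  shows "ip Q \<delta> w = - ip Q \<tau> (gradx w)"
  using pairing_test_fun[OF L(2) L2_minus[OF L(1)] w] d by (simp add: wdiv_def ip_minus_left)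

text \<open>Green's formula without a boundary term. The zero boundary values are carried by
  \<open>u\<close>, so no normal trace of \<open>\<tau>\<close> enters.\<close>

lemma wdiv_zero_bc:
  assumes L: "L2 Q \<tau>" "L2 Q \<delta>" "L2 Q u" "L2 Q U" and d: "wdiv \<tau> \<delta>" and z: "zero_bc Q u U"
  shows "ip Q \<delta> u = - ip Q \<tau> U"
  using zero_bc_pairing[OF L(3,4) L(2) L2_minus[OF L(1)] z] d by (simp add: wdiv_def ip_minus_left)

lemma lapx_eq: "lapx s p = (\<Sum>i\<in>UNIV. dx i (dx i s) p)"
  by (simp add: lapx_def pderivs.simps)

text \<open>Given the gradient, one spatial derivative is moved back onto it, so the weak Laplacian
  becomes a weak divergence; from here on only \<open>wdiv\<close> is used.\<close>

lemma weak_lap_iff: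
  assumes L: "L2 Q u" "L2 Q U" and g: "wgrad u U"
  shows "weak_lap Q u l \<longleftrightarrow> wdiv U l"
proof -
  have "intg Q (\<lambda>p. u p * lapx s p) = - ip Q U (gradx s)" if s: "test_fun Q s" for s
  proof -
    have "intg Q (\<lambda>p. u p * lapx s p) = (\<Sum>i\<in>UNIV. ip Q u (dx i (dx i s)))"
      unfolding lapx_eq sum_distrib_left ip_def inner_real_def
      by (rule Bochner_Integration.integral_sum) (intro L2_integrable_mult L(1) L2_Q_test[OF test_fun_pderiv[OF test_fun_pderiv[OF s]]])
    also have "\<dots> = (\<Sum>i\<in>UNIV. - ip Q (\<lambda>p. U p $ i) (dx i s))"
      using g test_fun_pderiv[OF s] unfolding wgrad_def by (intro sum.cong) auto
    also have "\<dots> = - ip Q U (gradx s)"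
      unfolding ip_vec[OF L(2) L2_gradx[OF s]] by (simp add: gradx_nth sum_negf)
    finally show ?thesis .
  qed
  then show ?thesis unfolding weak_lap_def wdiv_def by (simp add: ip_def)
qed

text \<open>Test pairs \<open>(w, \<tau>)\<close> vanishing at time \<open>T\<close>, with \<open>\<partial>\<^sub>t\<tau> = -b\<close>, \<open>\<tau>(0) = \<tau>0\<close> and \<open>div \<tau> = \<delta>\<close>. The adjoint
  wave operator maps them to \<open>(\<delta> - \<partial>\<^sub>t w, b + \<nabla>w)\<close>.\<close>

definition admissible :: "(real \<times> (real^'d) \<Rightarrow> real) \<Rightarrow> (real \<times> (real^'d) \<Rightarrow> real^'d) \<Rightarrow> (real \<times> (real^'d) \<Rightarrow> real^'d)
    \<Rightarrow> (real^'d \<Rightarrow> real^'d) \<Rightarrow> (real \<times> (real^'d) \<Rightarrow> real) \<Rightarrow> bool" where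
  "admissible w b \<tau> \<tau>0 \<delta> \<longleftrightarrow> test_fun ({..<T} \<times> \<Omega>) w \<and> is_vbprim b \<tau> \<tau>0 \<and> L2 Q \<delta> \<and> wdiv \<tau> \<delta>"

definition adjoint_wave :: "(real \<times> (real^'d) \<Rightarrow> real) \<Rightarrow> (real \<times> (real^'d) \<Rightarrow> real^'d) \<Rightarrow> (real \<times> (real^'d) \<Rightarrow> real)
    \<Rightarrow> real \<times> (real^'d) \<Rightarrow> real \<times> (real^'d)" where
  "adjoint_wave w b \<delta> p = (\<delta> p - dt w p, b p + gradx w p)"

lemma admissible_lin:
  assumes "admissible w b \<tau> \<tau>0 \<delta>" "admissible w' b' \<tau>' \<tau>0' \<delta>'"
  shows "admissible (\<lambda>p. c * w p + d * w' p) (\<lambda>p. c *\<^sub>R b p + d *\<^sub>R b' p) (\<lambda>p. c *\<^sub>R \<tau> p + d *\<^sub>R \<tau>' p)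
     (\<lambda>x. c *\<^sub>R \<tau>0 x + d *\<^sub>R \<tau>0' x) (\<lambda>p. c * \<delta> p + d * \<delta>' p)"
proof -
  have A: "test_fun ({..<T} \<times> \<Omega>) w" "is_vbprim b \<tau> \<tau>0" "L2 Q \<delta>" "wdiv \<tau> \<delta>"
    "test_fun ({..<T} \<times> \<Omega>) w'" "is_vbprim b' \<tau>' \<tau>0'" "L2 Q \<delta>'" "wdiv \<tau>' \<delta>'"
    using assms by (auto simp: admissible_def)
  have "wdiv (\<lambda>p. c *\<^sub>R \<tau> p + d *\<^sub>R \<tau>' p) (\<lambda>p. c * \<delta> p + d * \<delta>' p)"
    using A(4,8) unfolding wdiv_def
    by (simp add: ip_lin_left ip_lin_left' A(3,7) L2_gradx L2_Q_test is_vbprimD(2)[OF A(2)] is_vbprimD(2)[OF A(6)])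
  moreover have "is_vbprim (\<lambda>p. c *\<^sub>R b p + d *\<^sub>R b' p) (\<lambda>p. c *\<^sub>R \<tau> p + d *\<^sub>R \<tau>' p) (\<lambda>x. c *\<^sub>R \<tau>0 x + d *\<^sub>R \<tau>0' x)"
    using is_bprim_lin[OF is_vbprimD(4)[OF A(2)] is_vbprimD(4)[OF A(6)]] by (simp add: is_vbprim_def)
  ultimately show ?thesis unfolding admissible_def using A by (simp add: test_fun_lin L2_lin)
qed

lemma adjoint_wave_lin:
  assumes "smooth_fun w" "smooth_fun w'"
  shows "adjoint_wave (\<lambda>p. c * w p + d * w' p) (\<lambda>p. c *\<^sub>R b p + d *\<^sub>R b' p) (\<lambda>p. c * \<delta> p + d * \<delta>' p) p
    = c *\<^sub>R adjoint_wave w b \<delta> p + d *\<^sub>R adjoint_wave w' b' \<delta>' p"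
  using assms by (simp add: adjoint_wave_def dt_eq pderiv_lin vec_eq_iff gradx_nth algebra_simps)

lemma is_bprim_zero: "is_bprim (\<lambda>p. 0) (\<lambda>p. 0) (\<lambda>x. 0)"
  by (simp add: is_bprim_def)

lemma admissible_zero: "admissible (\<lambda>p. 0) (\<lambda>p. 0) (\<lambda>p. 0) (\<lambda>x. 0) (\<lambda>p. 0)"
  by (simp add: admissible_def test_fun_zero is_vbprim_def is_bprim_zero wdiv_def)

lemma adjoint_wave_zero: "adjoint_wave (\<lambda>p. 0) (\<lambda>p. 0) (\<lambda>p. 0) p = 0"
proof -
  have "pderivs [v] (\<lambda>p. 0) p = 0" for v p :: "real \<times> (real^'d)" by (rule pderiv_eq) (rule has_derivative_const)
  then show ?thesis by (simp add: adjoint_wave_def dt_eq vec_eq_iff gradx_nth zero_prod_def)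
qed

lemma L2_adjoint_wave:
  assumes "admissible w b \<tau> \<tau>0 \<delta>" shows "L2 Q (adjoint_wave w b \<delta>)"
  unfolding adjoint_wave_def[abs_def] using assms
  by (auto simp: admissible_def intro!: L2_Pair L2_diff L2_add L2_dt L2_gradx dest: is_vbprimD(1))

text \<open>Obtained by pairing the adjoint equation with \<open>t (w, \<tau>)\<close> and with \<open>(w, \<tau>)\<close>.\<close>

lemma adjoint_wave_bounds:
  assumes adm: "admissible w b \<tau> \<tau>0 \<delta>"
  shows "nrm Q (\<lambda>p. (w p, \<tau> p)) \<le> 2 * T * nrm Q (adjoint_wave w b \<delta>)"
    and "nrm \<Omega> (\<lambda>x. (w (0, x), \<tau>0 x)) \<le> 2 * sqrt T * nrm Q (adjoint_wave w b \<delta>)"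
proof -
  have w: "test_fun ({..<T} \<times> \<Omega>) w" and b: "is_vbprim b \<tau> \<tau>0" and d: "L2 Q \<delta>" "wdiv \<tau> \<delta>"
    using adm by (auto simp: admissible_def)
  note L = L2_Q_test[OF w] L2_dt[OF w] L2_gradx[OF w] L2_Omega_section[OF w, of 0] is_vbprimD(1-3)[OF b] d(1)
  note LT = L2_time[OF L(1)] L2_time_vec(1)[OF L(6)]
  let ?N = "nrm Q (adjoint_wave w b \<delta>)" and ?W = "\<lambda>p. (w p, \<tau> p)" and ?Z = "\<lambda>x. (w (0, x), \<tau>0 x)"
  have WL: "L2 Q ?W" "L2 \<Omega> ?Z" by (intro L2_Pair L)+
  have AL: "L2 Q (adjoint_wave w b \<delta>)" by (rule L2_adjoint_wave[OF adm])
  have "ip Q ?W (adjoint_wave w b \<delta>) = ip Q w (\<lambda>p. \<delta> p - dt w p) + ip Q \<tau> (\<lambda>p. b p + gradx w p)"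
    unfolding adjoint_wave_def[abs_def] by (intro ip_Pair L2_diff L2_add L)
  \<comment> \<open>The bracket vanishes by Green's formula, as \<open>w\<close> has compact support
    in space. The remaining time terms each contribute half of a squared norm at time 0.\<close>
  also have "\<dots> = (ip Q \<delta> w + ip Q \<tau> (gradx w)) - ip Q w (dt w) + ip Q \<tau> b"
    using L by (simp add: ip_diff_right ip_add_right ip_commute[of Q w \<delta>])
  also have "\<dots> = (1/2) * (ip \<Omega> (\<lambda>x. w (0, x)) (\<lambda>x. w (0, x)) + ip \<Omega> \<tau>0 \<tau>0)"
    using wdiv_test_fun[OF L(6) d w] bprim_test_fun_bounds(1)[OF w] vbprim_energy(1)[OF b] by (simp add: algebra_simps)
  also have "\<dots> = (1/2) * (nrm \<Omega> ?Z)\<^sup>2"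
    unfolding nrm_sq using L by (simp add: ip_Pair)
  finally have e0: "(nrm \<Omega> ?Z)\<^sup>2 = 2 * ip Q ?W (adjoint_wave w b \<delta>)" by simp
  \<comment> \<open>The weighted function is again a test function and t commutes with \<nabla>, so
    the spatial terms cancel once more; the weight leaves the norm over \<open>Q\<close> in place of
    the trace.\<close>
  have tw: "test_fun ({..<T} \<times> \<Omega>) (\<lambda>p. fst p * w p)" by (rule test_fun_smooth_mult[OF smooth_fun_time w])
  have gt: "gradx (\<lambda>p. fst p * w p) p = fst p *\<^sub>R gradx w p" for p
    using gradx_time_fun[of "\<lambda>t. t" p] smooth_fun_affine[of "1::real" 0]
    by (simp add: gradx_mult[OF smooth_fun_time test_fun_smooth[OF w]])
  have "ip Q (\<lambda>p. fst p *\<^sub>R ?W p) (adjoint_wave w b \<delta>) = ip Q (\<lambda>p. (fst p * w p, fst p *\<^sub>R \<tau> p)) (adjoint_wave w b \<delta>)"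
    by simp
  also have "\<dots> = ip Q (\<lambda>p. fst p * w p) (\<lambda>p. \<delta> p - dt w p) + ip Q (\<lambda>p. fst p *\<^sub>R \<tau> p) (\<lambda>p. b p + gradx w p)"
    unfolding adjoint_wave_def[abs_def] by (intro ip_Pair L2_diff L2_add L LT)
  also have "\<dots> = (ip Q \<delta> (\<lambda>p. fst p * w p) + ip Q (\<lambda>p. fst p *\<^sub>R \<tau> p) (gradx w)) - ip Q (\<lambda>p. fst p * w p) (dt w) + ip Q (\<lambda>p. fst p *\<^sub>R \<tau> p) b"
    using L LT by (simp add: ip_diff_right ip_add_right ip_commute[of Q _ \<delta>])
  also have "ip Q (\<lambda>p. fst p *\<^sub>R \<tau> p) (gradx w) = ip Q \<tau> (gradx (\<lambda>p. fst p * w p))"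
    by (simp add: ip_def gt)
  also have "ip Q \<delta> (\<lambda>p. fst p * w p) + ip Q \<tau> (gradx (\<lambda>p. fst p * w p)) = 0"
    using wdiv_test_fun[OF L(6) d tw] by simp
  also have "0 - ip Q (\<lambda>p. fst p * w p) (dt w) + ip Q (\<lambda>p. fst p *\<^sub>R \<tau> p) b = (1/2) * (ip Q w w + ip Q \<tau> \<tau>)"
    using bprim_test_fun_bounds(2)[OF w] vbprim_energy(2)[OF b] by (simp add: algebra_simps)
  also have "\<dots> = (1/2) * (nrm Q ?W)\<^sup>2"
    unfolding nrm_sq using L by (simp add: ip_Pair)
  finally have e1: "(nrm Q ?W)\<^sup>2 = 2 * ip Q (\<lambda>p. fst p *\<^sub>R ?W p) (adjoint_wave w b \<delta>)" by (simp only:)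
  have tWL: "L2 Q (\<lambda>p. fst p *\<^sub>R ?W p)" by (rule L2_bounded_mult[OF WL(1) time_weight(1,3)])
  have "(nrm Q ?W)\<^sup>2 \<le> 2 * (nrm Q (\<lambda>p. fst p *\<^sub>R ?W p) * ?N)"
    using e1 ip_Cauchy_Schwarz[OF tWL AL] by linarith
  also have "\<dots> \<le> 2 * ((\<bar>T\<bar> * nrm Q ?W) * ?N)"
    by (intro mult_left_mono mult_right_mono nrm_bounded_mult[OF WL(1) time_weight(1,3)]) auto
  also have "\<dots> = (2 * T * ?N) * nrm Q ?W" using T_pos by simp
  finally show b1: "nrm Q ?W \<le> 2 * T * ?N"
    by (rule square_le_mult_imp_le) (use T_pos in auto)
  show "nrm \<Omega> ?Z \<le> 2 * sqrt T * ?N"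
  proof (rule power2_le_imp_le)
    have "(nrm \<Omega> ?Z)\<^sup>2 \<le> 2 * (nrm Q ?W * ?N)"
      unfolding e0 using ip_Cauchy_Schwarz[OF WL(1) AL] by simp
    also have "\<dots> \<le> 2 * ((2 * T * ?N) * ?N)"
      by (intro mult_left_mono mult_right_mono b1) auto
    also have "\<dots> = (2 * sqrt T * ?N)\<^sup>2"
      using T_pos by (simp add: power_mult_distrib) (simp add: power2_eq_square)
    finally show "(nrm \<Omega> ?Z)\<^sup>2 \<le> (2 * sqrt T * ?N)\<^sup>2" .
  qed (use T_pos in simp)
qed

text \<open>The data functional is bounded by the norm of the image of the test pair under the
  adjoint, thanks to \<open>adjoint_wave_bounds\<close>, and its representer is the solution pair.
  The two constants there reappear in front of the source terms and of the initial data.\<close>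

lemma wave_weak_solution:
  assumes L: "L2 Q f" "L2 Q g" "L2 \<Omega> v0" "L2 \<Omega> \<sigma>0"
  obtains v \<sigma> where "L2 Q v" "L2 Q \<sigma>"
    "nrm Q (\<lambda>p. (v p, \<sigma> p)) \<le> 2 * T * nrm Q (\<lambda>p. (f p, g p)) + 2 * sqrt T * nrm \<Omega> (\<lambda>x. (v0 x, \<sigma>0 x))"
    "\<And>w b \<tau> \<tau>0 \<delta>. admissible w b \<tau> \<tau>0 \<delta> \<Longrightarrow>
       ip Q v (\<lambda>p. \<delta> p - dt w p) + ip Q \<sigma> (\<lambda>p. b p + gradx w p)
       = ip Q f w + ip Q g \<tau> + ip \<Omega> v0 (\<lambda>x. w (0, x)) + ip \<Omega> \<sigma>0 \<tau>0"
proof -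
  define F where "F = nrm Q (\<lambda>p. (f p, g p))"
  define F0 where "F0 = nrm \<Omega> (\<lambda>x. (v0 x, \<sigma>0 x))"
  define l where "l w \<tau> \<tau>0 = ip Q f w + ip Q g \<tau> + ip \<Omega> v0 (\<lambda>x. w (0, x)) + ip \<Omega> \<sigma>0 \<tau>0"
    for w :: "real \<times> (real^'d) \<Rightarrow> real" and \<tau> :: "real \<times> (real^'d) \<Rightarrow> real^'d" and \<tau>0 :: "real^'d \<Rightarrow> real^'d"
  \<comment> \<open>The value \<open>l\<close> is defined from the test pair, not from its image
    under the adjoint; as a relation, it can be used before it is known to depend on the image
    alone.\<close>
  define Rel where "Rel = {(adjoint_wave w b \<delta>, l w \<tau> \<tau>0) | w b \<tau> \<tau>0 \<delta>. admissible w b \<tau> \<tau>0 \<delta>}"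
  have FL: "L2 Q (\<lambda>p. (f p, g p))" "L2 \<Omega> (\<lambda>x. (v0 x, \<sigma>0 x))" by (intro L2_Pair L)+
  have lin: "(\<lambda>p. c *\<^sub>R x p + d *\<^sub>R y p, c * r + d * s) \<in> Rel" if "(x, r) \<in> Rel" "(y, s) \<in> Rel" for x r y s c d
  proof -
    obtain w b \<tau> \<tau>0 \<delta> where 1: "admissible w b \<tau> \<tau>0 \<delta>" and x: "x = adjoint_wave w b \<delta>" "r = l w \<tau> \<tau>0"
      using \<open>(x, r) \<in> Rel\<close> unfolding Rel_def by blast
    obtain w' b' \<tau>' \<tau>0' \<delta>' where 2: "admissible w' b' \<tau>' \<tau>0' \<delta>'" and y: "y = adjoint_wave w' b' \<delta>'" "s = l w' \<tau>' \<tau>0'"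
      using \<open>(y, s) \<in> Rel\<close> unfolding Rel_def by blast
    have w: "test_fun ({..<T} \<times> \<Omega>) w" "is_vbprim b \<tau> \<tau>0" "test_fun ({..<T} \<times> \<Omega>) w'" "is_vbprim b' \<tau>' \<tau>0'"
      using 1 2 by (auto simp: admissible_def)
    note LL = L2_Q_test[OF w(1)] L2_Q_test[OF w(3)] L2_Omega_section[OF w(1), of 0] L2_Omega_section[OF w(3), of 0]
      is_vbprimD(2,3)[OF w(2)] is_vbprimD(2,3)[OF w(4)]
    have "l (\<lambda>p. c * w p + d * w' p) (\<lambda>p. c *\<^sub>R \<tau> p + d *\<^sub>R \<tau>' p) (\<lambda>x. c *\<^sub>R \<tau>0 x + d *\<^sub>R \<tau>0' x) = c * r + d * s"
      using ip_lin_right[OF LL(1) LL(2) L(1), of c d] ip_lin_right[OF LL(3) LL(4) L(3), of c d]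
        ip_lin_right[OF LL(5) LL(7) L(2), of c d] ip_lin_right[OF LL(6) LL(8) L(4), of c d]
      by (simp add: l_def x y algebra_simps)
    moreover have "(\<lambda>p. c *\<^sub>R x p + d *\<^sub>R y p) = adjoint_wave (\<lambda>p. c * w p + d * w' p) (\<lambda>p. c *\<^sub>R b p + d *\<^sub>R b' p) (\<lambda>p. c * \<delta> p + d * \<delta>' p)"
      unfolding x y by (rule ext) (rule adjoint_wave_lin[OF test_fun_smooth[OF w(1)] test_fun_smooth[OF w(3)], symmetric])
    ultimately show ?thesis unfolding Rel_def using admissible_lin[OF 1 2, of c d] by (auto intro!: exI)
  qed
  obtain u where u: "L2 Q u" "\<And>x r. (x, r) \<in> Rel \<Longrightarrow> ip Q u x = r" "nrm Q u \<le> \<bar>2 * T * F + 2 * sqrt T * F0\<bar>"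
  proof (rule Riesz_linear_relation[of Rel Q "2 * T * F + 2 * sqrt T * F0"])
    show "((\<lambda>p. 0), 0) \<in> Rel"
      unfolding Rel_def using admissible_zero
      by (auto simp: l_def fun_eq_iff adjoint_wave_zero intro!: exI)
    show "(\<lambda>p. x p + y p, r + s) \<in> Rel" if "(x, r) \<in> Rel" "(y, s) \<in> Rel" for x r y s
      using lin[OF that, of 1 1] by simp
    show "(\<lambda>p. c *\<^sub>R x p, c * r) \<in> Rel" if "(x, r) \<in> Rel" for x r c
      using lin[OF that that, of c 0] by simp
    show "L2 Q x" if "(x, r) \<in> Rel" for x r
      using that L2_adjoint_wave unfolding Rel_def by blast
    show "\<bar>r\<bar> \<le> (2 * T * F + 2 * sqrt T * F0) * nrm Q x" if xr: "(x, r) \<in> Rel" for x r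
    proof -
      obtain w b \<tau> \<tau>0 \<delta> where 1: "admissible w b \<tau> \<tau>0 \<delta>" and x: "x = adjoint_wave w b \<delta>" "r = l w \<tau> \<tau>0"
        using xr unfolding Rel_def by blast
      have w: "test_fun ({..<T} \<times> \<Omega>) w" "is_vbprim b \<tau> \<tau>0" using 1 by (auto simp: admissible_def)
      note LL = L2_Q_test[OF w(1)] L2_Omega_section[OF w(1), of 0] is_vbprimD(2,3)[OF w(2)]
      have "r = ip Q (\<lambda>p. (f p, g p)) (\<lambda>p. (w p, \<tau> p)) + ip \<Omega> (\<lambda>x. (v0 x, \<sigma>0 x)) (\<lambda>x. (w (0, x), \<tau>0 x))"
        using L LL by (simp add: x l_def ip_Pair)
      also have "\<bar>\<dots>\<bar> \<le> F * nrm Q (\<lambda>p. (w p, \<tau> p)) + F0 * nrm \<Omega> (\<lambda>x. (w (0, x), \<tau>0 x))"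
        unfolding F_def F0_def
        using ip_Cauchy_Schwarz[OF FL(1) L2_Pair[OF LL(1,3)]] ip_Cauchy_Schwarz[OF FL(2) L2_Pair[OF LL(2,4)]] by linarith
      also have "\<dots> \<le> F * (2 * T * nrm Q x) + F0 * (2 * sqrt T * nrm Q x)"
        unfolding x F_def F0_def by (intro add_mono mult_left_mono adjoint_wave_bounds[OF 1]) auto
      finally show ?thesis by (simp add: algebra_simps)
    qed
  qed blast
  define v where "v p = fst (u p)" for p
  define \<sigma> where "\<sigma> p = snd (u p)" for p
  have vs: "L2 Q v" "L2 Q \<sigma>" unfolding v_def \<sigma>_def by (intro L2_fst L2_snd u(1))+
  show thesis
  proof (rule that[OF vs])
    have "F \<ge> 0" "F0 \<ge> 0" by (auto simp: F_def F0_def)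
    then show "nrm Q (\<lambda>p. (v p, \<sigma> p)) \<le> 2 * T * nrm Q (\<lambda>p. (f p, g p)) + 2 * sqrt T * nrm \<Omega> (\<lambda>x. (v0 x, \<sigma>0 x))"
      using u(3) T_pos by (simp add: v_def \<sigma>_def F_def F0_def)
    fix w b \<tau> \<tau>0 \<delta> assume 1: "admissible w b \<tau> \<tau>0 \<delta>"
    have w: "test_fun ({..<T} \<times> \<Omega>) w" "is_vbprim b \<tau> \<tau>0" "L2 Q \<delta>" using 1 by (auto simp: admissible_def)
    have "ip Q u (adjoint_wave w b \<delta>) = l w \<tau> \<tau>0"
      by (rule u(2)) (use 1 in \<open>unfold Rel_def, blast\<close>)
    moreover have "ip Q (\<lambda>p. (v p, \<sigma> p)) (adjoint_wave w b \<delta>) = ip Q v (\<lambda>p. \<delta> p - dt w p) + ip Q \<sigma> (\<lambda>p. b p + gradx w p)"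
      unfolding adjoint_wave_def[abs_def]
      by (intro ip_Pair vs L2_diff L2_add w(3) L2_dt[OF w(1)] L2_gradx[OF w(1)] is_vbprimD(1)[OF w(2)])
    ultimately show "ip Q v (\<lambda>p. \<delta> p - dt w p) + ip Q \<sigma> (\<lambda>p. b p + gradx w p)
       = ip Q f w + ip Q g \<tau> + ip \<Omega> v0 (\<lambda>x. w (0, x)) + ip \<Omega> \<sigma>0 \<tau>0"
      by (simp add: v_def \<sigma>_def l_def)
  qed
qed

lemma admissible_scalar: "test_fun ({..<T} \<times> \<Omega>) w \<Longrightarrow> admissible w (\<lambda>p. 0) (\<lambda>p. 0) (\<lambda>x. 0) (\<lambda>p. 0)"
  using admissible_zero by (simp add: admissible_def)

text \<open>Multiples of a coordinate direction recover the equation for \<open>\<sigma>\<close> one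
  component at a time: the divergence of such a field is a single partial derivative of
  \<open>\<phi>\<close>.\<close>

lemma admissible_vector:
  assumes p: "test_fun ({..<T} \<times> \<Omega>) \<phi>"
  shows "admissible (\<lambda>p. 0) (\<lambda>p. - dt \<phi> p *\<^sub>R axis i 1) (\<lambda>p. \<phi> p *\<^sub>R axis i 1) (\<lambda>x. \<phi> (0, x) *\<^sub>R axis i 1)
     (dx i \<phi>)"
  unfolding admissible_def
proof (intro conjI test_fun_zero)
  show "L2 Q (dx i \<phi>)" by (rule L2_Q_test[OF test_fun_pderiv[OF p]])
  have "wgrad \<phi> (gradx \<phi>)"
    by (rule zero_bc_wgrad[OF L2_Q_test[OF p] L2_gradx[OF p] zero_bc_test_fun[OF p]])
  then show "wdiv (\<lambda>p. \<phi> p *\<^sub>R axis i 1) (dx i \<phi>)"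
    unfolding wdiv_def wgrad_def ip_axis by (simp add: gradx_nth)
  show "is_vbprim (\<lambda>p. - dt \<phi> p *\<^sub>R axis i 1) (\<lambda>p. \<phi> p *\<^sub>R axis i 1) (\<lambda>x. \<phi> (0, x) *\<^sub>R axis i 1)"
    unfolding is_vbprim_def
  proof
    fix j
    show "is_bprim (\<lambda>p. (- dt \<phi> p *\<^sub>R axis i 1) $ j) (\<lambda>p. (\<phi> p *\<^sub>R axis i 1) $ j) (\<lambda>x. (\<phi> (0, x) *\<^sub>R axis i 1) $ j)"
      using is_bprim_test_fun[OF p] is_bprim_zero by (cases "i = j") (auto simp: axis_def)
  qed
qed

text \<open>The weak boundary condition becomes part of the variational identity: with
  \<open>w = 0\<close>, \<open>\<tau> = G\<close> and \<open>b = - Gt\<close> that identity is the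
  vanishing of D. As \<open>G\<close> need not vanish near the boundary of \<open>\<Omega>\<close>,
  admissible pairs ask for compact support in space of \<open>w\<close> only.\<close>

lemma inY_admissible:
  assumes "inY T \<Omega> \<phi> \<phi>t \<phi>tt G Gt L G0"
  shows "admissible (\<lambda>p. 0) (\<lambda>p. - Gt p) G G0 L"
proof -
  have Y: "L2 Q \<phi>" "L2 Q \<phi>t" "L2 Q G" "L2 Q Gt" "L2 Q L" "L2 \<Omega> G0" "weak_grad Q \<phi> G" "weak_grad Q \<phi>t Gt" "weak_lap Q \<phi> L"
    "zero_at_T T \<Omega> \<phi> \<phi>t" "trace0_vec T \<Omega> G Gt G0"
    using assms by (auto simp: inY_def)
  have g: "wgrad \<phi> G" "wgrad \<phi>t Gt" using Y by (simp_all add: wgrad_iff)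
  have "is_bprim (\<lambda>p. - Gt p $ i) (\<lambda>p. G p $ i) (\<lambda>x. G0 x $ i)" for i
    unfolding is_bprim_def
  proof (intro conjI allI impI)
    show "L2 Q (\<lambda>p. - Gt p $ i)" "L2 Q (\<lambda>p. G p $ i)" "L2 \<Omega> (\<lambda>x. G0 x $ i)" by (intro L2_minus L2_nth Y)+
    show "ip Q (\<lambda>p. - Gt p $ i) a - ip Q (\<lambda>p. G p $ i) (dt a) = ip \<Omega> (\<lambda>x. G0 x $ i) (\<lambda>x. a (0, x))"
      if "test_fun ({..<T} \<times> \<Omega>) a" for a
      using Y(11)[unfolded trace0_vec_iff[OF Y(3,4,6)]] that by (simp add: ip_minus_left)
    \<comment> \<open>Membership in Y prescribes the value at \<open>T\<close> for
      \<open>\<phi>\<close>, not for its gradient. The spatial derivative is therefore moved to the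
      test function, the end condition of \<open>\<phi>\<close> is used, and the derivative is moved
      back.\<close>
    show "ip Q (\<lambda>p. G p $ i) s = ip Q (\<lambda>p. - Gt p $ i) (favg s)" if s: "test_fun Q s" for s
    proof -
      let ?d = "dx i s"
      have d: "test_fun Q ?d" by (rule test_fun_pderiv[OF s])
      have "ip Q (\<lambda>p. - Gt p $ i) (favg s) = ip Q \<phi>t (favg ?d)"
        using wgrad_test_fun[OF Y(2) Y(4) g(2) test_fun_favg[OF s]] by (simp add: ip_minus_left pderiv_favg[OF s])
      also have "\<dots> = - ip Q \<phi> (dt (favg ?d))"
        using Y(10) test_fun_favg[OF d] by (simp add: zero_at_T_iff)
      also have "ip Q \<phi> (dt (favg ?d)) = ip Q \<phi> ?d" by (rule ip_cong) (auto simp: dt_favg[OF d])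
      finally show ?thesis using g(1) s by (simp add: wgrad_def)
    qed
  qed
  then have "is_vbprim (\<lambda>p. - Gt p) G G0" by (simp add: is_vbprim_def)
  moreover have "wdiv G L" using Y weak_lap_iff[OF Y(1) Y(3) g(1)] by simp
  ultimately show ?thesis using Y by (simp add: admissible_def test_fun_zero)
qed

lemma dt_gradx_zero [simp]: 
  fixes p :: "real \<times> (real^'d)" shows "dt (\<lambda>p. 0) p = 0" "gradx (\<lambda>p. 0) p = 0"
  using adjoint_wave_zero[of p] by (simp_all add: adjoint_wave_def zero_prod_def)

text \<open>Each kind of test pair yields one part of \<open>inV0\<close>: scalar and vector test
  functions on \<open>{..<T} \<times> \<Omega>\<close> give the trace identities, those supported in
  \<open>Q\<close> the differential equations, and elements of Y the boundary condition.\<close>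

theorem wave_exists:
  assumes L: "L2 Q f" "L2 Q g" "L2 \<Omega> v0" "L2 \<Omega> \<sigma>0"
  obtains v \<sigma> where "inV0 T \<Omega> v \<sigma> f g v0 \<sigma>0"
    "nrm Q (\<lambda>p. (v p, \<sigma> p)) \<le> 2 * T * nrm Q (\<lambda>p. (f p, g p)) + 2 * sqrt T * nrm \<Omega> (\<lambda>x. (v0 x, \<sigma>0 x))"
proof -
  obtain v \<sigma> where v: "L2 Q v" "L2 Q \<sigma>"
    and bd: "nrm Q (\<lambda>p. (v p, \<sigma> p)) \<le> 2 * T * nrm Q (\<lambda>p. (f p, g p)) + 2 * sqrt T * nrm \<Omega> (\<lambda>x. (v0 x, \<sigma>0 x))"
    and eq: "\<And>w b \<tau> \<tau>0 \<delta>. admissible w b \<tau> \<tau>0 \<delta> \<Longrightarrow>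
       ip Q v (\<lambda>p. \<delta> p - dt w p) + ip Q \<sigma> (\<lambda>p. b p + gradx w p)
       = ip Q f w + ip Q g \<tau> + ip \<Omega> v0 (\<lambda>x. w (0, x)) + ip \<Omega> \<sigma>0 \<tau>0"
    by (rule wave_weak_solution[OF L]) blast
  have tv: "ip \<Omega> v0 (\<lambda>x. \<phi> (0, x)) = - ip Q v (dt \<phi>) + ip Q \<sigma> (gradx \<phi>) - ip Q f \<phi>"
    if "test_fun ({..<T} \<times> \<Omega>) \<phi>" for \<phi>
    using eq[OF admissible_scalar[OF that]] by (simp add: ip_minus_right)
  have ts: "ip \<Omega> (\<lambda>x. \<sigma>0 x $ i) (\<lambda>x. \<phi> (0, x)) = - ip Q (\<lambda>p. \<sigma> p $ i) (dt \<phi>) + ip Q v (dx i \<phi>) - ip Q (\<lambda>p. g p $ i) \<phi>"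
    if "test_fun ({..<T} \<times> \<Omega>) \<phi>" for \<phi> i
  proof -
    have ax: "ip S F (\<lambda>p. h p *\<^sub>R axis i 1) = ip S (\<lambda>p. F p $ i) h"
      for S and F :: "'z::euclidean_space \<Rightarrow> real^'d" and h :: "'z \<Rightarrow> real"
      by (simp add: ip_def inner_axis mult.commute)
    show ?thesis using eq[OF admissible_vector[OF that, of i]]
      by (simp add: ip_minus_right ax)
  qed
  have Q0: "test_fun ({..<T} \<times> \<Omega>) \<phi>" "\<And>x. \<phi> (0, x) = 0" if "test_fun Q \<phi>" for \<phi>
    using that test_fun_outside[OF that] by (auto simp: cyl_def elim!: test_fun_mono)
  have "is_dtdiv Q v \<sigma> f"
    unfolding is_dtdiv_iff[OF v]
  proof (intro allI impI)
    fix \<phi> assume t: "test_fun Q \<phi>"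
    show "ip Q f \<phi> = - ip Q v (dt \<phi>) + ip Q \<sigma> (gradx \<phi>)"
      using tv[OF Q0(1)[OF t]] by (simp add: Q0(2)[OF t])
  qed
  moreover have "is_dtgrad Q \<sigma> v g"
    unfolding is_dtgrad_iff[OF v L(2)]
  proof (intro allI impI)
    fix \<phi> i assume t: "test_fun Q \<phi>"
    show "ip Q (\<lambda>p. g p $ i) \<phi> = - ip Q (\<lambda>p. \<sigma> p $ i) (dt \<phi>) + ip Q v (dx i \<phi>)"
      using ts[OF Q0(1)[OF t], of i] by (simp add: Q0(2)[OF t])
  qed
  moreover have "is_trace0_v T \<Omega> v \<sigma> f v0" using tv by (simp add: is_trace0_v_iff v L)
  moreover have "is_trace0_sigma T \<Omega> \<sigma> v g \<sigma>0" using ts by (simp add: is_trace0_sigma_iff v L)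
  moreover have "intg Q (\<lambda>p. g p \<bullet> G p) + intg Q (\<lambda>p. \<sigma> p \<bullet> Gt p) - intg Q (\<lambda>p. v p * l p) + intg \<Omega> (\<lambda>x. \<sigma>0 x \<bullet> G0 x) = 0"
    if "inY T \<Omega> \<phi> \<phi>t \<phi>tt G Gt l G0" for \<phi> \<phi>t \<phi>tt G Gt l G0
    using eq[OF inY_admissible[OF that]] by (simp add: ip_def)
  ultimately have "inV0 T \<Omega> v \<sigma> f g v0 \<sigma>0" using v L by (simp add: inV0_def inV_def)
  then show thesis using that bd by blast
qed

section \<open>Uniqueness\<close>

lemma ip_dt_bavg: "test_fun Q s \<Longrightarrow> ip Q u (dt (bavg s)) = - ip Q u s"
proof -
  assume s: "test_fun Q s"
  have "ip Q u (dt (bavg s)) = ip Q u (\<lambda>p. - s p)" by (rule ip_cong) (auto simp: dt_bavg[OF s])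
  then show ?thesis by (simp add: ip_minus_right)
qed

lemma fprim_bavg: "is_fprim a A \<Longrightarrow> test_fun Q s \<Longrightarrow> ip Q A s = ip Q a (bavg s)"
  using is_fprimD(3)[OF _ test_fun_bavg] ip_dt_bavg by fastforce

lemma vfprim_gradx:
  assumes a: "is_vfprim a A" and s: "test_fun Q s"
  shows "ip Q A (gradx s) = ip Q a (gradx (bavg s))"
  unfolding ip_vec[OF is_vfprimD(2)[OF a] L2_gradx[OF s]] ip_vec[OF is_vfprimD(1)[OF a] L2_gradx[OF test_fun_bavg[OF s]]]
  by (rule sum.cong) (simp_all add: gradx_nth pderiv_bavg[OF s] fprim_bavg[OF is_vfprimD(3)[OF a] test_fun_pderiv[OF s]])

lemma vbprim_gradx:
  assumes b: "is_vbprim b \<tau> \<tau>0" and s: "test_fun Q s"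
  shows "ip Q \<tau> (gradx s) = ip Q b (gradx (favg s))"
  unfolding ip_vec[OF is_vbprimD(2)[OF b] L2_gradx[OF s]] ip_vec[OF is_vbprimD(1)[OF b] L2_gradx[OF test_fun_favg[OF s]]]
  by (rule sum.cong) (simp_all add: gradx_nth pderiv_favg[OF s] is_bprimD(5)[OF is_vbprimD(4)[OF b] test_fun_pderiv[OF s]])

text \<open>Time averages commute with spatial derivatives, so testing the primitives with
  \<open>s\<close> amounts to testing the original fields with \<open>favg s\<close>. This function
  need not vanish at \<open>T\<close>, which \<open>wdiv_test_fun\<close> permits.\<close>

lemma wdiv_bprim:
  assumes d: "wdiv b d" and b: "is_vbprim b \<tau> \<tau>0" and d1: "is_bprim d d1 d10"
  shows "wdiv \<tau> d1"
  unfolding wdiv_def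
proof (intro allI impI)
  fix s assume s: "test_fun Q s"
  show "ip Q d1 s = - ip Q \<tau> (gradx s)"
    using wdiv_test_fun[OF is_vbprimD(1)[OF b] is_bprimD(1)[OF d1] d test_fun_favg[OF s]]
      vbprim_gradx[OF b s] is_bprimD(5)[OF d1 s] by simp
qed

lemma wdiv_fprim:
  assumes d: "wdiv a d" and a: "is_vfprim a A" and d1: "is_fprim d d1"
  shows "wdiv A d1"
  unfolding wdiv_def
proof (intro allI impI)
  fix s assume s: "test_fun Q s"
  show "ip Q d1 s = - ip Q A (gradx s)"
    using wdiv_test_fun[OF is_vfprimD(1)[OF a] is_fprimD(1)[OF d1] d test_fun_bavg[OF s]]
      vfprim_gradx[OF a s] fprim_bavg[OF d1 s] by simp
qed

lemma wgrad_fprim: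
  assumes g: "wgrad u U" and u: "is_fprim u u1" and U: "is_vfprim U U1"
  shows "wgrad u1 U1"
  unfolding wgrad_def
proof (intro allI impI)
  fix s i assume s: "test_fun Q s"
  show "ip Q (\<lambda>p. U1 p $ i) s = - ip Q u1 (dx i s)"
    using wgrad_test_fun[OF is_fprimD(1)[OF u] is_vfprimD(1)[OF U] g test_fun_bavg[OF s], of i]
      fprim_bavg[OF is_vfprimD(3)[OF U] s, of i] fprim_bavg[OF u test_fun_pderiv[OF s, of "(0, axis i 1)"]]
    by (simp add: pderiv_bavg[OF s])
qed

lemma zero_bc_minus:
  assumes "zero_bc Q u U" shows "zero_bc Q (\<lambda>p. - u p) (\<lambda>p. - U p)"
proof -
  obtain s where s: "\<And>n. test_fun Q (s n)"
    "(\<lambda>n. intg Q (\<lambda>p. (s n p - u p)\<^sup>2 + (norm (gradx (s n) p - U p))\<^sup>2)) \<longlonglongrightarrow> 0"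
    using assms unfolding zero_bc_def by blast
  have g: "gradx (\<lambda>p. - s n p) p = - gradx (s n) p" for n p
    using pderiv_scale[OF test_fun_smooth[OF s(1)], of _ "-1"] by (simp add: vec_eq_iff gradx_nth)
  have "(norm (- gradx (s n) p - - U p)) = norm (gradx (s n) p - U p)" for n p
    by (metis minus_diff_minus norm_minus_cancel)
  moreover have "(- s n p - - u p)\<^sup>2 = (s n p - u p)\<^sup>2" for n p by (simp add: power2_commute)
  ultimately have "(\<lambda>n. intg Q (\<lambda>p. (- s n p - - u p)\<^sup>2 + (norm (gradx (\<lambda>p. - s n p) p - - U p))\<^sup>2)) \<longlonglongrightarrow> 0"
    using s(2) by (simp only: g)
  moreover have "test_fun Q (\<lambda>p. - s n p)" for n using test_fun_scale[OF s(1), of "-1"] by simp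
  ultimately show ?thesis unfolding zero_bc_def by (intro exI[of _ "\<lambda>n p. - s n p"]) auto
qed

text \<open>Makes T - t times the second primitive of \<open>v\<close>, the multiplier of the energy
  argument, a function with zero boundary values.\<close>

lemma zero_bc_time':
  assumes L: "L2 Q u" "L2 Q U" and z: "zero_bc Q u U"
  shows "zero_bc Q (\<lambda>p. (T - fst p) * u p) (\<lambda>p. (T - fst p) *\<^sub>R U p)"
proof -
  obtain s where s: "\<And>n. test_fun Q (s n)" "L2conv Q s u" "L2conv Q (\<lambda>n. gradx (s n)) U"
    using zero_bcE[OF L z] by metis
  have sm: "smooth_fun (\<lambda>t::real. T - t)" using smooth_fun_affine[of "-1::real" T] by simp
  have smf: "smooth_fun (\<lambda>p. T - fst p :: real)"
    using smooth_fun_compose_affine[OF sm bounded_linear_fst, of 0] by simp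
  show ?thesis
  proof (rule zero_bcI_conv)
    show "test_fun Q (\<lambda>p. (T - fst p) * s n p)" for n by (rule test_fun_smooth_mult[OF smf s(1)])
    show "L2conv Q (\<lambda>n p. (T - fst p) * s n p) (\<lambda>p. (T - fst p) * u p)"
      using L2conv_bounded_mult[OF s(2) time_weight(2,4)] by simp
    have "gradx (\<lambda>p. (T - fst p) * s n p) = (\<lambda>p. (T - fst p) *\<^sub>R gradx (s n) p)" for n
      by (rule ext) (simp add: gradx_mult[OF smf test_fun_smooth[OF s(1)]] gradx_time_fun[OF sm])
    then show "L2conv Q (\<lambda>n. gradx (\<lambda>p. (T - fst p) * s n p)) (\<lambda>p. (T - fst p) *\<^sub>R U p)"
      using L2conv_bounded_mult[OF s(3) time_weight(2,4)] by simp
  qed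
qed

lemma zero_bc_AE_cong:
  assumes z: "zero_bc Q u U" and L: "L2 Q u" "L2 Q U" "L2 Q u'" "L2 Q U'"
    and "AE p in lebesgue_on Q. u p = u' p" "AE p in lebesgue_on Q. U p = U' p"
  shows "zero_bc Q u' U'"
proof -
  obtain s where s: "\<And>n. test_fun Q (s n)" "L2conv Q s u" "L2conv Q (\<lambda>n. gradx (s n)) U"
    using zero_bcE[OF L(1,2) z] by metis
  show ?thesis
    by (rule zero_bcI_conv[OF s(1) L2conv_AE_cong[OF s(2) assms(6) L(3)] L2conv_AE_cong[OF s(3) assms(7) L(4)]])
qed

text \<open>Riesz representation in the closure of \<open>{(s, \<nabla>s)}\<close>, that is, in \<open>L\<^sup>2(J; H\<^sup>1\<^sub>0(\<Omega>))\<close>.\<close>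

lemma zero_bc_Riesz:
  assumes L: "L2 Q a" "L2 Q B"
  obtains u U where "L2 Q u" "L2 Q U" "zero_bc Q u U"
    "\<And>s. test_fun Q s \<Longrightarrow> ip Q u s + ip Q U (gradx s) = ip Q a s + ip Q B (gradx s)"
proof -
  define E where "E s p = (s p, gradx s p)" for s :: "real \<times> (real^'d) \<Rightarrow> real" and p
  have EL: "L2 Q (E s)" if "test_fun Q s" for s
    unfolding E_def[abs_def] by (intro L2_Pair L2_Q_test[OF that] L2_gradx[OF that])
  have aB: "L2 Q (\<lambda>p. (a p, B p))" by (rule L2_Pair[OF L])
  define Rel where "Rel = {(E s, ip Q (\<lambda>p. (a p, B p)) (E s)) | s. test_fun Q s}"
  have lin: "(\<lambda>p. c *\<^sub>R x p + d *\<^sub>R y p, c * r + d * q) \<in> Rel" if xr: "(x, r) \<in> Rel" and yq: "(y, q) \<in> Rel" for x r y q c d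
  proof -
    obtain s where s: "test_fun Q s" "x = E s" "r = ip Q (\<lambda>p. (a p, B p)) (E s)" using xr unfolding Rel_def by blast
    obtain t where t: "test_fun Q t" "y = E t" "q = ip Q (\<lambda>p. (a p, B p)) (E t)" using yq unfolding Rel_def by blast
    have e: "(\<lambda>p. c *\<^sub>R x p + d *\<^sub>R y p) = E (\<lambda>p. c * s p + d * t p)"
      by (simp add: s t E_def fun_eq_iff vec_eq_iff gradx_nth pderiv_lin[OF test_fun_smooth[OF s(1)] test_fun_smooth[OF t(1)]])
    have "c * r + d * q = ip Q (\<lambda>p. (a p, B p)) (\<lambda>p. c *\<^sub>R x p + d *\<^sub>R y p)"
      using ip_lin_right[OF EL[OF s(1)] EL[OF t(1)] aB, of c d] by (simp add: s t)
    then show ?thesis unfolding e Rel_def using test_fun_lin[OF s(1) t(1), of c d] by blast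
  qed
  obtain u X where u: "L2 Q u" "\<And>x r. (x, r) \<in> Rel \<Longrightarrow> ip Q u x = r" "\<And>n. X n \<in> Rel" "L2conv Q (\<lambda>n. fst (X n)) u"
  proof (rule Riesz_linear_relation[of Rel Q "nrm Q (\<lambda>p. (a p, B p))"])
    have "E (\<lambda>p. 0) = (\<lambda>p. 0)" by (simp add: E_def fun_eq_iff zero_prod_def)
    then show "((\<lambda>p. 0), 0) \<in> Rel" unfolding Rel_def using test_fun_zero[of Q] by (auto intro!: exI[of _ "\<lambda>p. 0"])
    show "(\<lambda>p. x p + y p, r + s) \<in> Rel" if "(x, r) \<in> Rel" "(y, s) \<in> Rel" for x r y s
      using lin[OF that, of 1 1] by simp
    show "(\<lambda>p. c *\<^sub>R x p, c * r) \<in> Rel" if "(x, r) \<in> Rel" for x r c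
      using lin[OF that that, of c 0] by simp
    show "L2 Q x" if "(x, r) \<in> Rel" for x r using that EL unfolding Rel_def by blast
    show "\<bar>r\<bar> \<le> nrm Q (\<lambda>p. (a p, B p)) * nrm Q x" if "(x, r) \<in> Rel" for x r
      using that ip_Cauchy_Schwarz[OF aB EL] unfolding Rel_def by blast
  qed blast
  \<comment> \<open>The minimising sequence of the Riesz argument consists of pairs (s, \<nabla>s),
    exactly what membership in the closure asks for.\<close>
  have "\<exists>s. test_fun Q s \<and> fst (X n) = E s" for n using u(3)[of n] unfolding Rel_def by auto
  then obtain s where s: "\<And>n. test_fun Q (s n)" "\<And>n. fst (X n) = E (s n)" by metis
  show thesis
  proof (rule that[of "\<lambda>p. fst (u p)" "\<lambda>p. snd (u p)"])
    show fs: "L2 Q (\<lambda>p. fst (u p))" "L2 Q (\<lambda>p. snd (u p))" by (intro L2_fst L2_snd u(1))+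
    show "zero_bc Q (\<lambda>p. fst (u p)) (\<lambda>p. snd (u p))"
      using L2conv_fst_snd[OF u(4)] by (intro zero_bcI_conv[OF s(1)]) (simp_all add: s(2) E_def)
    fix t assume t: "test_fun Q t"
    have "ip Q (\<lambda>p. (fst (u p), snd (u p))) (E t) = ip Q (\<lambda>p. (a p, B p)) (E t)"
      using u(2)[of "E t" "ip Q (\<lambda>p. (a p, B p)) (E t)"] t unfolding Rel_def by auto
    then show "ip Q (\<lambda>p. fst (u p)) t + ip Q (\<lambda>p. snd (u p)) (gradx t) = ip Q a t + ip Q B (gradx t)"
      unfolding E_def[abs_def] using ip_Pair[OF fs L2_Q_test[OF t] L2_gradx[OF t]] ip_Pair[OF L L2_Q_test[OF t] L2_gradx[OF t]] by simp
  qed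
qed

text \<open>Integrated twice backwards from \<open>T\<close>, \<open>\<psi>\<close> acquires two
  time derivatives and both end conditions, while gradient, divergence and boundary values pass
  through the integration. Elements of Y thus arise from solvability in space alone. The signs
  reflect that a backward primitive has minus its integrand as time derivative.\<close>

lemma inY_double_primitive:
  assumes z: "zero_bc Q \<psi> \<Psi>" and d: "wdiv \<Psi> l"
    and \<psi>: "is_bprim \<psi> \<psi>1 \<psi>10" "is_bprim \<psi>1 \<phi> \<phi>0"
    and \<Psi>: "is_vbprim \<Psi> \<Psi>1 \<Psi>10" "is_vbprim \<Psi>1 G G0"
    and l: "is_bprim l l1 l10" "is_bprim l1 l2 l20"
  shows "inY T \<Omega> \<phi> (\<lambda>p. - \<psi>1 p) \<psi> G (\<lambda>p. - \<Psi>1 p) l2 G0"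
proof -
  note L = is_bprimD(1,2)[OF \<psi>(1)] is_bprimD(2)[OF \<psi>(2)] is_vbprimD(1,2)[OF \<Psi>(1)] is_vbprimD(2,3)[OF \<Psi>(2)] is_bprimD(2)[OF l(2)]
  have z1: "zero_bc Q \<psi>1 \<Psi>1" by (rule zero_bc_bprim[OF z \<psi>(1) \<Psi>(1)])
  have zm: "zero_bc Q (\<lambda>p. - \<psi>1 p) (\<lambda>p. - \<Psi>1 p)" by (rule zero_bc_minus[OF z1])
  have z2: "zero_bc Q \<phi> G" by (rule zero_bc_bprim[OF z1 \<psi>(2) \<Psi>(2)])
  have g2: "wgrad \<phi> G" by (rule zero_bc_wgrad[OF L(3,6) z2])
  have g1: "wgrad (\<lambda>p. - \<psi>1 p) (\<lambda>p. - \<Psi>1 p)" by (rule zero_bc_wgrad[OF L2_minus[OF L(2)] L2_minus[OF L(5)] zm])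
  \<comment> \<open>The test function vanishes near time 0, so the initial term drops, and by
    \<open>bprim_test_all\<close> there is no term at \<open>T\<close>. One identity thus yields
    both the weak time derivative and the end condition.\<close>
  have bt: "ip Q b a = ip Q \<tau> (dt a)" if b: "is_bprim b \<tau> \<tau>0" and a: "test_fun ({0<..} \<times> \<Omega>) a" for b \<tau> \<tau>0 a
  proof -
    have "a (0, x) = 0" for x by (rule test_fun_outside[OF a]) simp
    then show ?thesis using bprim_test_all[OF b a] by simp
  qed
  have Qs: "test_fun ({0<..} \<times> \<Omega>) a" if "test_fun Q a" for a
    using that by (rule test_fun_mono) (auto simp: cyl_def)
  have "wdiv G l2" by (rule wdiv_bprim[OF wdiv_bprim[OF d \<Psi>(1) l(1)] \<Psi>(2) l(2)])
  then have "weak_lap Q \<phi> l2" using weak_lap_iff[OF L(3,6) g2] by simp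
  moreover have "weak_dt Q \<phi> (\<lambda>p. - \<psi>1 p)" "zero_at_T T \<Omega> \<phi> (\<lambda>p. - \<psi>1 p)"
    using bt[OF \<psi>(2)] Qs by (auto simp: weak_dt_iff zero_at_T_iff ip_minus_left)
  moreover have "weak_dt Q (\<lambda>p. - \<psi>1 p) \<psi>" "zero_at_T T \<Omega> (\<lambda>p. - \<psi>1 p) \<psi>"
    using bt[OF \<psi>(1)] Qs by (auto simp: weak_dt_iff zero_at_T_iff ip_minus_left)
  moreover have "trace0_vec T \<Omega> G (\<lambda>p. - \<Psi>1 p) G0"
    using is_bprimD(4)[OF is_vbprimD(4)[OF \<Psi>(2)]] by (simp add: trace0_vec_iff L L2_minus ip_minus_left)
  moreover have "weak_grad Q \<phi> G" "weak_grad Q (\<lambda>p. - \<psi>1 p) (\<lambda>p. - \<Psi>1 p)"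
    using g1 g2 L by (auto simp: wgrad_iff L2_minus)
  ultimately show ?thesis unfolding inY_def using L z2 zm by (auto simp: L2_minus)
qed

text \<open>The weak boundary condition passes to time primitives: split \<open>(V, \<Sigma>)\<close> into its projection onto
  \<open>L\<^sup>2(J; H\<^sup>1\<^sub>0(\<Omega>))\<close> and a remainder \<open>(r, \<rho>)\<close>; testing with twice the backward time primitive of the
  solution \<open>\<psi>\<close> of \<open>\<psi> - \<Delta>\<psi> = r\<close>, \<open>\<psi> = 0\<close> on the boundary, yields \<open>r = 0\<close>.\<close>

lemma zero_bc_of_weak_boundary_condition:
  assumes v: "is_fprim v V" "is_fprim V V'" and s: "is_vfprim \<sigma> S" and g: "wgrad V' S"
    and bc: "\<And>\<phi> \<phi>t \<phi>tt G Gt l G0. inY T \<Omega> \<phi> \<phi>t \<phi>tt G Gt l G0 \<Longrightarrow> ip Q \<sigma> Gt = ip Q v l"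
  shows "zero_bc Q V' S"
proof -
  note L = is_fprimD(2)[OF v(2)] is_vfprimD(2)[OF s]
  obtain V1 \<sigma>1 where V1: "L2 Q V1" "L2 Q \<sigma>1" "zero_bc Q V1 \<sigma>1"
    "\<And>t. test_fun Q t \<Longrightarrow> ip Q V1 t + ip Q \<sigma>1 (gradx t) = ip Q V' t + ip Q S (gradx t)"
    by (rule zero_bc_Riesz[OF L]) blast
  define r where "r p = V' p - V1 p" for p
  define \<rho> where "\<rho> p = S p - \<sigma>1 p" for p
  have rL: "L2 Q r" "L2 Q \<rho>" unfolding r_def[abs_def] \<rho>_def[abs_def] by (intro L2_diff L V1)+
  \<comment> \<open>Orthogonality of the remainder to all pairs (s, \<nabla>s) says exactly that
    \<open>\<rho>\<close> has weak divergence \<open>r\<close>.\<close>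
  have dr: "wdiv \<rho> r" unfolding wdiv_def r_def[abs_def] \<rho>_def[abs_def]
    using V1(4) by (auto simp: ip_diff_left L V1(1,2) L2_Q_test L2_gradx algebra_simps)
  \<comment> \<open>With data (r, 0) the Riesz lemma is weak solvability of the elliptic problem,
    time being a mere parameter.\<close>
  obtain \<psi> \<Psi> where p: "L2 Q \<psi>" "L2 Q \<Psi>" "zero_bc Q \<psi> \<Psi>"
    "\<And>t. test_fun Q t \<Longrightarrow> ip Q \<psi> t + ip Q \<Psi> (gradx t) = ip Q r t + ip Q (\<lambda>p. 0) (gradx t)"
    by (rule zero_bc_Riesz[OF rL(1) L2_zero]) blast
  have lL: "L2 Q (\<lambda>p. \<psi> p - r p)" by (rule L2_diff[OF p(1) rL(1)])
  have dp: "wdiv \<Psi> (\<lambda>p. \<psi> p - r p)" unfolding wdiv_def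
    using p(4) by (auto simp: ip_diff_left p(1) rL(1) L2_Q_test algebra_simps)
  obtain \<psi>1 \<psi>10 where a1: "is_bprim \<psi> \<psi>1 \<psi>10" using bprim_exists[OF p(1)] by metis
  obtain \<phi> \<phi>0 where a2: "is_bprim \<psi>1 \<phi> \<phi>0" using bprim_exists[OF is_bprimD(2)[OF a1]] by metis
  obtain \<Psi>1 \<Psi>10 where b1: "is_vbprim \<Psi> \<Psi>1 \<Psi>10" using vbprim_exists[OF p(2)] by metis
  obtain G G0 where b2: "is_vbprim \<Psi>1 G G0" using vbprim_exists[OF is_vbprimD(2)[OF b1]] by metis
  obtain l1 l10 where l1: "is_bprim (\<lambda>p. \<psi> p - r p) l1 l10" using bprim_exists[OF lL] by metis
  obtain l2 l20 where l2: "is_bprim l1 l2 l20" using bprim_exists[OF is_bprimD(2)[OF l1]] by metis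
  \<comment> \<open>Duality trades each backward primitive of a test quantity for a forward
    primitive of the solution: one for \<open>\<sigma>\<close>, two for \<open>v\<close>. This is
    why \<open>V'\<close> and \<open>S\<close> come with different numbers of integrations.\<close>
  have "ip Q \<sigma> (\<lambda>p. - \<Psi>1 p) = ip Q v l2"
    by (rule bc[OF inY_double_primitive[OF p(3) dp a1 a2 b1 b2 l1 l2]])
  moreover have "ip Q S \<Psi> = ip Q \<sigma> \<Psi>1" by (rule vfprim_vbprim_dual[OF s b1])
  moreover have "ip Q V l1 = ip Q v l2" by (rule fprim_bprim_dual[OF v(1) l2])
  moreover have "ip Q V' (\<lambda>p. \<psi> p - r p) = ip Q V l1" by (rule fprim_bprim_dual[OF v(2) l1])
  ultimately have "- ip Q S \<Psi> = ip Q V' (\<lambda>p. \<psi> p - r p)" by (simp add: ip_minus_right)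
  \<comment> \<open>For \<open>V1\<close>, Green's formula holds by its zero boundary values; for
    \<open>V'\<close>, it is what the weak boundary condition has just supplied.\<close>
  moreover have "ip Q (\<lambda>p. \<psi> p - r p) V1 = - ip Q \<Psi> \<sigma>1"
    by (rule wdiv_zero_bc[OF p(2) lL V1(1,2) dp V1(3)])
  moreover have "ip Q r \<psi> = - ip Q \<rho> \<Psi>"
    by (rule wdiv_zero_bc[OF rL(2,1) p(1,2) dr p(3)])
  moreover have "ip Q \<rho> \<Psi> = ip Q S \<Psi> - ip Q \<sigma>1 \<Psi>"
    unfolding \<rho>_def[abs_def] by (rule ip_diff_left[OF L(2) V1(2) p(2)])
  moreover have "ip Q r (\<lambda>p. \<psi> p - r p) = ip Q V' (\<lambda>p. \<psi> p - r p) - ip Q V1 (\<lambda>p. \<psi> p - r p)"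
    unfolding r_def[abs_def] by (rule ip_diff_left[OF L(1) V1(1) lL[unfolded r_def]])
  moreover have "ip Q r (\<lambda>p. \<psi> p - r p) = ip Q r \<psi> - ip Q r r"
    by (rule ip_diff_right[OF p(1) rL(1) rL(1)])
  \<comment> \<open>The difference of the two Green formulas is (r, \<psi> - r) = - (\<rho>,
    \<Psi>), and the right-hand side equals (r, \<psi>).\<close>
  ultimately have "ip Q r r = 0"
    by (simp add: ip_commute[of Q V1] ip_commute[of Q \<Psi>])
  then have r0: "AE p in lebesgue_on Q. r p = 0" by (rule ip_self_zero_AE[OF rL(1)])
  \<comment> \<open>\<open>\<rho>\<close> is the weak gradient of \<open>r\<close>, as a difference
    of two gradients, and vanishes with it.\<close>
  have "AE p in lebesgue_on Q. \<rho> p $ i = 0" for i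
  proof (rule test_fun_orthogonal_AE[OF open_Q bounded_Q L2_nth[OF rL(2)]])
    fix t assume t: "test_fun Q t"
    note tL = L2_Q_test[OF t] L2_Q_test[OF test_fun_pderiv[OF t, of "(0, axis i 1)"]]
    have "wgrad V1 \<sigma>1" by (rule zero_bc_wgrad[OF V1(1-3)])
    then have "ip Q (\<lambda>p. \<rho> p $ i) t = - (ip Q V' (dx i t) - ip Q V1 (dx i t))"
      using g t tL L V1(1,2) unfolding wgrad_def by (simp add: \<rho>_def ip_diff_left L2_nth)
    also have "\<dots> = - ip Q r (dx i t)"
      using tL L V1(1,2) by (simp add: r_def[abs_def] ip_diff_left)
    also have "\<dots> = 0" using ip_AE_cong[OF rL(1) L2_zero tL(2) r0] by simp
    finally show "ip Q (\<lambda>p. \<rho> p $ i) t = 0" .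
  qed
  then have "AE p in lebesgue_on Q. \<forall>i\<in>UNIV. \<rho> p $ i = 0" by (intro AE_finite_allI) auto
  then have "AE p in lebesgue_on Q. \<sigma>1 p = S p" by eventually_elim (simp add: \<rho>_def vec_eq_iff)
  moreover have "AE p in lebesgue_on Q. V1 p = V' p" using r0 by eventually_elim (simp add: r_def)
  ultimately show ?thesis using zero_bc_AE_cong[OF V1(3,1,2) L] by simp
qed

text \<open>\<open>a\<close> is recovered as the time derivative of \<open>A\<close> by pairing with
  test functions of \<open>Q\<close>.\<close>

lemma fprim_zero_AE:
  assumes "is_fprim a A" "AE p in lebesgue_on Q. A p = 0" shows "AE p in lebesgue_on Q. a p = 0"
proof (rule test_fun_orthogonal_AE[OF open_Q bounded_Q is_fprimD(1)[OF assms(1)]])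
  fix s assume s: "test_fun Q s"
  have t: "test_fun ({..<T} \<times> \<Omega>) s" by (rule test_fun_mono[OF s]) (auto simp: cyl_def)
  have "ip Q A (dt s) = 0" using ip_AE_cong[OF is_fprimD(2)[OF assms(1)] L2_zero L2_dt[OF s] assms(2)] by simp
  then show "ip Q a s = 0" using is_fprimD(3)[OF assms(1) t] by simp
qed

lemma vfprim_zero_AE:
  assumes "is_vfprim a A" "AE p in lebesgue_on Q. A p = 0" shows "AE p in lebesgue_on Q. a p = 0"
proof -
  have "AE p in lebesgue_on Q. a p $ i = 0" for i
    by (rule fprim_zero_AE[OF is_vfprimD(3)[OF assms(1)]]) (use assms(2) in auto)
  then have "AE p in lebesgue_on Q. \<forall>i\<in>UNIV. a p $ i = 0" by (intro AE_finite_allI) auto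
  then show ?thesis by eventually_elim (simp add: vec_eq_iff)
qed

text \<open>The test functions in both equations may be nonzero at time 0, which encodes zero
  initial values, so the equations can be integrated from 0. For the second primitives this gives V
  = div S' and S = \<nabla>V', with all terms square-integrable.\<close>

theorem homogeneous_wave_zero:
  assumes L: "L2 Q v" "L2 Q \<sigma>"
    and e1: "\<And>\<phi>. test_fun ({..<T} \<times> \<Omega>) \<phi> \<Longrightarrow> ip Q \<sigma> (gradx \<phi>) = ip Q v (dt \<phi>)"
    and e2: "\<And>\<phi> i. test_fun ({..<T} \<times> \<Omega>) \<phi> \<Longrightarrow> ip Q v (dx i \<phi>) = ip Q (\<lambda>p. \<sigma> p $ i) (dt \<phi>)"
    and bc: "\<And>\<phi> \<phi>t \<phi>tt G Gt l G0. inY T \<Omega> \<phi> \<phi>t \<phi>tt G Gt l G0 \<Longrightarrow> ip Q \<sigma> Gt = ip Q v l"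
  shows "AE p in lebesgue_on Q. v p = 0" "AE p in lebesgue_on Q. \<sigma> p = 0"
proof -
  obtain V where V: "is_fprim v V" using fprim_exists[OF L(1)] by metis
  obtain V' where V': "is_fprim V V'" using fprim_exists[OF is_fprimD(2)[OF V]] by metis
  obtain S where S: "is_vfprim \<sigma> S" using vfprim_exists[OF L(2)] by metis
  obtain S' where S': "is_vfprim S S'" using vfprim_exists[OF is_vfprimD(2)[OF S]] by metis
  note LL = is_fprimD(2)[OF V] is_fprimD(2)[OF V'] is_vfprimD(2)[OF S] is_vfprimD(2)[OF S']
  \<comment> \<open>Testing with a backward average absorbs the time derivative: integrated once,
    the second equation makes \<open>\<sigma>\<close> the gradient of \<open>V\<close>, and below
    the first makes \<open>v\<close> the divergence of \<open>S\<close>.\<close>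
  have gV: "wgrad V \<sigma>" unfolding wgrad_def
  proof (intro allI impI)
    fix s i assume s: "test_fun Q s"
    show "ip Q (\<lambda>p. \<sigma> p $ i) s = - ip Q V (dx i s)"
      using e2[OF test_fun_bavg[OF s], of i] fprim_bavg[OF V test_fun_pderiv[OF s, of "(0, axis i 1)"]]
      by (simp add: pderiv_bavg[OF s] ip_dt_bavg[OF s])
  qed
  have gV': "wgrad V' S" by (rule wgrad_fprim[OF gV V' S])
  have dS: "wdiv S v" unfolding wdiv_def
    using e1[OF test_fun_bavg] vfprim_gradx[OF S] ip_dt_bavg by simp
  have dS': "wdiv S' V" by (rule wdiv_fprim[OF dS S' V])
  have "zero_bc Q V' S" by (rule zero_bc_of_weak_boundary_condition[OF V V' S gV' bc])
  then have z: "zero_bc Q (\<lambda>p. (T - fst p) * V' p) (\<lambda>p. (T - fst p) *\<^sub>R S p)"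
    by (rule zero_bc_time'[OF LL(2,3)])
  \<comment> \<open>The spatial terms are skew: Green's formula turns one into minus the other, so
    the two weighted time energies, each half a squared norm, add up to zero.\<close>
  have "ip Q V (\<lambda>p. (T - fst p) * V' p) = - ip Q S' (\<lambda>p. (T - fst p) *\<^sub>R S p)"
    by (rule wdiv_zero_bc[OF LL(4,1) L2_time'[OF LL(2)] L2_time_vec(2)[OF LL(3)] dS' z])
  moreover have "ip Q S' (\<lambda>p. (T - fst p) *\<^sub>R S p) = ip Q (\<lambda>p. (T - fst p) *\<^sub>R S' p) S"
    by (simp add: ip_def)
  ultimately have "ip Q V' V' + ip Q S' S' = 0"
    using fprim_energy[OF V'] vfprim_energy[OF S'] by (simp add: ip_commute[of Q V])
  then have "ip Q V' V' = 0" "ip Q S' S' = 0"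
    using ip_self_nonneg[of Q V'] ip_self_nonneg[of Q S'] by linarith+
  then have "AE p in lebesgue_on Q. V' p = 0" "AE p in lebesgue_on Q. S' p = 0"
    using LL by (auto intro: ip_self_zero_AE)
  then show "AE p in lebesgue_on Q. v p = 0" "AE p in lebesgue_on Q. \<sigma> p = 0"
    using fprim_zero_AE[OF V fprim_zero_AE[OF V']] vfprim_zero_AE[OF S vfprim_zero_AE[OF S']] by auto
qed

text \<open>The trace identities carry the equations and the initial values together, so only these
  and the boundary condition are subtracted; the common data cancel.\<close>

theorem inV0_unique:
  assumes 1: "inV0 T \<Omega> v \<sigma> f g v0 \<sigma>0" and 2: "inV0 T \<Omega> v' \<sigma>' f g v0 \<sigma>0"
  shows "AE p in lebesgue_on Q. v p = v' p" "AE p in lebesgue_on Q. \<sigma> p = \<sigma>' p"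
proof -
  have L: "L2 Q v" "L2 Q \<sigma>" "L2 Q v'" "L2 Q \<sigma>'" "L2 Q f" "L2 Q g" "L2 \<Omega> v0" "L2 \<Omega> \<sigma>0"
    using 1 2 by (auto simp: inV0_def inV_def)
  have tr: "is_trace0_v T \<Omega> v \<sigma> f v0" "is_trace0_v T \<Omega> v' \<sigma>' f v0"
    "is_trace0_sigma T \<Omega> \<sigma> v g \<sigma>0" "is_trace0_sigma T \<Omega> \<sigma>' v' g \<sigma>0"
    using 1 2 by (auto simp: inV0_def inV_def)
  have L': "L2 Q (\<lambda>p. v p - v' p)" "L2 Q (\<lambda>p. \<sigma> p - \<sigma>' p)" by (intro L2_diff L)+
  have e1: "ip Q (\<lambda>p. \<sigma> p - \<sigma>' p) (gradx \<phi>) = ip Q (\<lambda>p. v p - v' p) (dt \<phi>)"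
    if t: "test_fun ({..<T} \<times> \<Omega>) \<phi>" for \<phi>
  proof -
    have "ip \<Omega> v0 (\<lambda>x. \<phi> (0, x)) = - ip Q v (dt \<phi>) + ip Q \<sigma> (gradx \<phi>) - ip Q f \<phi>"
      "ip \<Omega> v0 (\<lambda>x. \<phi> (0, x)) = - ip Q v' (dt \<phi>) + ip Q \<sigma>' (gradx \<phi>) - ip Q f \<phi>"
      using tr(1,2) t by (simp_all add: is_trace0_v_iff L)
    then show ?thesis by (simp add: ip_diff_left L L2_dt[OF t] L2_gradx[OF t])
  qed
  have e2: "ip Q (\<lambda>p. v p - v' p) (dx i \<phi>) = ip Q (\<lambda>p. (\<sigma> p - \<sigma>' p) $ i) (dt \<phi>)"
    if t: "test_fun ({..<T} \<times> \<Omega>) \<phi>" for \<phi> i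
  proof -
    have "ip \<Omega> (\<lambda>x. \<sigma>0 x $ i) (\<lambda>x. \<phi> (0, x)) = - ip Q (\<lambda>p. \<sigma> p $ i) (dt \<phi>) + ip Q v (dx i \<phi>) - ip Q (\<lambda>p. g p $ i) \<phi>"
      "ip \<Omega> (\<lambda>x. \<sigma>0 x $ i) (\<lambda>x. \<phi> (0, x)) = - ip Q (\<lambda>p. \<sigma>' p $ i) (dt \<phi>) + ip Q v' (dx i \<phi>) - ip Q (\<lambda>p. g p $ i) \<phi>"
      using tr(3,4) t by (simp_all add: is_trace0_sigma_iff L)
    then show ?thesis by (simp add: ip_diff_left L L2_nth L2_dt[OF t] L2_Q_test[OF test_fun_pderiv[OF t]])
  qed
  have e3: "ip Q (\<lambda>p. \<sigma> p - \<sigma>' p) Gt = ip Q (\<lambda>p. v p - v' p) l"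
    if y: "inY T \<Omega> \<phi> \<phi>t \<phi>tt G Gt l G0" for \<phi> \<phi>t \<phi>tt G Gt l G0
  proof -
    have "L2 Q Gt" "L2 Q l" using y by (auto simp: inY_def)
    moreover have "ip Q g G + ip Q \<sigma> Gt - ip Q v l + ip \<Omega> \<sigma>0 G0 = 0" "ip Q g G + ip Q \<sigma>' Gt - ip Q v' l + ip \<Omega> \<sigma>0 G0 = 0"
      using 1 2 y unfolding inV0_def ip_def inner_real_def by blast+
    ultimately show ?thesis by (simp add: ip_diff_left L)
  qed
  have "AE p in lebesgue_on Q. v p - v' p = 0" "AE p in lebesgue_on Q. \<sigma> p - \<sigma>' p = 0"
    by (rule homogeneous_wave_zero[OF L' e1 e2 e3]; assumption)+
  then show "AE p in lebesgue_on Q. v p = v' p" "AE p in lebesgue_on Q. \<sigma> p = \<sigma>' p" by auto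
qed

section \<open>Norms and the a priori estimate\<close>

lemma normA_sq:
  "(normA T \<Omega> f g v0 \<sigma>0)\<^sup>2 = (nrm Q f)\<^sup>2 + (nrm Q g)\<^sup>2 + (nrm \<Omega> v0)\<^sup>2 + (nrm \<Omega> \<sigma>0)\<^sup>2"
proof -
  have "normA T \<Omega> f g v0 \<sigma>0 = sqrt ((nrm Q f)\<^sup>2 + (nrm Q g)\<^sup>2 + (nrm \<Omega> v0)\<^sup>2 + (nrm \<Omega> \<sigma>0)\<^sup>2)"
    unfolding normA_def nrm_sq ip_self by simp
  then show ?thesis by simp
qed

lemma normA_nonneg: "0 \<le> normA T \<Omega> f g v0 \<sigma>0"
  unfolding normA_def by (auto intro!: add_nonneg_nonneg integral_nonneg_AE)

lemma normL2Q_eq: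
  assumes "L2 Q v" "L2 Q \<sigma>" shows "normL2Q T \<Omega> v \<sigma> = nrm Q (\<lambda>p. (v p, \<sigma> p))"
proof -
  have "normL2Q T \<Omega> v \<sigma> = sqrt ((nrm Q v)\<^sup>2 + (nrm Q \<sigma>)\<^sup>2)"
    unfolding normL2Q_def nrm_sq ip_self by simp
  also have "\<dots> = sqrt ((nrm Q (\<lambda>p. (v p, \<sigma> p)))\<^sup>2)" using nrm_sq_Pair[OF assms] by simp
  finally show ?thesis by simp
qed

text \<open>The estimate comes with the solution produced by the Riesz representation. Uniqueness
  identifies an arbitrary solution with it almost everywhere, and then the norms coincide.\<close>

lemma inV0_bound:
  assumes 1: "inV0 T \<Omega> v \<sigma> f g v0 \<sigma>0"
  shows "normL2Q T \<Omega> v \<sigma> \<le> (2 * T + 2 * sqrt T) * normA T \<Omega> f g v0 \<sigma>0"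
proof -
  have L: "L2 Q v" "L2 Q \<sigma>" "L2 Q f" "L2 Q g" "L2 \<Omega> v0" "L2 \<Omega> \<sigma>0"
    using 1 by (auto simp: inV0_def inV_def)
  obtain v' \<sigma>' where 2: "inV0 T \<Omega> v' \<sigma>' f g v0 \<sigma>0"
    and bd: "nrm Q (\<lambda>p. (v' p, \<sigma>' p)) \<le> 2 * T * nrm Q (\<lambda>p. (f p, g p)) + 2 * sqrt T * nrm \<Omega> (\<lambda>x. (v0 x, \<sigma>0 x))"
    by (rule wave_exists[OF L(3-6)]) blast
  have L': "L2 Q v'" "L2 Q \<sigma>'" using 2 by (auto simp: inV0_def inV_def)
  let ?u = "\<lambda>p. (v p, \<sigma> p)" and ?u' = "\<lambda>p. (v' p, \<sigma>' p)"
  have uL: "L2 Q ?u" "L2 Q ?u'" by (intro L2_Pair L L')+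
  have ae: "AE p in lebesgue_on Q. ?u p = ?u' p"
    using inV0_unique[OF 1 2] by eventually_elim simp
  have "ip Q ?u ?u = ip Q ?u' ?u'"
    using ip_AE_cong[OF uL(1) uL(2) uL(1) ae] ip_AE_cong[OF uL(1) uL(2) uL(2) ae] by (simp add: ip_commute)
  then have "normL2Q T \<Omega> v \<sigma> = nrm Q ?u'" by (simp add: normL2Q_eq[OF L(1,2)] nrm_def)
  also have "\<dots> \<le> 2 * T * nrm Q (\<lambda>p. (f p, g p)) + 2 * sqrt T * nrm \<Omega> (\<lambda>x. (v0 x, \<sigma>0 x))" by (rule bd)
  \<comment> \<open>Each of the two data norms collects part of the squares in \<open>normA\<close>,
    hence the sum of the two constants.\<close>
  also have "\<dots> \<le> 2 * T * normA T \<Omega> f g v0 \<sigma>0 + 2 * sqrt T * normA T \<Omega> f g v0 \<sigma>0"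
  proof (intro add_mono mult_left_mono)
    show "nrm Q (\<lambda>p. (f p, g p)) \<le> normA T \<Omega> f g v0 \<sigma>0"
      by (rule power2_le_imp_le[OF _ normA_nonneg]) (simp add: normA_sq nrm_sq_Pair[OF L(3,4)])
    show "nrm \<Omega> (\<lambda>x. (v0 x, \<sigma>0 x)) \<le> normA T \<Omega> f g v0 \<sigma>0"
      by (rule power2_le_imp_le[OF _ normA_nonneg]) (simp add: normA_sq nrm_sq_Pair[OF L(5,6)])
  qed (use T_pos in auto)
  finally show ?thesis by (simp add: distrib_right)
qed

end

theorem theorem3p5:
  fixes \<Omega> :: "(real^'d) set" and T :: real
  assumes "polygonal_lipschitz_domain \<Omega>" and "T > 0"
  shows
    \<comment> \<open>A is bounded (V_0 normed by ||.||_V)\<close>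
    "(\<forall>v \<sigma> f g v0 \<sigma>0. inV0 T \<Omega> v \<sigma> f g v0 \<sigma>0 \<longrightarrow>
        normA T \<Omega> f g v0 \<sigma>0 \<le> normV T \<Omega> v \<sigma> f g v0 \<sigma>0)
     \<and> \<comment> \<open>A is injective (elements of L2 identified a.e.)\<close>
     (\<forall>v \<sigma> v' \<sigma>' f g v0 \<sigma>0. inV0 T \<Omega> v \<sigma> f g v0 \<sigma>0 \<and> inV0 T \<Omega> v' \<sigma>' f g v0 \<sigma>0 \<longrightarrow>
        (AE p in lebesgue_on (cyl T \<Omega>). v p = v' p) \<and> (AE p in lebesgue_on (cyl T \<Omega>). \<sigma> p = \<sigma>' p))
     \<and> \<comment> \<open>A is surjective onto L2(Q) x L2(Q)^d x L2(\<Omega>) x L2(\<Omega>)^d\<close>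
     (\<forall>f g v0 \<sigma>0. L2 (cyl T \<Omega>) f \<and> L2 (cyl T \<Omega>) g \<and> L2 \<Omega> v0 \<and> L2 \<Omega> \<sigma>0 \<longrightarrow>
        (\<exists>v \<sigma>. inV0 T \<Omega> v \<sigma> f g v0 \<sigma>0))
     \<and> \<comment> \<open>the inverse is bounded\<close>
     (\<exists>C. \<forall>v \<sigma> f g v0 \<sigma>0. inV0 T \<Omega> v \<sigma> f g v0 \<sigma>0 \<longrightarrow>
        normV T \<Omega> v \<sigma> f g v0 \<sigma>0 \<le> C * normA T \<Omega> f g v0 \<sigma>0)
     \<and> \<comment> \<open>in particular\<close>
     (\<exists>C. \<forall>v \<sigma> f g v0 \<sigma>0. inV0 T \<Omega> v \<sigma> f g v0 \<sigma>0 \<longrightarrow>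
        normL2Q T \<Omega> v \<sigma> \<le> C * normA T \<Omega> f g v0 \<sigma>0)"
proof -
  interpret space_time_cylinder T \<Omega>
    using assms by unfold_locales (auto simp: polygonal_lipschitz_domain_def lipschitz_domain_def)
  define C where "C = 2 * T + 2 * sqrt T"
  have bound: "normL2Q T \<Omega> v \<sigma> \<le> C * normA T \<Omega> f g v0 \<sigma>0" if "inV0 T \<Omega> v \<sigma> f g v0 \<sigma>0" for v \<sigma> f g v0 \<sigma>0
    unfolding C_def by (rule inV0_bound[OF that])
  \<comment> \<open>A root of a sum of two squares is at most the sum of the two terms; the
    additional 1 accounts for the data norm contained in \<open>normV\<close>.\<close>
  have boundV: "normV T \<Omega> v \<sigma> f g v0 \<sigma>0 \<le> (C + 1) * normA T \<Omega> f g v0 \<sigma>0" if "inV0 T \<Omega> v \<sigma> f g v0 \<sigma>0" for v \<sigma> f g v0 \<sigma>0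
  proof -
    have "0 \<le> normL2Q T \<Omega> v \<sigma>"
      unfolding normL2Q_def by (auto intro!: add_nonneg_nonneg integral_nonneg_AE)
    then have "normV T \<Omega> v \<sigma> f g v0 \<sigma>0 \<le> normL2Q T \<Omega> v \<sigma> + normA T \<Omega> f g v0 \<sigma>0"
      unfolding normV_def using normA_nonneg by (rule sqrt_sum_squares_le_sum)
    then show ?thesis using bound[OF that] by (simp add: distrib_right)
  qed
  have le: "normA T \<Omega> f g v0 \<sigma>0 \<le> normV T \<Omega> v \<sigma> f g v0 \<sigma>0" for v \<sigma> f g v0 \<sigma>0
    unfolding normV_def by (rule real_le_rsqrt) simp
  have ex: "\<exists>v \<sigma>. inV0 T \<Omega> v \<sigma> f g v0 \<sigma>0" if "L2 (cyl T \<Omega>) f \<and> L2 (cyl T \<Omega>) g \<and> L2 \<Omega> v0 \<and> L2 \<Omega> \<sigma>0" for f g v0 \<sigma>0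
  proof -
    have "L2 (cyl T \<Omega>) f" "L2 (cyl T \<Omega>) g" "L2 \<Omega> v0" "L2 \<Omega> \<sigma>0" using that by auto
    then show ?thesis by (rule wave_exists) blast
  qed
  show ?thesis
  proof (intro conjI allI impI)
    fix v \<sigma> v' \<sigma>' f g v0 \<sigma>0
    assume "inV0 T \<Omega> v \<sigma> f g v0 \<sigma>0 \<and> inV0 T \<Omega> v' \<sigma>' f g v0 \<sigma>0"
    then have 1: "inV0 T \<Omega> v \<sigma> f g v0 \<sigma>0" and 2: "inV0 T \<Omega> v' \<sigma>' f g v0 \<sigma>0" by auto
    show "AE p in lebesgue_on (cyl T \<Omega>). v p = v' p" "AE p in lebesgue_on (cyl T \<Omega>). \<sigma> p = \<sigma>' p"
      by (rule inV0_unique[OF 1 2])+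
  next
    show "\<exists>C. \<forall>v \<sigma> f g v0 \<sigma>0. inV0 T \<Omega> v \<sigma> f g v0 \<sigma>0 \<longrightarrow> normV T \<Omega> v \<sigma> f g v0 \<sigma>0 \<le> C * normA T \<Omega> f g v0 \<sigma>0"
      by (intro exI[of _ "C + 1"] allI impI boundV)
    show "\<exists>C. \<forall>v \<sigma> f g v0 \<sigma>0. inV0 T \<Omega> v \<sigma> f g v0 \<sigma>0 \<longrightarrow> normL2Q T \<Omega> v \<sigma> \<le> C * normA T \<Omega> f g v0 \<sigma>0"
      by (intro exI[of _ C] allI impI bound)
  qed (rule le, rule ex)
qed

end
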